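(* Let $\mathcal{A}$ be an essential, central hyperplane arrangement in $V=k^{n+1}$. Then $\mathcal{A}$ is locally free if and only if $\widetilde{D^1(\mathcal{A})}$ is locally free on $\mathbf{P}^n$.
   Context: $k$ is an arbitrary field, $V=k^{n+1}$, $S=\mathrm{Sym}(V^* )$ (a standard graded polynomial ring in $n+1$ variables), $\mathbf{P}^n=\mathrm{Proj}\,S$; $\widetilde{M}$ is the sheaf on $\mathbf{P}^n$ associated to a graded $S$-module $M$. A (central) hyperplane arrangement $\mathcal{A}$ is a finite set of distinct codimension one linear subspaces of $V$. $L_{\mathcal{A}}$ is the set of all intersections of elements of $\mathcal{A}$ (including $V$, the empty intersection), with rank $=$ codimension in $V$; $\mathcal{A}$ is essential if $\mathrm{rank}\,L_{\mathcal{A}}=\dim V$. Let $Q$ be the product of linear forms, one defining each hyperplane of $\mathcal{A}$; $D^1(\mathcal{A})=\{\theta\in\mathrm{Der}_kS:\theta(Q)\in(Q)\}$. For $X\in L_{\mathcal{A}}$, $\mathcal{A}_X=\{H\in\mathcal{A}:X\subset H\}$, an arrangement in $V$. An arrangement is free if its module $D^1$ is a free $S$-module. An essential central arrangement $\mathcal{A}$ is called locally free if for every $X\in L_{\mathcal{A}}$ with $\mathrm{rank}\,X<\dim V$ the arrangement $\mathcal{A}_X$ is free. *)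

theory Defs
  imports
    "HOL-Analysis.Cartesian_Space"
    "HOL-Analysis.Abstract_Topology"
    "HOL-Library.FuncSet"
    "HOL-Library.Function_Algebras"
    "HOL-Library.Poly_Mapping"
begin

section \<open>The polynomial ring\<close>

text \<open>
  The vector space \<open>V\<close> is \<open>'k ^ 'n\<close>, so that \<open>CARD('n)\<close> is \<open>n + 1\<close>.  The dual basis of the standard
  basis identifies \<open>Sym(V\<^sup>*)\<close> with the polynomials over \<open>'k\<close> in variables indexed by \<open>'n\<close>; these are
  formal polynomials, because \<open>'k\<close> may be finite.
\<close>

type_synonym ('k, 'n) sym = "('n \<Rightarrow>\<^sub>0 nat) \<Rightarrow>\<^sub>0 'k"

definition scalar :: "'k \<Rightarrow> ('k::field, 'n) sym" where
  "scalar c = Poly_Mapping.single 0 c"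

definition var :: "'n \<Rightarrow> ('k::field, 'n) sym" where
  "var i = Poly_Mapping.single (Poly_Mapping.single i 1) 1"

definition mon_degree :: "('n::finite \<Rightarrow>\<^sub>0 nat) \<Rightarrow> nat" where
  "mon_degree m = (\<Sum>i\<in>UNIV. Poly_Mapping.lookup m i)"

definition homog :: "nat \<Rightarrow> ('k::field, 'n::finite) sym set" where
  "homog d = {f. \<forall>m\<in>Poly_Mapping.keys f. mon_degree m = d}"

interpretation ideal: module "(*) :: 'a::comm_ring_1 \<Rightarrow> 'a \<Rightarrow> 'a"
  by standard (simp_all add: algebra_simps)

lemmas [simp del] = ideal.scale_scale

section \<open>The projective spectrum\<close>

definition homog_ideal :: "('k::field, 'n::finite) sym set \<Rightarrow> bool" where
  "homog_ideal a \<longleftrightarrow> a = ideal.span {f \<in> a. \<exists>d. f \<in> homog d}"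

definition prime_ideal :: "'a::comm_ring_1 set \<Rightarrow> bool" where
  "prime_ideal p \<longleftrightarrow>
     ideal.subspace p \<and> p \<noteq> UNIV \<and> (\<forall>f g. f * g \<in> p \<longrightarrow> f \<in> p \<or> g \<in> p)"

definition irrelevant_ideal :: "('k::field, 'n::finite) sym set" where
  "irrelevant_ideal = ideal.span (\<Union>d\<in>{0<..}. homog d)"

definition Proj :: "('k::field, 'n::finite) sym set set" where
  "Proj = {p. prime_ideal p \<and> homog_ideal p \<and> \<not> irrelevant_ideal \<subseteq> p}"

definition zariski_closed :: "('k::field, 'n::finite) sym set \<Rightarrow> ('k, 'n) sym set set" where
  "zariski_closed a = {p \<in> Proj. a \<subseteq> p}"

definition proj_topology :: "('k::field, 'n::finite) sym set topology" where
  "proj_topology = topology (\<lambda>U. \<exists>a. homog_ideal a \<and> U = Proj - zariski_closed a)"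

lemma homog_ideal_span:
  assumes "E \<subseteq> (\<Union>d. homog d)"
  shows "homog_ideal (ideal.span E)"
proof -
  have "E \<subseteq> {f \<in> ideal.span E. \<exists>d. f \<in> homog d}"
    using assms by (auto intro: ideal.span_base)
  hence "ideal.span E \<subseteq> ideal.span {f \<in> ideal.span E. \<exists>d. f \<in> homog d}"
    by (rule ideal.span_mono)
  moreover have "ideal.span {f \<in> ideal.span E. \<exists>d. f \<in> homog d} \<subseteq> ideal.span E"
    by (rule ideal.span_minimal) auto
  ultimately show ?thesis
    unfolding homog_ideal_def by (rule equalityI)
qed

lemma homog_mult:
  assumes "f \<in> homog d" "g \<in> homog e"
  shows "f * g \<in> homog (d + e)"
proof -
  have "mon_degree m = d + e" if "m \<in> Poly_Mapping.keys (f * g)" for m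
  proof -
    from that obtain a b where "m = a + b" "a \<in> Poly_Mapping.keys f" "b \<in> Poly_Mapping.keys g"
      using keys_mult[of f g] by auto
    with assms show ?thesis
      by (simp add: homog_def mon_degree_def lookup_add sum.distrib)
  qed
  thus ?thesis by (simp add: homog_def)
qed

lemma span_subset_iff:
  "ideal.subspace p \<Longrightarrow> ideal.span E \<subseteq> p \<longleftrightarrow> E \<subseteq> p"
  using ideal.span_minimal ideal.span_superset by blast

lemma homog_ideal_generators:
  assumes "homog_ideal a"
  shows "\<exists>E. E \<subseteq> (\<Union>d. homog d) \<and> a = ideal.span E"
proof (intro exI conjI)
  show "a = ideal.span {f \<in> a. \<exists>d. f \<in> homog d}"
    by (rule assms[unfolded homog_ideal_def])
qed auto

lemma istopology_proj:
  "istopology (\<lambda>U. \<exists>a::('k::field, 'n::finite) sym set. homog_ideal a \<and> U = Proj - zariski_closed a)"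
  unfolding istopology_def
proof (intro conjI allI impI)
  fix S T :: "('k, 'n) sym set set"
  assume "\<exists>a. homog_ideal a \<and> S = Proj - zariski_closed a"
    and "\<exists>a. homog_ideal a \<and> T = Proj - zariski_closed a"
  then obtain a b where a: "homog_ideal a" "S = Proj - zariski_closed a"
    and b: "homog_ideal b" "T = Proj - zariski_closed b"
    by blast
  obtain E where E: "E \<subseteq> (\<Union>d. homog d)" "a = ideal.span E"
    using homog_ideal_generators[OF a(1)] by blast
  obtain F where F: "F \<subseteq> (\<Union>d. homog d)" "b = ideal.span F"
    using homog_ideal_generators[OF b(1)] by blast
  define P where "P = {f * g | f g. f \<in> E \<and> g \<in> F}"
  have "P \<subseteq> (\<Union>d. homog d)"
  proof
    fix h assume "h \<in> P"
    then obtain f g d e where "h = f * g" "f \<in> homog d" "g \<in> homog e"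
      using E(1) F(1) unfolding P_def by blast
    thus "h \<in> (\<Union>d. homog d)"
      using homog_mult by blast
  qed
  hence hom: "homog_ideal (ideal.span P)"
    by (rule homog_ideal_span)
  have "ideal.span P \<subseteq> p \<longleftrightarrow> a \<subseteq> p \<or> b \<subseteq> p" if "p \<in> Proj" for p
  proof -
    have p: "prime_ideal p" and sp: "ideal.subspace p"
      using that by (auto simp: Proj_def prime_ideal_def)
    have mem: "f * g \<in> p \<longleftrightarrow> f \<in> p \<or> g \<in> p" for f g
      using p ideal.subspace_scale[OF sp, of f g] ideal.subspace_scale[OF sp, of g f]
      by (auto simp: prime_ideal_def mult.commute)
    have "P \<subseteq> p \<longleftrightarrow> (\<forall>f\<in>E. \<forall>g\<in>F. f \<in> p \<or> g \<in> p)"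
      unfolding P_def mem[symmetric] by blast
    thus ?thesis
      unfolding E(2) F(2) span_subset_iff[OF sp] by blast
  qed
  hence "S \<inter> T = Proj - zariski_closed (ideal.span P)"
    unfolding a(2) b(2) zariski_closed_def by blast
  with hom show "\<exists>a. homog_ideal a \<and> S \<inter> T = Proj - zariski_closed a"
    by blast
next
  fix \<K> :: "('k, 'n) sym set set set"
  assume "\<forall>K\<in>\<K>. \<exists>a. homog_ideal a \<and> K = Proj - zariski_closed a"
  hence "\<forall>K\<in>\<K>. \<exists>E. E \<subseteq> (\<Union>d. homog d) \<and> K = Proj - zariski_closed (ideal.span E)"
    using homog_ideal_generators by metis
  then obtain E where E: "\<And>K. K \<in> \<K> \<Longrightarrow> E K \<subseteq> (\<Union>d. homog d)"
    and K: "\<And>K. K \<in> \<K> \<Longrightarrow> K = Proj - zariski_closed (ideal.span (E K))"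
    by metis
  have "(\<Union>K\<in>\<K>. E K) \<subseteq> (\<Union>d. homog d)"
    using E by (rule UN_least)
  hence hom: "homog_ideal (ideal.span (\<Union>K\<in>\<K>. E K))"
    by (rule homog_ideal_span)
  have "p \<in> \<Union>\<K> \<longleftrightarrow> p \<in> Proj - zariski_closed (ideal.span (\<Union>K\<in>\<K>. E K))" for p
  proof (cases "p \<in> Proj")
    case True
    hence sp: "ideal.subspace p"
      by (auto simp: Proj_def prime_ideal_def)
    have "p \<in> K \<longleftrightarrow> \<not> E K \<subseteq> p" if "K \<in> \<K>" for K
      using True by (subst K[OF that]) (simp add: zariski_closed_def span_subset_iff[OF sp])
    with True show ?thesis
      by (simp add: zariski_closed_def span_subset_iff[OF sp] UN_subset_iff)
  next
    case False
    thus ?thesis using K by blast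
  qed
  hence "\<Union>\<K> = Proj - zariski_closed (ideal.span (\<Union>K\<in>\<K>. E K))"
    by (rule set_eqI)
  with hom show "\<exists>a. homog_ideal a \<and> \<Union>\<K> = Proj - zariski_closed a"
    by blast
qed

lemma openin_proj_topology:
  "openin proj_topology U \<longleftrightarrow> (\<exists>a. homog_ideal a \<and> U = Proj - zariski_closed a)"
  unfolding proj_topology_def by (simp only: topology_inverse'[OF istopology_proj])

section \<open>Presheaves of modules and local freeness\<close>

text \<open>
  The record carries the data of a presheaf of modules: sections over an open set, their addition,
  the action of the sections of a presheaf of rings, and the restriction \<open>pres F U W\<close> from \<open>U\<close> to \<open>W\<close>.
  A presheaf of rings is presented as a module over itself, its multiplication being \<open>pscale\<close>.
\<close>

record ('x, 'r, 's) module_presheaf =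
  psec :: "'x set \<Rightarrow> 's set"
  padd :: "'x set \<Rightarrow> 's \<Rightarrow> 's \<Rightarrow> 's"
  pscale :: "'x set \<Rightarrow> 'r \<Rightarrow> 's \<Rightarrow> 's"
  pres :: "'x set \<Rightarrow> 'x set \<Rightarrow> 's \<Rightarrow> 's"

text \<open>The direct sum of \<open>r\<close> copies.\<close>

definition free_presheaf ::
  "('x, 'r, 'r) module_presheaf \<Rightarrow> nat \<Rightarrow> ('x, 'r, nat \<Rightarrow> 'r) module_presheaf" where
  "free_presheaf R r =
    \<lparr> psec = (\<lambda>U. PiE {..<r} (\<lambda>_. psec R U)),
      padd = (\<lambda>U s t. \<lambda>i\<in>{..<r}. padd R U (s i) (t i)),
      pscale = (\<lambda>U c s. \<lambda>i\<in>{..<r}. pscale R U c (s i)),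
      pres = (\<lambda>U W s. \<lambda>i\<in>{..<r}. pres R U W (s i)) \<rparr>"

text \<open>Isomorphism of the restrictions of \<open>F\<close> and \<open>G\<close> to the open set \<open>U\<close>, over the restriction of \<open>R\<close>.\<close>

definition module_iso_on ::
  "'x topology \<Rightarrow> ('x, 'r, 'r) module_presheaf \<Rightarrow> 'x set \<Rightarrow>
   ('x, 'r, 's) module_presheaf \<Rightarrow> ('x, 'r, 't) module_presheaf \<Rightarrow> bool" where
  "module_iso_on T R U F G \<longleftrightarrow>
    (\<exists>\<phi>. \<forall>W. openin T W \<and> W \<subseteq> U \<longrightarrow>
       bij_betw (\<phi> W) (psec F W) (psec G W) \<and>
       (\<forall>s\<in>psec F W. \<forall>t\<in>psec F W. \<phi> W (padd F W s t) = padd G W (\<phi> W s) (\<phi> W t)) \<and>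
       (\<forall>c\<in>psec R W. \<forall>s\<in>psec F W. \<phi> W (pscale F W c s) = pscale G W c (\<phi> W s)) \<and>
       (\<forall>W'. openin T W' \<and> W' \<subseteq> W \<longrightarrow>
          (\<forall>s\<in>psec F W. \<phi> W' (pres F W W' s) = pres G W W' (\<phi> W s))))"

definition locally_free_sheaf ::
  "'x topology \<Rightarrow> ('x, 'r, 'r) module_presheaf \<Rightarrow> ('x, 'r, 's) module_presheaf \<Rightarrow> bool" where
  "locally_free_sheaf T R F \<longleftrightarrow>
    (\<forall>x\<in>topspace T. \<exists>U r. openin T U \<and> x \<in> U \<and> module_iso_on T R U (free_presheaf R r) F)"

section \<open>The sheaf associated to a graded module\<close>

text \<open>
  A graded module is given by its scalar multiplication \<open>sc\<close> and its homogeneous components \<open>G d\<close>.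
  An element of the degree zero localization at \<open>p\<close> is the class of the pairs \<open>(m, s)\<close> representing
  the fraction \<open>m/s\<close>, where \<open>m\<close> and \<open>s\<close> are homogeneous of the same degree and \<open>s \<notin> p\<close>.
\<close>

definition hfractions ::
  "(nat \<Rightarrow> 'm set) \<Rightarrow> ('k::field, 'n::finite) sym set \<Rightarrow> ('m \<times> ('k, 'n) sym) set" where
  "hfractions G p = {(m, s). \<exists>d. m \<in> G d \<and> s \<in> homog d \<and> s \<notin> p}"

definition hfraction_rel ::
  "(('k::field, 'n::finite) sym \<Rightarrow> 'm \<Rightarrow> 'm) \<Rightarrow> (nat \<Rightarrow> 'm set) \<Rightarrow> ('k, 'n) sym set \<Rightarrow>
   (('m \<times> ('k, 'n) sym) \<times> ('m \<times> ('k, 'n) sym)) set" where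
  "hfraction_rel sc G p =
    {((m, s), (m', s')). (m, s) \<in> hfractions G p \<and> (m', s') \<in> hfractions G p \<and>
       (\<exists>u e. u \<in> homog e \<and> u \<notin> p \<and> sc u (sc s' m) = sc u (sc s m'))}"

definition hlocalization ::
  "(('k::field, 'n::finite) sym \<Rightarrow> 'm \<Rightarrow> 'm) \<Rightarrow> (nat \<Rightarrow> 'm set) \<Rightarrow> ('k, 'n) sym set \<Rightarrow>
   ('m \<times> ('k, 'n) sym) set set" where
  "hlocalization sc G p = hfractions G p // hfraction_rel sc G p"

definition hfrac ::
  "(('k::field, 'n::finite) sym \<Rightarrow> 'm \<Rightarrow> 'm) \<Rightarrow> (nat \<Rightarrow> 'm set) \<Rightarrow> ('k, 'n) sym set \<Rightarrow>
   'm \<Rightarrow> ('k, 'n) sym \<Rightarrow> ('m \<times> ('k, 'n) sym) set" where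
  "hfrac sc G p m s = hfraction_rel sc G p `` {(m, s)}"

definition hadd ::
  "(('k::field, 'n::finite) sym \<Rightarrow> 'm::plus \<Rightarrow> 'm) \<Rightarrow> (nat \<Rightarrow> 'm set) \<Rightarrow> ('k, 'n) sym set \<Rightarrow>
   ('m \<times> ('k, 'n) sym) set \<Rightarrow> ('m \<times> ('k, 'n) sym) set \<Rightarrow> ('m \<times> ('k, 'n) sym) set" where
  "hadd sc G p x y =
    (\<Union>(m, s)\<in>x. \<Union>(m', s')\<in>y. hfrac sc G p (sc s' m + sc s m') (s * s'))"

definition hscale ::
  "(('k::field, 'n::finite) sym \<Rightarrow> 'm \<Rightarrow> 'm) \<Rightarrow> (nat \<Rightarrow> 'm set) \<Rightarrow> ('k, 'n) sym set \<Rightarrow>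
   (('k, 'n) sym \<times> ('k, 'n) sym) set \<Rightarrow> ('m \<times> ('k, 'n) sym) set \<Rightarrow> ('m \<times> ('k, 'n) sym) set" where
  "hscale sc G p c x = (\<Union>(f, t)\<in>c. \<Union>(m, s)\<in>x. hfrac sc G p (sc f m) (t * s))"

text \<open>
  A section over \<open>U\<close> is a function assigning to each \<open>p \<in> U\<close> an element of the degree zero
  localization at \<open>p\<close> which is locally given by a single fraction.
\<close>

definition tilde_sections ::
  "(('k::field, 'n::finite) sym \<Rightarrow> 'm \<Rightarrow> 'm) \<Rightarrow> (nat \<Rightarrow> 'm set) \<Rightarrow> ('k, 'n) sym set set \<Rightarrow>
   (('k, 'n) sym set \<Rightarrow> ('m \<times> ('k, 'n) sym) set) set" where
  "tilde_sections sc G U =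
    {\<sigma> \<in> PiE U (hlocalization sc G).
       \<forall>p\<in>U. \<exists>W d m s. openin proj_topology W \<and> p \<in> W \<and> W \<subseteq> U \<and> m \<in> G d \<and> s \<in> homog d \<and>
         (\<forall>q\<in>W. s \<notin> q \<and> \<sigma> q = hfrac sc G q m s)}"

definition tilde ::
  "(('k::field, 'n::finite) sym \<Rightarrow> 'm::plus \<Rightarrow> 'm) \<Rightarrow> (nat \<Rightarrow> 'm set) \<Rightarrow>
   (('k, 'n) sym set, ('k, 'n) sym set \<Rightarrow> (('k, 'n) sym \<times> ('k, 'n) sym) set,
    ('k, 'n) sym set \<Rightarrow> ('m \<times> ('k, 'n) sym) set) module_presheaf" where
  "tilde sc G =
    \<lparr> psec = tilde_sections sc G,
      padd = (\<lambda>U \<sigma> \<tau>. \<lambda>p\<in>U. hadd sc G p (\<sigma> p) (\<tau> p)),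
      pscale = (\<lambda>U c \<sigma>. \<lambda>p\<in>U. hscale sc G p (c p) (\<sigma> p)),
      pres = (\<lambda>U W \<sigma>. restrict \<sigma> W) \<rparr>"

definition structure_sheaf ::
  "(('k::field, 'n::finite) sym set, ('k, 'n) sym set \<Rightarrow> (('k, 'n) sym \<times> ('k, 'n) sym) set,
    ('k, 'n) sym set \<Rightarrow> (('k, 'n) sym \<times> ('k, 'n) sym) set) module_presheaf" where
  "structure_sheaf = tilde (*) homog"

section \<open>Hyperplane arrangements\<close>

definition arrangement :: "('k::field ^ 'n::finite) set set \<Rightarrow> bool" where
  "arrangement A \<longleftrightarrow> finite A \<and> (\<forall>H\<in>A. vec.subspace H \<and> vec.dim H + 1 = CARD('n))"

definition intersection_lattice :: "('k::field ^ 'n::finite) set set \<Rightarrow> ('k ^ 'n) set set" where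
  "intersection_lattice A = {\<Inter>B | B. B \<subseteq> A}"

definition codim :: "('k::field ^ 'n::finite) set \<Rightarrow> nat" where
  "codim X = CARD('n) - vec.dim X"

definition essential :: "('k::field ^ 'n::finite) set set \<Rightarrow> bool" where
  "essential A \<longleftrightarrow> Max (codim ` intersection_lattice A) = CARD('n)"

definition subarrangement ::
  "('k::field ^ 'n::finite) set set \<Rightarrow> ('k ^ 'n) set \<Rightarrow> ('k ^ 'n) set set" where
  "subarrangement A X = {H \<in> A. X \<subseteq> H}"

definition linear_form :: "'k ^ 'n \<Rightarrow> ('k::field, 'n::finite) sym" where
  "linear_form a = (\<Sum>i\<in>UNIV. scalar (a $ i) * var i)"

text \<open>The choice only affects the form, and hence their product, by a nonzero constant factor.\<close>

definition hyperplane_form :: "('k::field ^ 'n::finite) set \<Rightarrow> ('k, 'n) sym" where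
  "hyperplane_form H =
    linear_form (SOME a. H = {v. (\<Sum>i\<in>UNIV. a $ i * v $ i) = 0})"

definition defining_poly :: "('k::field ^ 'n::finite) set set \<Rightarrow> ('k, 'n) sym" where
  "defining_poly A = (\<Prod>H\<in>A. hyperplane_form H)"

section \<open>Logarithmic derivations\<close>

definition Der :: "(('k::field, 'n::finite) sym \<Rightarrow> ('k, 'n) sym) set" where
  "Der = {\<theta>. (\<forall>f g. \<theta> (f + g) = \<theta> f + \<theta> g) \<and>
             (\<forall>c f. \<theta> (scalar c * f) = scalar c * \<theta> f) \<and>
             (\<forall>f g. \<theta> (f * g) = f * \<theta> g + \<theta> f * g)}"

definition der_scale :: "'a::comm_ring_1 \<Rightarrow> ('b \<Rightarrow> 'a) \<Rightarrow> 'b \<Rightarrow> 'a" where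
  "der_scale f \<theta> = (\<lambda>g. f * \<theta> g)"

interpretation der: module "der_scale :: 'a::comm_ring_1 \<Rightarrow> ('b \<Rightarrow> 'a) \<Rightarrow> 'b \<Rightarrow> 'a"
  by standard (simp_all add: der_scale_def fun_eq_iff algebra_simps)

definition D1 ::
  "('k::field ^ 'n::finite) set set \<Rightarrow> (('k, 'n) sym \<Rightarrow> ('k, 'n) sym) set" where
  "D1 A = {\<theta> \<in> Der. \<theta> (defining_poly A) \<in> ideal.span {defining_poly A}}"

text \<open>
  Polynomial degree: \<open>\<theta> = \<Sum>i. \<theta> (var i) \<partial>\<^sub>i\<close> has degree \<open>d\<close> when its coefficients have degree \<open>d\<close>, so
  that the derivations \<open>\<partial>\<^sub>i\<close> have degree 0.  Another convention shifts the grading, which replaces the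
  associated sheaf by a twist.
\<close>

definition D1_component ::
  "('k::field ^ 'n::finite) set set \<Rightarrow> nat \<Rightarrow> (('k, 'n) sym \<Rightarrow> ('k, 'n) sym) set" where
  "D1_component A d = {\<theta> \<in> D1 A. \<forall>i. \<theta> (var i) \<in> homog d}"

definition free_arrangement :: "('k::field ^ 'n::finite) set set \<Rightarrow> bool" where
  "free_arrangement A \<longleftrightarrow>
    (\<exists>B :: (('k, 'n) sym \<Rightarrow> ('k, 'n) sym) set. \<not> der.dependent B \<and> der.span B = D1 A)"

definition locally_free_arrangement :: "('k::field ^ 'n::finite) set set \<Rightarrow> bool" where
  "locally_free_arrangement A \<longleftrightarrow>
    (\<forall>X\<in>intersection_lattice A. codim X < CARD('n) \<longrightarrow> free_arrangement (subarrangement A X))"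

end

theory Submission
  imports Defs "HOL-Analysis.Determinants" "HOL-Computational_Algebra.Polynomial"
begin

text \<open>
  A derivation is logarithmic iff \<open>\<theta>(l\<^sub>H)\<close> is divisible by the form \<open>l\<^sub>H\<close> of each hyperplane.  At a prime
  \<open>p\<close> the forms outside \<open>p\<close> become units, so near \<open>p\<close> the module \<open>D\<^sup>1(A)\<close> agrees with \<open>D\<^sup>1(A\<^sub>X)\<close>, where \<open>X\<close>
  is the intersection of the hyperplanes whose form lies in \<open>p\<close>.

  If \<open>D\<^sup>1(A\<^sub>X)\<close> has a basis, the determinants of tuples of homogeneous elements, divided by that of the
  basis, generate the unit ideal by multilinearity.  One of them is not in \<open>p\<close>, and by Cramer's rule
  its tuple is a frame near \<open>p\<close>.

  Conversely, apply local freeness at the prime \<open>p\<close> of forms vanishing on \<open>X\<close>.  In coordinates \<open>(y, z)\<close> with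
  \<open>X = {y = 0}\<close> the module \<open>D\<^sup>1(A\<^sub>X)\<close> is generated by elements with coefficients in \<open>k[y]\<close>, homogeneous in
  \<open>y\<close>.  By multilinearity again, some tuple \<open>\<tau>\<close> of such elements has a determinant that divides all other
  determinants up to a factor \<open>u\<close> not in \<open>p\<close>.  Some monomial of \<open>u\<close> is free of \<open>y\<close>; comparing the parts
  of the right degree in \<open>y\<close> at this monomial removes \<open>u\<close>, and \<open>\<tau>\<close> is a basis by Saito's criterion.
\<close>

section \<open>Polynomials and derivations\<close>

text \<open>A basis of \<open>D\<^sup>1(A\<^sub>X)\<close> need not be homogeneous, whereas sections
  of the sheaf are fractions of degree zero, so the basis itself cannot serve as a local frame. This
  is why homogeneous tuples are compared with it through determinants: it suffices that the quotient
  of the two determinants is a unit at \<open>p\<close>. The tuple found in this way has mixed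
  degrees, which powers of a variable outside \<open>p\<close> raise to a common one.

  In the converse the obstacle is that a frame at \<open>p\<close> controls
  \<open>D\<^sup>1(A\<^sub>X)\<close> only after localization, while freeness over the whole ring is
  wanted. Tuples with coefficients in \<open>k[y]\<close> overcome it, since denominators outside
  \<open>p\<close> can be recognized by their monomials in \<open>z\<close> alone. The rank of the
  frame is not given either; it is forced to be \<open>n + 1\<close> because the defining polynomial
  times each partial derivative is logarithmic. That the rank of \<open>X\<close> is below the
  dimension of \<open>V\<close> is what makes \<open>p\<close> a point of Proj: a nonzero vector in
  \<open>X\<close> leaves at least one variable \<open>z\<close>.\<close>

definition eval_hom ::
  "('k::field \<Rightarrow> 'r::comm_ring_1) \<Rightarrow> ('n::finite \<Rightarrow> 'r) \<Rightarrow> ('k, 'n) sym \<Rightarrow> 'r" where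
  "eval_hom \<kappa> \<sigma> f =
    (\<Sum>m\<in>Poly_Mapping.keys f. \<kappa> (Poly_Mapping.lookup f m) * (\<Prod>i\<in>UNIV. \<sigma> i ^ Poly_Mapping.lookup m i))"

definition coeff_hom :: "('k::field \<Rightarrow> 'r::comm_ring_1) \<Rightarrow> bool" where
  "coeff_hom \<kappa> \<longleftrightarrow> (\<forall>a b. \<kappa> (a + b) = \<kappa> a + \<kappa> b) \<and> (\<forall>a b. \<kappa> (a * b) = \<kappa> a * \<kappa> b) \<and> \<kappa> 1 = 1"

lemma coeff_hom_zero: "coeff_hom \<kappa> \<Longrightarrow> \<kappa> 0 = 0"
  unfolding coeff_hom_def by (metis add_cancel_left_right add_0)

lemma eval_hom_superset:
  assumes "coeff_hom \<kappa>" "finite K" "Poly_Mapping.keys f \<subseteq> K"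
  shows "eval_hom \<kappa> \<sigma> f =
    (\<Sum>m\<in>K. \<kappa> (Poly_Mapping.lookup f m) * (\<Prod>i\<in>UNIV. \<sigma> i ^ Poly_Mapping.lookup m i))"
  unfolding eval_hom_def
  by (rule sum.mono_neutral_left[OF assms(2,3)])
     (auto simp: in_keys_iff coeff_hom_zero[OF assms(1)])

lemma eval_hom_add:
  assumes "coeff_hom \<kappa>"
  shows "eval_hom \<kappa> \<sigma> (f + g) = eval_hom \<kappa> \<sigma> f + eval_hom \<kappa> \<sigma> g"
proof -
  let ?K = "Poly_Mapping.keys f \<union> Poly_Mapping.keys g"
  have K: "finite ?K" by simp
  have add: "\<kappa> (a + b) = \<kappa> a + \<kappa> b" for a b using assms by (simp add: coeff_hom_def)
  show ?thesis
    using eval_hom_superset[OF assms K, of f \<sigma>] eval_hom_superset[OF assms K, of g \<sigma>]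
      eval_hom_superset[OF assms K, of "f + g" \<sigma>] Poly_Mapping.keys_add[of f g]
    by (simp add: lookup_add add sum.distrib algebra_simps)
qed

lemma eval_hom_single:
  assumes "coeff_hom \<kappa>"
  shows "eval_hom \<kappa> \<sigma> (Poly_Mapping.single m c) =
    \<kappa> c * (\<Prod>i\<in>UNIV. \<sigma> i ^ Poly_Mapping.lookup m i)"
  using eval_hom_superset[OF assms, of "{m}" "Poly_Mapping.single m c" \<sigma>] by simp

lemma sym_induct [case_names single add]:
  fixes f :: "('k::field, 'n) sym"
  assumes "\<And>m c. P (Poly_Mapping.single m c)" "\<And>f g. P f \<Longrightarrow> P g \<Longrightarrow> P (f + g)"
  shows "P f"
proof (induction f rule: update_induct)
  case const
  show ?case using assms(1)[of 0 0] by simp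
next
  case (update f a b)
  have "Poly_Mapping.update a b f = f + Poly_Mapping.single a b"
    using update(1) by (intro poly_mapping_eqI)
      (auto simp: lookup_update lookup_add lookup_single when_def in_keys_iff)
  thus ?case using assms update by metis
qed

lemma eval_hom_zero: "eval_hom \<kappa> \<sigma> 0 = 0"
  by (simp add: eval_hom_def)

lemma eval_hom_mult:
  fixes f g :: "('k::field, 'n::finite) sym"
  assumes \<kappa>: "coeff_hom \<kappa>"
  shows "eval_hom \<kappa> \<sigma> (f * g) = eval_hom \<kappa> \<sigma> f * eval_hom \<kappa> \<sigma> g"
proof (induction f rule: sym_induct)
  case (single m c)
  show ?case
  proof (induction g rule: sym_induct)
    case (single m' c')
    have "\<kappa> (c * c') = \<kappa> c * \<kappa> c'" using \<kappa> by (simp add: coeff_hom_def)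
    thus ?case
      by (simp add: mult_single eval_hom_single[OF \<kappa>] lookup_add power_add prod.distrib)
  next
    case (add f g)
    thus ?case by (simp add: distrib_left eval_hom_add[OF \<kappa>])
  qed
next
  case (add f f')
  thus ?case by (simp add: distrib_right eval_hom_add[OF \<kappa>])
qed

lemma eval_hom_var:
  assumes "coeff_hom \<kappa>"
  shows "eval_hom \<kappa> \<sigma> (var i) = \<sigma> i"
proof -
  have "\<kappa> 1 = 1" using assms by (simp add: coeff_hom_def)
  moreover have "(\<Prod>j\<in>UNIV. \<sigma> j ^ Poly_Mapping.lookup (Poly_Mapping.single i 1) j) = (\<Prod>j\<in>UNIV. if i = j then \<sigma> j else 1)"
    by (rule prod.cong) (auto simp: lookup_single when_def)
  ultimately show ?thesis
    by (simp add: var_def eval_hom_single[OF assms])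
qed

lemma eval_hom_scalar:
  assumes "coeff_hom \<kappa>"
  shows "eval_hom \<kappa> \<sigma> (scalar c) = \<kappa> c"
  by (simp add: scalar_def eval_hom_single[OF assms])

lemma eval_hom_one:
  assumes "coeff_hom \<kappa>"
  shows "eval_hom \<kappa> \<sigma> 1 = 1"
  using eval_hom_scalar[OF assms, of \<sigma> 1] assms by (simp add: scalar_def coeff_hom_def)

lemma eval_hom_sum:
  assumes "coeff_hom \<kappa>"
  shows "eval_hom \<kappa> \<sigma> (sum h K) = (\<Sum>x\<in>K. eval_hom \<kappa> \<sigma> (h x))"
  by (induction K rule: infinite_finite_induct)
     (auto simp: eval_hom_zero eval_hom_add[OF assms])

lemma scalar_add: "scalar (a + b) = scalar a + scalar b"
  by (simp add: scalar_def single_add)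

lemma scalar_mult: "scalar (a * b) = scalar a * scalar b"
  by (simp add: scalar_def mult_single)

lemma scalar_0 [simp]: "scalar 0 = 0"
  by (simp add: scalar_def)

lemma scalar_1 [simp]: "scalar 1 = 1"
  by (simp add: scalar_def)

lemma coeff_hom_scalar: "coeff_hom scalar"
  by (simp add: coeff_hom_def scalar_add scalar_mult)

lemma var_power: "var i ^ d = Poly_Mapping.single (Poly_Mapping.single i d) 1"
  by (induction d) (simp_all add: var_def mult_single single_add[symmetric])

lemma single_prod_one:
  "finite K \<Longrightarrow> (\<Prod>i\<in>K. Poly_Mapping.single (h i) (1::'k::field)) = Poly_Mapping.single (sum h K) 1"
  by (induction K rule: finite_induct) (auto simp: mult_single)

lemma monomial_expansion:
  fixes m :: "'n::finite \<Rightarrow>\<^sub>0 nat"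
  shows "m = (\<Sum>i\<in>UNIV. Poly_Mapping.single i (Poly_Mapping.lookup m i))"
  by (rule poly_mapping_eqI) (simp add: lookup_sum lookup_single when_def)

lemma single_expansion:
  fixes c :: "'k::field" and m :: "'n::finite \<Rightarrow>\<^sub>0 nat"
  shows "Poly_Mapping.single m c = scalar c * (\<Prod>i\<in>UNIV. var i ^ Poly_Mapping.lookup m i)"
  using monomial_expansion[of m]
  by (simp add: var_power single_prod_one scalar_def mult_single)

lemma eval_hom_id: "eval_hom scalar var f = f"
proof (induction f rule: sym_induct)
  case (single m c)
  show ?case using eval_hom_single[OF coeff_hom_scalar, of var m c] single_expansion[of m c] by metis
next
  case (add f g)
  thus ?case by (simp add: eval_hom_add[OF coeff_hom_scalar])
qed

text \<open>Uniqueness in the universal property of the polynomial ring. It identifies composites by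
  their values on scalars and variables: the constant term of a deformation in
  \<open>Der_exists\<close>, and inverse changes of coordinates in
  \<open>eval_hom_inverse\<close>.\<close>

lemma hom_eq_eval_hom:
  fixes \<phi> :: "('k::field, 'n::finite) sym \<Rightarrow> 'r::comm_ring_1"
  assumes "\<And>f g. \<phi> (f + g) = \<phi> f + \<phi> g" "\<And>f g. \<phi> (f * g) = \<phi> f * \<phi> g" "\<phi> 1 = 1"
  shows "\<phi> f = eval_hom (\<lambda>c. \<phi> (scalar c)) (\<lambda>i. \<phi> (var i)) f"
proof -
  have \<kappa>: "coeff_hom (\<lambda>c. \<phi> (scalar c))"
    using assms by (simp add: coeff_hom_def scalar_add scalar_mult)
  have pow: "\<phi> (g ^ d) = \<phi> g ^ d" for g d
    by (induction d) (simp_all add: assms)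
  have prd: "\<phi> (prod h K) = (\<Prod>x\<in>K. \<phi> (h x))" if "finite K" for h :: "'n \<Rightarrow> _" and K
    using that by (induction K rule: finite_induct) (auto simp: assms)
  show ?thesis
  proof (induction f rule: sym_induct)
    case (single m c)
    show ?case
      by (simp add: eval_hom_single[OF \<kappa>]) (simp add: single_expansion[of m c] assms prd pow)
  next
    case (add f g)
    thus ?case by (simp add: eval_hom_add[OF \<kappa>] assms)
  qed
qed

text \<open>Variables are enumerated by natural numbers because the library shows that polynomials have no
  zero divisors only for a linearly ordered set of variables.\<close>

lemma sym_no_zero_divisors:
  fixes f g :: "('k::field, 'n::finite) sym"
  assumes "f * g = 0"
  shows "f = 0 \<or> g = 0"
proof -
  obtain idx :: "'n \<Rightarrow> nat" where idx: "inj idx"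
    using finite_imp_inj_to_nat_seg[of "UNIV :: 'n set"] by auto
  define \<kappa> :: "'k \<Rightarrow> (nat \<Rightarrow>\<^sub>0 nat) \<Rightarrow>\<^sub>0 'k" where "\<kappa> = Poly_Mapping.single 0"
  define \<sigma> :: "'n \<Rightarrow> (nat \<Rightarrow>\<^sub>0 nat) \<Rightarrow>\<^sub>0 'k"
    where "\<sigma> i = Poly_Mapping.single (Poly_Mapping.single (idx i) 1) 1" for i
  define enc :: "('n \<Rightarrow>\<^sub>0 nat) \<Rightarrow> nat \<Rightarrow>\<^sub>0 nat"
    where "enc m = (\<Sum>i\<in>UNIV. Poly_Mapping.single (idx i) (Poly_Mapping.lookup m i))" for m
  have \<kappa>: "coeff_hom \<kappa>" by (simp add: coeff_hom_def \<kappa>_def single_add mult_single)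
  have look: "Poly_Mapping.lookup (enc m) (idx j) = Poly_Mapping.lookup m j" for m j
  proof -
    have "Poly_Mapping.lookup (enc m) (idx j) = (\<Sum>i\<in>UNIV. if i = j then Poly_Mapping.lookup m i else 0)"
      unfolding enc_def lookup_sum
      by (rule sum.cong) (auto simp: lookup_single when_def inj_eq[OF idx])
    thus ?thesis by simp
  qed
  have enc: "enc m = enc m' \<longleftrightarrow> m = m'" for m m'
    by (metis look poly_mapping_eqI)
  have pow: "\<sigma> i ^ d = Poly_Mapping.single (Poly_Mapping.single (idx i) d) 1" for i d
    by (induction d) (simp_all add: \<sigma>_def mult_single single_add[symmetric])
  have ev: "eval_hom \<kappa> \<sigma> h = (\<Sum>m\<in>Poly_Mapping.keys h. Poly_Mapping.single (enc m) (Poly_Mapping.lookup h m))" for h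
    unfolding eval_hom_def
    by (simp add: pow single_prod_one enc_def[symmetric] \<kappa>_def mult_single)
  \<comment> \<open>\<open>enc\<close> is injective on exponents, so nothing cancels and each
    coefficient of \<open>h\<close> survives at its encoded exponent.\<close>
  have inj: "h = 0" if "eval_hom \<kappa> \<sigma> h = 0" for h
  proof (rule poly_mapping_eqI)
    fix m
    have "Poly_Mapping.lookup (eval_hom \<kappa> \<sigma> h) (enc m) =
      (\<Sum>m'\<in>Poly_Mapping.keys h. if m' = m then Poly_Mapping.lookup h m' else 0)"
      unfolding ev lookup_sum
      by (rule sum.cong) (auto simp: lookup_single when_def enc)
    also have "\<dots> = Poly_Mapping.lookup h m" by (simp add: in_keys_iff)
    finally show "Poly_Mapping.lookup h m = Poly_Mapping.lookup 0 m" using that by simp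
  qed
  have "eval_hom \<kappa> \<sigma> f * eval_hom \<kappa> \<sigma> g = 0"
    using assms eval_hom_mult[OF \<kappa>, of \<sigma> f g] by (simp add: eval_hom_zero)
  hence "eval_hom \<kappa> \<sigma> f = 0 \<or> eval_hom \<kappa> \<sigma> g = 0" by simp
  thus ?thesis using inj by blast
qed

lemma sym_mult_cancel:
  fixes f g h :: "('k::field, 'n::finite) sym"
  assumes "h \<noteq> 0" "h * f = h * g"
  shows "f = g"
  using sym_no_zero_divisors[of h "f - g"] assms by (simp add: right_diff_distrib)

section \<open>Derivations of the polynomial ring\<close>

lemma Der_zero: "\<theta> \<in> Der \<Longrightarrow> \<theta> 0 = 0"
  unfolding Der_def by (metis (mono_tags, lifting) add_cancel_right_left add_0 mem_Collect_eq)

lemma Der_add: "\<theta> \<in> Der \<Longrightarrow> \<theta> (f + g) = \<theta> f + \<theta> g"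
  by (simp add: Der_def)

lemma Der_mult: "\<theta> \<in> Der \<Longrightarrow> \<theta> (f * g) = f * \<theta> g + \<theta> f * g"
  by (simp add: Der_def)

lemma Der_scalar: "\<theta> \<in> Der \<Longrightarrow> \<theta> (scalar c * f) = scalar c * \<theta> f"
  unfolding Der_def by blast

lemma Der_sum: "\<theta> \<in> Der \<Longrightarrow> \<theta> (sum h K) = (\<Sum>x\<in>K. \<theta> (h x))"
  by (induction K rule: infinite_finite_induct) (auto simp: Der_zero Der_add)

lemma Der_linear_form:
  "\<theta> \<in> Der \<Longrightarrow> \<theta> (linear_form a) = (\<Sum>i\<in>UNIV. scalar (a $ i) * \<theta> (var i))"
  by (simp add: linear_form_def Der_sum Der_scalar)

lemma subspace_Der: "der.subspace (Der :: (('k::field, 'n::finite) sym \<Rightarrow> ('k, 'n) sym) set)"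
  by (auto simp: module.subspace_def[OF der.module_axioms] Der_def der_scale_def algebra_simps)

lemma Der_eqI:
  fixes \<theta> \<theta>' :: "('k::field, 'n::finite) sym \<Rightarrow> ('k, 'n) sym"
  assumes "\<theta> \<in> Der" "\<theta>' \<in> Der" "\<And>i. \<theta> (var i) = \<theta>' (var i)"
  shows "\<theta> = \<theta>'"
proof
  fix f
  have one: "\<eta> 1 = 0" if "\<eta> \<in> Der" for \<eta> :: "('k, 'n) sym \<Rightarrow> ('k, 'n) sym"
    using Der_mult[OF that, of 1 1] by simp
  have pow: "\<theta> (var i ^ d) = \<theta>' (var i ^ d)" for i d
    by (induction d) (simp_all add: assms one Der_mult)
  have prd: "\<theta> (\<Prod>i\<in>K. var i ^ Poly_Mapping.lookup m i) = \<theta>' (\<Prod>i\<in>K. var i ^ Poly_Mapping.lookup m i)"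
    if "finite K" for K m
    using that by (induction K rule: finite_induct) (simp_all add: assms one Der_mult pow)
  show "\<theta> f = \<theta>' f"
  proof (induction f rule: sym_induct)
    case (single m c)
    show ?case by (simp add: single_expansion[of m c] Der_scalar assms prd)
  next
    case (add f g)
    thus ?case by (simp add: Der_add assms)
  qed
qed

text \<open>The derivation is the coefficient of \<open>t\<close> in the homomorphism \<open>x\<^sub>i \<mapsto> x\<^sub>i + c\<^sub>i t\<close>.\<close>

lemma Der_exists:
  fixes c :: "'n::finite \<Rightarrow> ('k::field, 'n) sym"
  shows "\<exists>\<theta>\<in>Der. \<forall>i. \<theta> (var i) = c i"
proof -
  define h where "h = eval_hom (\<lambda>a::'k. [:scalar a:]) (\<lambda>i. [:var i, c i:])"
  have \<kappa>: "coeff_hom (\<lambda>a::'k. [:scalar a :: ('k, 'n) sym:])"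
    by (simp add: coeff_hom_def scalar_add scalar_mult)
  \<comment> \<open>Once the constant term of \<open>h f\<close> is \<open>f\<close>, comparing
    coefficients of \<open>t\<close> in \<open>h f * h g\<close> is the Leibniz rule.\<close>
  have "coeff (h f) 0 = f" for f
  proof -
    have "coeff (h f) 0 = eval_hom scalar var f"
      using hom_eq_eval_hom[of "\<lambda>f. coeff (h f) 0" f]
      by (simp add: h_def eval_hom_add[OF \<kappa>] eval_hom_mult[OF \<kappa>] coeff_mult_0
          eval_hom_one[OF \<kappa>] eval_hom_scalar[OF \<kappa>] eval_hom_var[OF \<kappa>])
    thus ?thesis by (simp add: eval_hom_id)
  qed
  hence "(\<lambda>f. coeff (h f) 1) \<in> Der"
    by (simp add: Der_def h_def eval_hom_add[OF \<kappa>] eval_hom_mult[OF \<kappa>] eval_hom_scalar[OF \<kappa>]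
        coeff_mult)
  moreover have "coeff (h (var i)) 1 = c i" for i
    by (simp add: h_def eval_hom_var[OF \<kappa>])
  ultimately show ?thesis by (intro bexI) auto
qed

section \<open>Determinants of derivations\<close>

text \<open>Fraction-free Gaussian elimination: cross-multiplying with one equation removes an
  unknown, and the absence of zero divisors keeps the lifted solution nontrivial. It is applied to
  polynomials and to scalars alike.\<close>

lemma homogeneous_system:
  fixes a :: "'i \<Rightarrow> 'j \<Rightarrow> 'r::comm_ring_1"
  assumes nz: "\<And>x y::'r. x * y = 0 \<Longrightarrow> x = 0 \<or> y = 0"
    and "finite I" "finite J" "card I < card J"
  shows "\<exists>c. (\<exists>j\<in>J. c j \<noteq> 0) \<and> (\<forall>i\<in>I. (\<Sum>j\<in>J. a i j * c j) = 0)"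
  using assms(2-)
proof (induction I arbitrary: a J rule: finite_induct)
  case empty
  hence "J \<noteq> {}" by auto
  thus ?case by (intro exI[of _ "\<lambda>_. 1"]) auto
next
  case (insert i0 I)
  show ?case
  proof (cases "\<forall>j\<in>J. a i0 j = 0")
    case True
    have "card I < card J" using insert by simp
    from insert.IH[OF insert.prems(1) this, of a] True show ?thesis by auto
  next
    case False
    then obtain j0 where j0: "j0 \<in> J" "a i0 j0 \<noteq> 0" by blast
    let ?J = "J - {j0}"
    have "finite ?J" "card I < card ?J"
      using insert j0 by auto
    from insert.IH[OF this, of "\<lambda>i j. a i0 j0 * a i j - a i j0 * a i0 j"]
    obtain c' where c': "\<exists>j\<in>?J. c' j \<noteq> 0"
      "\<And>i. i \<in> I \<Longrightarrow> (\<Sum>j\<in>?J. (a i0 j0 * a i j - a i j0 * a i0 j) * c' j) = 0" by blast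
    \<comment> \<open>The other unknowns are multiplied by the pivot \<open>a i0 j0\<close>, so that
      equation \<open>i0\<close> can be solved for the unknown \<open>j0\<close> without
      dividing.\<close>
    define c where "c j = (if j = j0 then - (\<Sum>j\<in>?J. a i0 j * c' j) else a i0 j0 * c' j)" for j
    have split: "(\<Sum>j\<in>J. a i j * c j) =
        a i j0 * (- (\<Sum>j\<in>?J. a i0 j * c' j)) + (\<Sum>j\<in>?J. a i j * (a i0 j0 * c' j))" for i
    proof -
      have "(\<Sum>j\<in>J. a i j * c j) = a i j0 * c j0 + (\<Sum>j\<in>?J. a i j * c j)"
        using insert.prems(1) j0(1) by (rule sum.remove)
      also have "(\<Sum>j\<in>?J. a i j * c j) = (\<Sum>j\<in>?J. a i j * (a i0 j0 * c' j))"
        by (rule sum.cong) (auto simp: c_def)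
      finally show ?thesis by (simp add: c_def)
    qed
    have "(\<Sum>j\<in>J. a i j * c j) = (\<Sum>j\<in>?J. (a i0 j0 * a i j - a i j0 * a i0 j) * c' j)" for i
      unfolding split by (simp add: sum_distrib_left sum_subtractf algebra_simps)
    hence "(\<Sum>j\<in>J. a i j * c j) = 0" if "i \<in> insert i0 I" for i
      using that c'(2) by auto
    moreover have "\<exists>j\<in>J. c j \<noteq> 0"
      using c'(1) nz j0(2) by (auto simp: c_def)
    ultimately show ?thesis by blast
  qed
qed

definition der_of :: "('n::finite \<Rightarrow> ('k::field, 'n) sym) \<Rightarrow> ('k, 'n) sym \<Rightarrow> ('k, 'n) sym" where
  "der_of c = (SOME \<theta>. \<theta> \<in> Der \<and> (\<forall>i. \<theta> (var i) = c i))"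

lemma der_of_Der [simp]: "der_of c \<in> Der" and der_of_var [simp]: "der_of c (var i) = c i"
proof -
  have "\<exists>\<theta>. \<theta> \<in> Der \<and> (\<forall>i. \<theta> (var i) = c i)" using Der_exists[of c] by blast
  from someI_ex[OF this] show "der_of c \<in> Der" "der_of c (var i) = c i"
    unfolding der_of_def by blast+
qed

text \<open>The Saito determinant: row \<open>i\<close> lists the coefficients of
  \<open>\<theta> i\<close> with respect to the partial derivatives.\<close>

definition jac :: "('n::finite \<Rightarrow> ('k::field, 'n) sym \<Rightarrow> ('k, 'n) sym) \<Rightarrow> ('k, 'n) sym" where
  "jac \<theta> = det (\<chi> i j. \<theta> i (var j))"

lemma sum_fun_apply: "(\<Sum>x\<in>K. f x) y = (\<Sum>x\<in>K. f x y)"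
  by (induction K rule: infinite_finite_induct) auto

lemma jac_fun_upd:
  "jac (\<theta>(k := a)) = det (\<chi> i. if i = k then (\<chi> j. a (var j)) else (\<chi> j. \<theta> i (var j)))"
  unfolding jac_def by (rule arg_cong[of _ _ det]) (simp add: vec_eq_iff)

lemma jac_sum:
  assumes "finite K"
  shows "jac (\<theta>(k := \<Sum>x\<in>K. der_scale (c x) (\<eta> x))) = (\<Sum>x\<in>K. c x * jac (\<theta>(k := \<eta> x)))"
proof -
  have eq: "(\<chi> j. (\<Sum>x\<in>K. der_scale (c x) (\<eta> x)) (var j)) = (\<Sum>x\<in>K. c x *s (\<chi> j. \<eta> x (var j)))"
    by (simp add: vec_eq_iff sum_fun_apply der_scale_def sum_component)
  show ?thesis
    unfolding jac_fun_upd eq using det_linear_row_sum[OF assms, of k "\<lambda>_ x. c x *s (\<chi> j. \<eta> x (var j))" "\<lambda>i. \<chi> j. \<theta> i (var j)"]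
    by (simp add: det_row_mul)
qed

lemma jac_add: "jac (\<theta>(k := a + b)) = jac (\<theta>(k := a)) + jac (\<theta>(k := b))"
proof -
  have eq: "(\<chi> j. (a + b) (var j)) = (\<chi> j. a (var j)) + (\<chi> j. b (var j))"
    by (simp add: vec_eq_iff)
  show ?thesis
    unfolding jac_fun_upd eq using det_row_add[of k "\<lambda>_. \<chi> j. a (var j)" "\<lambda>_. \<chi> j. b (var j)"] by simp
qed

lemma jac_scale: "jac (\<theta>(k := der_scale c a)) = c * jac (\<theta>(k := a))"
  using jac_sum[of "{()}" \<theta> k "\<lambda>_. c" "\<lambda>_. a"] by simp

lemma jac_zero: "jac (\<theta>(k := 0)) = 0"
  using jac_sum[of "{}" \<theta> k] by simp

lemma jac_identical: "i \<noteq> j \<Longrightarrow> \<theta> i = \<theta> j \<Longrightarrow> jac \<theta> = 0"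
  unfolding jac_def by (rule det_identical_rows[of i j]) (simp_all add: row_def)

text \<open>Every term of the expansion along row \<open>k\<close>, except the \<open>k\<close>-th,
  repeats a row. Reading off coefficients in this way yields both independence and Cramer's
  rule.\<close>

lemma jac_combination:
  "jac (\<theta>(k := \<Sum>i\<in>UNIV. der_scale (c i) (\<theta> i))) = c k * jac \<theta>"
proof -
  have "jac (\<theta>(k := \<theta> i)) = 0" if "i \<noteq> k" for i
    using that by (intro jac_identical[of i k]) auto
  hence "(\<Sum>i\<in>UNIV. c i * jac (\<theta>(k := \<theta> i))) = (\<Sum>i\<in>UNIV. if i = k then c k * jac \<theta> else 0)"
    by (intro sum.cong) auto
  thus ?thesis by (simp add: jac_sum)
qed

lemma jac_independent:
  assumes "jac \<theta> \<noteq> 0" "(\<Sum>i\<in>UNIV. der_scale (c i) (\<theta> i)) = 0"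
  shows "c i = 0"
  using jac_combination[of \<theta> i c] assms sym_no_zero_divisors[of "c i" "jac \<theta>"] by (simp add: jac_zero)

lemma jac_product:
  assumes "\<And>i. \<eta> i = (\<Sum>j\<in>UNIV. der_scale (c i j) (\<tau> j))"
  shows "jac \<eta> = det (\<chi> i j. c i j) * jac \<tau>"
proof -
  have "(\<chi> i j. \<eta> i (var j)) = (\<chi> i j. c i j) ** (\<chi> i j. \<tau> i (var j))"
    by (simp add: vec_eq_iff matrix_matrix_mult_def assms sum_fun_apply der_scale_def)
  thus ?thesis by (simp add: jac_def det_mul)
qed

text \<open>Multilinearity, one row after another: in the induction \<open>K\<close> holds the rows
  not yet known to lie in \<open>T\<close>. Read backwards, it produces generators: if some tuple in
  the span has its determinant outside \<open>J\<close>, then so does some tuple in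
  \<open>T\<close>.\<close>

lemma jac_span:
  assumes J: "ideal.subspace J" and T: "\<And>\<tau>. range \<tau> \<subseteq> T \<Longrightarrow> jac \<tau> \<in> J"
    and "range \<eta> \<subseteq> der.span T"
  shows "jac \<eta> \<in> J"
proof -
  have "jac \<eta> \<in> J" if "finite K" "\<And>i. i \<notin> K \<Longrightarrow> \<eta> i \<in> T" "range \<eta> \<subseteq> der.span T" for K \<eta>
    using that
  proof (induction K arbitrary: \<eta> rule: finite_induct)
    case empty
    thus ?case by (intro T) auto
  next
    case (insert k K)
    have "jac (\<eta>(k := a)) \<in> J" if "a \<in> der.span T" for a
      using that
    proof (induction rule: der.span_induct_alt)
      case base
      show ?case unfolding jac_zero by (rule ideal.subspace_0[OF J])
    next
      case (step c x y)
      have "jac (\<eta>(k := x)) \<in> J"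
        using insert.prems step(1) der.span_base[of x T]
        by (intro insert.IH) (auto simp: image_subset_iff)
      with step(2) show ?case
        unfolding jac_add jac_scale by (intro ideal.subspace_add[OF J] ideal.subspace_scale[OF J])
    qed
    from this[of "\<eta> k"] insert.prems(2) show ?case by auto
  qed
  from this[of UNIV \<eta>] assms(3) show ?thesis by auto
qed

lemma der_relation_iff:
  assumes "\<And>j. j \<in> J \<Longrightarrow> \<theta> j \<in> Der"
  shows "(\<Sum>j\<in>J. der_scale (c j) (\<theta> j)) = 0 \<longleftrightarrow> (\<forall>i. (\<Sum>j\<in>J. \<theta> j (var i) * c j) = 0)"
proof
  assume "\<forall>i. (\<Sum>j\<in>J. \<theta> j (var i) * c j) = 0"
  moreover have "(\<Sum>j\<in>J. der_scale (c j) (\<theta> j)) \<in> Der"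
    by (intro der.subspace_sum der.subspace_scale subspace_Der assms)
  moreover have "0 \<in> Der" by (rule der.subspace_0[OF subspace_Der])
  ultimately show "(\<Sum>j\<in>J. der_scale (c j) (\<theta> j)) = 0"
    by (intro Der_eqI) (simp_all add: sum_fun_apply der_scale_def mult.commute)
next
  assume eq: "(\<Sum>j\<in>J. der_scale (c j) (\<theta> j)) = 0"
  show "\<forall>i. (\<Sum>j\<in>J. \<theta> j (var i) * c j) = 0"
  proof
    fix i
    have "(\<Sum>j\<in>J. der_scale (c j) (\<theta> j)) (var i) = 0" by (simp add: eq)
    thus "(\<Sum>j\<in>J. \<theta> j (var i) * c j) = 0"
      by (simp add: sum_fun_apply der_scale_def mult.commute)
  qed
qed

text \<open>The \<open>\<tau> i\<close> and \<open>\<eta>\<close> together are one more than the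
  number of variables, hence related. The coefficient of \<open>\<eta>\<close> is nonzero because
  the \<open>\<tau> i\<close> are independent; \<open>jac_combination\<close> expresses the others
  through it, and it cancels in the end.\<close>

lemma jac_cramer:
  assumes "\<And>i. \<tau> i \<in> Der" "\<eta> \<in> Der" "jac \<tau> \<noteq> 0"
  shows "der_scale (jac \<tau>) \<eta> = (\<Sum>i\<in>UNIV. der_scale (jac (\<tau>(i := \<eta>))) (\<tau> i))"
proof -
  define \<theta> where "\<theta> j = (case j of None \<Rightarrow> \<eta> | Some i \<Rightarrow> \<tau> i)" for j
  have \<theta>: "\<theta> j \<in> Der" for j using assms by (cases j) (auto simp: \<theta>_def)
  have "card (UNIV :: 'a set) < card (UNIV :: 'a option set)" by simp
  then obtain c where c: "\<exists>j. c j \<noteq> 0" "\<And>i. (\<Sum>j\<in>UNIV. \<theta> j (var i) * c j) = 0"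
    using homogeneous_system[OF sym_no_zero_divisors, of "UNIV :: 'a set" "UNIV :: 'a option set" "\<lambda>i j. \<theta> j (var i)"]
    by auto
  have "(\<Sum>j\<in>UNIV. der_scale (c j) (\<theta> j)) = 0"
    using der_relation_iff[of UNIV \<theta> c] \<theta> c(2) by blast
  hence rel: "der_scale (c None) \<eta> + (\<Sum>i\<in>UNIV. der_scale (c (Some i)) (\<tau> i)) = 0"
    by (simp add: UNIV_option_conv sum.reindex \<theta>_def)
  have "c None \<noteq> 0"
  proof
    assume 0: "c None = 0"
    hence "c (Some i) = 0" for i
      using rel jac_independent[OF assms(3), of "\<lambda>i. c (Some i)"] by simp
    with 0 c(1) show False by (metis option.exhaust)
  qed
  from rel have eq: "der_scale (c None) \<eta> = (\<Sum>i\<in>UNIV. der_scale (- c (Some i)) (\<tau> i))"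
    by (simp add: eq_neg_iff_add_eq_0 sum_negf)
  have "c None * jac (\<tau>(i := \<eta>)) = - c (Some i) * jac \<tau>" for i
    using jac_combination[of \<tau> i "\<lambda>i. - c (Some i)"] unfolding eq[symmetric] jac_scale .
  hence "der_scale (c None) (\<Sum>i\<in>UNIV. der_scale (jac (\<tau>(i := \<eta>))) (\<tau> i)) =
      (\<Sum>i\<in>UNIV. der_scale (jac \<tau>) (der_scale (- c (Some i)) (\<tau> i)))"
    by (simp add: der.scale_sum_right der.scale_scale mult.commute)
  also have "\<dots> = der_scale (c None) (der_scale (jac \<tau>) \<eta>)"
    unfolding der.scale_sum_right[symmetric] eq[symmetric] by (simp add: der.scale_scale mult.commute)
  finally show ?thesis
    using sym_mult_cancel[OF \<open>c None \<noteq> 0\<close>] by (auto simp: der_scale_def fun_eq_iff)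
qed

lemma rank_le:
  fixes \<theta> :: "'j \<Rightarrow> ('k::field, 'n::finite) sym \<Rightarrow> ('k, 'n) sym"
  assumes "finite J" "\<And>j. j \<in> J \<Longrightarrow> \<theta> j \<in> Der"
    and "\<And>c j. (\<Sum>j\<in>J. der_scale (c j) (\<theta> j)) = 0 \<Longrightarrow> j \<in> J \<Longrightarrow> c j = 0"
  shows "card J \<le> CARD('n)"
proof (rule ccontr)
  assume "\<not> ?thesis"
  then obtain c where c: "\<exists>j\<in>J. c j \<noteq> 0" "\<And>i. (\<Sum>j\<in>J. \<theta> j (var i) * c j) = 0"
    using homogeneous_system[OF sym_no_zero_divisors, of "UNIV :: 'n set" J "\<lambda>i j. \<theta> j (var i)"]
      assms(1) by auto
  with der_relation_iff[of J \<theta> c] assms show False by blast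
qed

text \<open>The premise \<open>eq\<close> writes \<open>q i\<close> times the \<open>i\<close>-th
  partial derivative as a combination of the \<open>\<theta> j\<close>. With too few
  \<open>\<theta> j\<close> some nonzero \<open>b\<close> is orthogonal to all columns of
  \<open>c\<close>, and then \<open>b l * q l = 0\<close> for every \<open>l\<close>.\<close>

lemma rank_ge:
  fixes \<theta> :: "'j \<Rightarrow> ('k::field, 'n::finite) sym \<Rightarrow> ('k, 'n) sym"
  assumes "finite J" "\<And>i. q i \<noteq> 0" 
    and eq: "\<And>i l. (\<Sum>j\<in>J. c i j * \<theta> j (var l)) = (if l = i then q i else 0)"
  shows "CARD('n) \<le> card J"
proof (rule ccontr)
  assume "\<not> ?thesis"
  then obtain b where b: "\<exists>i. b i \<noteq> 0" "\<And>j. j \<in> J \<Longrightarrow> (\<Sum>i\<in>UNIV. c i j * b i) = 0"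
    using homogeneous_system[OF sym_no_zero_divisors, of J "UNIV :: 'n set" "\<lambda>j i. c i j"]
      assms(1) by auto
  have "b l * q l = 0" for l
  proof -
    have "b l * q l = (\<Sum>i\<in>UNIV. if l = i then b l * q l else 0)" by simp
    also have "\<dots> = (\<Sum>i\<in>UNIV. b i * (\<Sum>j\<in>J. c i j * \<theta> j (var l)))"
      unfolding eq by (rule sum.cong) auto
    also have "\<dots> = (\<Sum>j\<in>J. (\<Sum>i\<in>UNIV. c i j * b i) * \<theta> j (var l))"
      unfolding sum_distrib_left sum_distrib_right by (subst sum.swap) (simp add: algebra_simps)
    also have "\<dots> = 0" using b(2) by simp
    finally show ?thesis .
  qed
  with b(1) assms(2) sym_no_zero_divisors show False by blast
qed

text \<open>The matrix \<open>c\<close> times the coefficient matrix is diagonal with the nonzero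
  entries \<open>q i\<close>.\<close>

lemma jac_nonzero:
  fixes \<theta> :: "'n::finite \<Rightarrow> ('k::field, 'n::finite) sym \<Rightarrow> ('k, 'n) sym"
  assumes "\<And>i. q i \<noteq> 0"
    and eq: "\<And>i l. (\<Sum>j\<in>UNIV. c i j * \<theta> j (var l)) = (if l = i then q i else 0)"
  shows "jac \<theta> \<noteq> 0"
proof
  assume 0: "jac \<theta> = 0"
  have "(\<chi> i l. if l = i then q i else 0) = (\<chi> i j. c i j) ** (\<chi> i j. \<theta> i (var j))"
    by (simp add: vec_eq_iff matrix_matrix_mult_def eq)
  hence "det (\<chi> i l. if l = i then q i else 0) = 0"
    using 0 by (simp add: jac_def det_mul)
  hence p: "(\<Prod>i\<in>UNIV. q i) = 0"
    by (subst (asm) det_diagonal) auto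
  have "(\<Prod>i\<in>K. q i) \<noteq> 0" if "finite K" for K
    using that
  proof (induction K rule: finite_induct)
    case (insert i K)
    hence "(\<Prod>i\<in>insert i K. q i) = q i * (\<Prod>i\<in>K. q i)" by simp
    with assms(1)[of i] insert.IH sym_no_zero_divisors show ?case by metis
  qed simp
  from this[of UNIV] p show False by simp
qed

text \<open>Saito's criterion.\<close>

lemma basis_of_jac_dvd:
  fixes \<tau> :: "'n::finite \<Rightarrow> ('k::field, 'n) sym \<Rightarrow> ('k, 'n) sym"
  assumes D: "der.subspace D" "D \<subseteq> Der" and \<tau>: "\<And>i. \<tau> i \<in> D" "jac \<tau> \<noteq> 0"
    and dvd: "\<And>\<eta>. range \<eta> \<subseteq> D \<Longrightarrow> jac \<tau> dvd jac \<eta>"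
  shows "\<exists>B. \<not> der.dependent B \<and> der.span B = D"
proof (intro exI conjI)
  have inj: "inj \<tau>"
    by (rule injI) (metis \<tau>(2) jac_identical)
  show "\<not> der.dependent (range \<tau>)"
  proof
    assume "der.dependent (range \<tau>)"
    then obtain u where u: "\<exists>v\<in>range \<tau>. u v \<noteq> 0" "(\<Sum>v\<in>range \<tau>. der_scale (u v) v) = 0"
      using der.dependent_finite[of "range \<tau>"] by auto
    have "(\<Sum>i\<in>UNIV. der_scale (u (\<tau> i)) (\<tau> i)) = 0"
      using u(2) by (simp add: sum.reindex[OF inj])
    with jac_independent[OF \<tau>(2), of "\<lambda>i. u (\<tau> i)"] u(1) show False by auto
  qed
  show "der.span (range \<tau>) = D"
  proof
    show "der.span (range \<tau>) \<subseteq> D"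
      using \<tau>(1) D(1) by (intro der.span_minimal) auto
    show "D \<subseteq> der.span (range \<tau>)"
    proof
      fix \<eta> assume \<eta>: "\<eta> \<in> D"
      \<comment> \<open>Cramer's coefficients are themselves determinants of tuples in
        \<open>D\<close>, so \<open>jac \<tau>\<close> can be cancelled from Cramer's
        identity.\<close>
      have "\<exists>w. jac (\<tau>(i := \<eta>)) = jac \<tau> * w" for i
        using dvd[of "\<tau>(i := \<eta>)"] \<tau>(1) \<eta> by (auto simp: dvd_def)
      then obtain w where w: "\<And>i. jac (\<tau>(i := \<eta>)) = jac \<tau> * w i" by metis
      have "der_scale (jac \<tau>) \<eta> = (\<Sum>i\<in>UNIV. der_scale (jac \<tau>) (der_scale (w i) (\<tau> i)))"
        using jac_cramer[of \<tau> \<eta>] \<tau> \<eta> D(2) w by (auto simp: der.scale_scale)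
      hence "der_scale (jac \<tau>) \<eta> = der_scale (jac \<tau>) (\<Sum>i\<in>UNIV. der_scale (w i) (\<tau> i))"
        by (simp add: der.scale_sum_right)
      hence "\<eta> = (\<Sum>i\<in>UNIV. der_scale (w i) (\<tau> i))"
        using sym_mult_cancel[OF \<tau>(2)] by (auto simp: der_scale_def fun_eq_iff)
      thus "\<eta> \<in> der.span (range \<tau>)"
        by (auto intro!: der.span_sum der.span_scale intro: der.span_base)
    qed
  qed
qed

text \<open>A basis comes as a set of unknown size. Independence bounds its finite subsets by the
  number of variables, which makes it finite; the multiples of the partial derivatives in its span
  force equality and a nonzero determinant.\<close>

lemma basis_indexed:
  fixes B :: "(('k::field, 'n::finite) sym \<Rightarrow> ('k, 'n) sym) set"
  assumes B: "\<not> der.dependent B" "der.span B \<subseteq> Der"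
    and q: "q \<noteq> 0" "\<And>i. der_scale q (der_of (\<lambda>j. if j = i then 1 else 0)) \<in> der.span B"
  shows "\<exists>b :: 'n \<Rightarrow> _. bij_betw b UNIV B \<and> jac b \<noteq> 0"
proof -
  have BD: "B \<subseteq> Der" using B(2) der.span_superset by blast
  have le: "card C \<le> CARD('n)" if "finite C" "C \<subseteq> B" for C
  proof (rule rank_le[of C "\<lambda>v. v"])
    fix c j assume "(\<Sum>j\<in>C. der_scale (c j) j) = 0" "j \<in> C"
    thus "c j = 0" using B(1) that unfolding der.dependent_explicit by blast
  qed (use that BD in auto)
  have fin: "finite B"
  proof (rule ccontr)
    assume "infinite B"
    then obtain C where "finite C" "C \<subseteq> B" "card C = CARD('n) + 1"
      using infinite_arbitrarily_large by blast
    with le[of C] show False by simp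
  qed
  have "\<exists>c. der_scale q (der_of (\<lambda>j. if j = i then 1 else 0)) = (\<Sum>v\<in>B. der_scale (c v) v)" for i
    using q(2)[of i] unfolding der.span_finite[OF fin] by auto
  hence "\<forall>i. \<exists>c. der_scale q (der_of (\<lambda>j. if j = i then 1 else 0)) = (\<Sum>v\<in>B. der_scale (c v) v)"
    by (rule allI)
  from choice[OF this] obtain c
    where c: "der_scale q (der_of (\<lambda>j. if j = i then 1 else 0)) = (\<Sum>v\<in>B. der_scale (c i v) v)" for i
    by fast
  have eq: "(\<Sum>v\<in>B. c i v * v (var l)) = (if l = i then q else 0)" for i l
    using fun_cong[OF c[of i], of "var l"] by (simp add: sum_fun_apply der_scale_def split: if_splits)
  have "CARD('n) \<le> card B"
    by (rule rank_ge[OF fin, of "\<lambda>_. q" c "\<lambda>v. v"]) (use q eq in auto)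
  with le[OF fin] have "CARD('n) = card B" by simp
  then obtain b :: "'n \<Rightarrow> _" where b: "bij_betw b UNIV B"
    using fin by (metis finite bij_betw_iff_card)
  have "jac b \<noteq> 0"
  proof (rule jac_nonzero[of "\<lambda>_. q" "\<lambda>i j. c i (b j)"])
    show "(\<Sum>j\<in>UNIV. c i (b j) * b j (var l)) = (if l = i then q else 0)" for i l
      using sum.reindex_bij_betw[OF b, of "\<lambda>v. c i v * v (var l)"] eq by simp
  qed (use q in auto)
  with b show ?thesis by blast
qed

section \<open>Graded pieces and linear forms\<close>

definition mon_restrict :: "'n set \<Rightarrow> ('n::finite \<Rightarrow>\<^sub>0 nat) \<Rightarrow> 'n \<Rightarrow>\<^sub>0 nat" where
  "mon_restrict I m = (\<Sum>i\<in>I. Poly_Mapping.single i (Poly_Mapping.lookup m i))"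

lemma lookup_mon_restrict:
  "Poly_Mapping.lookup (mon_restrict I m) i = (if i \<in> I then Poly_Mapping.lookup m i else 0)"
proof -
  have "Poly_Mapping.lookup (mon_restrict I m) i = (\<Sum>j\<in>I. if j = i then Poly_Mapping.lookup m i else 0)"
    unfolding mon_restrict_def lookup_sum by (rule sum.cong) (auto simp: lookup_single)
  thus ?thesis by simp
qed

lemma mon_restrict_add: "mon_restrict I (m + m') = mon_restrict I m + mon_restrict I m'"
  by (rule poly_mapping_eqI) (simp add: lookup_mon_restrict lookup_add)

lemma mon_restrict_UNIV [simp]: "mon_restrict UNIV m = m"
  by (rule poly_mapping_eqI) (simp add: lookup_mon_restrict)

lemma mon_restrict_empty [simp]: "mon_restrict {} m = 0"
  by (simp add: mon_restrict_def)

lemma mon_restrict_idem [simp]: "mon_restrict I (mon_restrict I m) = mon_restrict I m"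
  by (rule poly_mapping_eqI) (simp add: lookup_mon_restrict)

lemma mon_restrict_compl: "mon_restrict (- I) m + mon_restrict I m = m"
  by (rule poly_mapping_eqI) (simp add: lookup_mon_restrict lookup_add)

lemma mon_restrict_compl_0: "mon_restrict I m = m \<Longrightarrow> mon_restrict (- I) m = 0"
  using mon_restrict_compl[of I m] by simp

lemma mon_degree_add: "mon_degree (m + m') = mon_degree m + mon_degree m'"
  by (simp add: mon_degree_def lookup_add sum.distrib)

lemma mon_degree_0 [simp]: "mon_degree 0 = 0"
  by (simp add: mon_degree_def)

lemma mon_degree_eq_0_iff: "mon_degree m = 0 \<longleftrightarrow> m = 0"
  by (auto simp: mon_degree_def poly_mapping_eq_iff fun_eq_iff)

text \<open>The exponent outside \<open>I\<close> is kept whole, whereas inside \<open>I\<close>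
  only the degree is recorded. Parts sorted in this way have coefficients in \<open>k[y]\<close> and
  are compatible with multiplication by forms in \<open>k[y]\<close>.\<close>

definition bidegree :: "'n set \<Rightarrow> ('n::finite \<Rightarrow>\<^sub>0 nat) \<Rightarrow> ('n \<Rightarrow>\<^sub>0 nat) \<times> nat" where
  "bidegree I m = (mon_restrict (- I) m, mon_degree (mon_restrict I m))"

text \<open>With \<open>y\<close> the variables in \<open>I\<close> and \<open>z\<close> the others, \<open>slice I (b, d) f\<close> is the part of degree \<open>d\<close>
  of the coefficient in \<open>k[y]\<close> of the monomial \<open>z\<^sup>b\<close>, so that \<open>slice UNIV (0, d) f\<close> is the homogeneous
  component of degree \<open>d\<close>; and \<open>forms I d\<close> are the forms of degree \<open>d\<close> in \<open>k[y]\<close>.\<close>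

definition slice :: "'n set \<Rightarrow> ('n \<Rightarrow>\<^sub>0 nat) \<times> nat \<Rightarrow> ('k::field, 'n::finite) sym \<Rightarrow> ('k, 'n) sym" where
  "slice I x f = (\<Sum>m\<in>Poly_Mapping.keys f. if bidegree I m = x
     then Poly_Mapping.single (mon_restrict I m) (Poly_Mapping.lookup f m) else 0)"

definition forms :: "'n set \<Rightarrow> nat \<Rightarrow> ('k::field, 'n::finite) sym set" where
  "forms I d = {f. \<forall>m\<in>Poly_Mapping.keys f. mon_restrict I m = m \<and> mon_degree m = d}"

lemma homog_forms: "homog d = forms UNIV d"
  by (simp add: homog_def forms_def)

lemma forms_subset_homog: "forms I d \<subseteq> homog d"
  by (auto simp: homog_def forms_def)

lemma slice_superset:
  assumes "finite K" "Poly_Mapping.keys f \<subseteq> K"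
  shows "slice I x f = (\<Sum>m\<in>K. if bidegree I m = x
     then Poly_Mapping.single (mon_restrict I m) (Poly_Mapping.lookup f m) else 0)"
  unfolding slice_def
  by (rule sum.mono_neutral_left[OF assms]) (auto simp: in_keys_iff)

lemma slice_add: "slice I x (f + g) = slice I x f + slice I x g"
proof -
  let ?K = "Poly_Mapping.keys f \<union> Poly_Mapping.keys g"
  show ?thesis
    using slice_superset[of ?K f I x] slice_superset[of ?K g I x] slice_superset[of ?K "f + g" I x]
      Poly_Mapping.keys_add[of f g]
    by (simp add: sum.distrib[symmetric] lookup_add single_add if_distrib cong: if_cong sum.cong)
qed

lemma slice_zero [simp]: "slice I x 0 = 0"
  by (simp add: slice_def)

lemma slice_sum: "slice I x (sum h K) = (\<Sum>j\<in>K. slice I x (h j))"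
  by (induction K rule: infinite_finite_induct) (auto simp: slice_add)

lemma slice_single:
  "slice I x (Poly_Mapping.single m c) =
    (if bidegree I m = x then Poly_Mapping.single (mon_restrict I m) c else 0)"
  using slice_superset[of "{m}" "Poly_Mapping.single m c" I x] by simp

lemma forms_zero [simp]: "0 \<in> forms I d"
  by (simp add: forms_def)

lemma forms_add: "f \<in> forms I d \<Longrightarrow> g \<in> forms I d \<Longrightarrow> f + g \<in> forms I d"
  using Poly_Mapping.keys_add[of f g] by (force simp: forms_def)

lemma forms_sum: "(\<And>j. j \<in> K \<Longrightarrow> h j \<in> forms I d) \<Longrightarrow> sum h K \<in> forms I d"
  by (induction K rule: infinite_finite_induct) (auto simp: forms_add)

lemma forms_single: "mon_restrict I m = m \<Longrightarrow> mon_degree m = d \<Longrightarrow> Poly_Mapping.single m c \<in> forms I d"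
  by (simp add: forms_def)

lemma forms_scalar [simp]: "scalar c \<in> forms I 0"
  by (auto simp: scalar_def intro!: forms_single poly_mapping_eqI simp: lookup_mon_restrict)

lemma forms_one [simp]: "1 \<in> forms I 0"
  using forms_scalar[of 1 I] by simp

lemma forms_mult:
  assumes "f \<in> forms I d" "g \<in> forms I e"
  shows "f * g \<in> forms I (d + e)"
  unfolding forms_def
proof (intro CollectI ballI)
  fix m assume "m \<in> Poly_Mapping.keys (f * g)"
  then obtain a b where "m = a + b" "a \<in> Poly_Mapping.keys f" "b \<in> Poly_Mapping.keys g"
    using keys_mult[of f g] by auto
  with assms show "mon_restrict I m = m \<and> mon_degree m = d + e"
    by (simp add: forms_def mon_restrict_add mon_degree_add)
qed

lemma forms_prod:
  "finite K \<Longrightarrow> (\<And>j. j \<in> K \<Longrightarrow> h j \<in> forms I (d j)) \<Longrightarrow> prod h K \<in> forms I (sum d K)"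
  by (induction K rule: finite_induct) (auto simp: forms_mult)

lemma forms_power: "f \<in> forms I d \<Longrightarrow> f ^ e \<in> forms I (e * d)"
  by (induction e) (auto simp: forms_mult)

lemma forms_scale: "f \<in> forms I d \<Longrightarrow> scalar c * f \<in> forms I d"
  using forms_mult[of "scalar c" I 0 f d] by simp

lemma forms_of_int: "(of_int c :: ('k::field, 'n::finite) sym) \<in> forms I 0"
proof -
  have "(of_int c :: ('k, 'n) sym) = scalar (of_int c)"
    by (simp add: scalar_def flip: single_of_int)
  thus ?thesis by simp
qed

lemma forms_det:
  assumes "\<And>i j. M $ i $ j \<in> forms I (d i)"
  shows "det M \<in> forms I (\<Sum>i\<in>UNIV. d i)"
  unfolding det_def
proof (rule forms_sum)
  fix p
  have "(\<Prod>i\<in>UNIV. M $ i $ p i) \<in> forms I (\<Sum>i\<in>UNIV. d i)"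
    using assms by (intro forms_prod) auto
  thus "of_int (sign p) * (\<Prod>i\<in>UNIV. M $ i $ p i) \<in> forms I (\<Sum>i\<in>UNIV. d i)"
    using forms_mult[OF forms_of_int] by fastforce
qed

lemma slice_forms: "slice I x f \<in> forms I (snd x)"
  unfolding slice_def
  by (rule forms_sum) (auto simp: bidegree_def intro: forms_single)

lemma forms_0: "f \<in> forms I 0 \<Longrightarrow> f = scalar (Poly_Mapping.lookup f 0)"
  unfolding forms_def scalar_def
  by (intro poly_mapping_eqI) (auto simp: lookup_single when_def mon_degree_eq_0_iff in_keys_iff)

lemma sum_single: "f = (\<Sum>m\<in>Poly_Mapping.keys f. Poly_Mapping.single m (Poly_Mapping.lookup f m))"
  by (rule poly_mapping_eqI) (simp add: lookup_sum lookup_single when_def in_keys_iff)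

lemma slice_expansion:
  assumes "finite K" "Poly_Mapping.keys f \<subseteq> K"
  shows "f = (\<Sum>x\<in>bidegree I ` K. Poly_Mapping.single (fst x) 1 * slice I x f)"
proof -
  have *: "(\<Sum>x\<in>bidegree I ` K. Poly_Mapping.single (fst x) 1 * slice I x (Poly_Mapping.single m c)) =
      Poly_Mapping.single m c" if "m \<in> K" for m c
  proof -
    have "(\<Sum>x\<in>bidegree I ` K. Poly_Mapping.single (fst x) 1 * slice I x (Poly_Mapping.single m c)) =
      (\<Sum>x\<in>bidegree I ` K. if bidegree I m = x then Poly_Mapping.single m c else 0)"
      by (rule sum.cong) (auto simp: slice_single mult_single bidegree_def, metis mon_restrict_compl)
    thus ?thesis using that assms(1) by simp
  qed
  have "(\<Sum>x\<in>bidegree I ` K. Poly_Mapping.single (fst x) 1 * slice I x f) =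
    (\<Sum>m\<in>Poly_Mapping.keys f. \<Sum>x\<in>bidegree I ` K. Poly_Mapping.single (fst x) 1 *
       slice I x (Poly_Mapping.single m (Poly_Mapping.lookup f m)))"
    by (subst sum.swap) (simp add: sum_distrib_left[symmetric] slice_sum[symmetric] sum_single[symmetric])
  also have "\<dots> = (\<Sum>m\<in>Poly_Mapping.keys f. Poly_Mapping.single m (Poly_Mapping.lookup f m))"
    using assms(2) by (intro sum.cong *) auto
  finally show ?thesis by (simp add: sum_single[symmetric])
qed

lemma slice_mult_single:
  assumes "mon_restrict I m = m" "mon_degree m = a"
  shows "slice I (b, d) (Poly_Mapping.single m c * f) =
    (if a \<le> d then Poly_Mapping.single m c * slice I (b, d - a) f else 0)"
proof (induction f rule: sym_induct)
  case (single m' c')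
  show ?case
    by (auto simp: mult_single slice_single bidegree_def mon_restrict_add mon_degree_add assms
        mon_restrict_compl_0[OF assms(1)])
next
  case (add f g)
  thus ?case by (simp add: distrib_left slice_add)
qed

text \<open>A factor from \<open>k[y]\<close> keeps the exponent in \<open>z\<close> and raises the
  degree in \<open>y\<close> by \<open>a\<close>; in degrees below \<open>a\<close> nothing is
  left.\<close>

lemma slice_mult:
  assumes "g \<in> forms I a"
  shows "slice I (b, d) (g * f) = (if a \<le> d then g * slice I (b, d - a) f else 0)"
proof -
  have "slice I (b, d) (g * f) = (\<Sum>m\<in>Poly_Mapping.keys g.
      slice I (b, d) (Poly_Mapping.single m (Poly_Mapping.lookup g m) * f))"
    by (simp add: slice_sum[symmetric] sum_distrib_right[symmetric] sum_single[symmetric])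
  also have "\<dots> = (\<Sum>m\<in>Poly_Mapping.keys g.
      if a \<le> d then Poly_Mapping.single m (Poly_Mapping.lookup g m) * slice I (b, d - a) f else 0)"
    using assms by (intro sum.cong refl slice_mult_single) (auto simp: forms_def)
  also have "\<dots> = (if a \<le> d then g * slice I (b, d - a) f else 0)"
    by (simp add: sum_distrib_right[symmetric] sum_single[symmetric])
  finally show ?thesis .
qed

lemma slice_scale: "slice I x (scalar c * f) = scalar c * slice I x f"
  using slice_mult[OF forms_scalar, of I "fst x" "snd x" c f] by simp

lemma slice_of_form:
  fixes f :: "('k::field, 'n::finite) sym"
  assumes "f \<in> forms I d"
  shows "slice I (0, e) f = (if d = e then f else 0)"
proof -
  have "slice I (0, k) (1 :: ('k, 'n) sym) = (if k = 0 then 1 else 0)" for k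
    using slice_single[of I "(0, k)" 0 "1::'k"]
    by (auto simp: bidegree_def mon_restrict_def)
  thus ?thesis using slice_mult[OF assms, of 0 e 1] by auto
qed

text \<open>Slicing commutes with multiplication by \<open>l\<close> up to a shift of degree. This
  is why the slices of a logarithmic derivation are again logarithmic.\<close>

lemma dvd_slice:
  assumes "l \<in> forms I a" "l dvd f"
  shows "l dvd slice I x f"
proof -
  obtain w where "f = l * w" using assms(2) by (auto simp: dvd_def)
  thus ?thesis using slice_mult[OF assms(1), of "fst x" "snd x" w] by auto
qed

text \<open>Since \<open>h\<close> lies in \<open>k[y]\<close> and already has degree
  \<open>e\<close>, the slice of \<open>u * h\<close> at \<open>(b, e)\<close> is \<open>h\<close>
  times the nonzero constant \<open>slice I (b, 0) u\<close>. This slice is still a multiple of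
  \<open>g\<close>.\<close>

lemma forms_dvd_cancel:
  assumes g: "g \<in> forms I a" and h: "h \<in> forms I e"
    and dvd: "g dvd u * h" and u: "slice I (b, 0) u \<noteq> 0"
  shows "g dvd h"
proof -
  obtain w where w: "u * h = g * w" using dvd by (auto simp: dvd_def)
  obtain c where c: "slice I (b, 0) u = scalar c"
    using forms_0[OF slice_forms[of I "(b, 0)" u, simplified]] by blast
  hence "c \<noteq> 0" using u by auto
  have "slice I (b, e) (h * u) = h * scalar c"
    using slice_mult[OF h, of b e u] c by simp
  moreover have "g dvd slice I (b, e) (h * u)"
    using w by (intro dvd_slice[OF g]) (simp add: mult.commute)
  ultimately have "g dvd (h * scalar c) * scalar (inverse c)" by (simp add: dvd_mult2)
  also have "(h * scalar c) * scalar (inverse c) = h"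
    using \<open>c \<noteq> 0\<close> by (simp add: mult.assoc scalar_mult[symmetric])
  finally show ?thesis .
qed

abbreviation hcomp :: "nat \<Rightarrow> ('k::field, 'n::finite) sym \<Rightarrow> ('k, 'n) sym" where
  "hcomp d \<equiv> slice UNIV (0, d)"

lemma hcomp_homog: "hcomp d f \<in> homog d"
  using slice_forms[of UNIV "(0, d)" f] by (simp add: homog_forms)

lemma bidegree_UNIV: "bidegree UNIV m = (0, mon_degree m)"
  by (simp add: bidegree_def)

lemma hcomp_expansion:
  assumes "finite K" "mon_degree ` Poly_Mapping.keys f \<subseteq> K"
  shows "f = (\<Sum>d\<in>K. hcomp d f)"
proof -
  let ?K = "mon_degree ` Poly_Mapping.keys f"
  have "f = (\<Sum>x\<in>bidegree UNIV ` Poly_Mapping.keys f. slice UNIV x f)"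
    by (subst slice_expansion[of "Poly_Mapping.keys f" f UNIV], simp, simp, intro sum.cong)
      (auto simp: bidegree_UNIV)
  also have "bidegree UNIV ` Poly_Mapping.keys f = Pair 0 ` ?K"
    by (auto simp: bidegree_UNIV)
  also have "(\<Sum>x\<in>Pair 0 ` ?K. slice UNIV x f) = (\<Sum>d\<in>?K. hcomp d f)"
    by (simp add: sum.reindex inj_on_def)
  also have "\<dots> = (\<Sum>d\<in>K. hcomp d f)"
    using assms
    by (intro sum.mono_neutral_left) (auto simp: slice_def bidegree_UNIV intro!: sum.neutral)
  finally show ?thesis .
qed

section \<open>Linear forms and divisibility by them\<close>

lemma linear_form_add: "linear_form (a + b) = linear_form a + linear_form b"
  by (simp add: linear_form_def scalar_add distrib_right sum.distrib)

lemma linear_form_scale: "linear_form (c *s a) = scalar c * linear_form a"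
  by (simp add: linear_form_def scalar_mult sum_distrib_left mult.assoc)

lemma linear_form_sum: "linear_form (sum h K) = (\<Sum>x\<in>K. linear_form (h x))"
  by (induction K rule: infinite_finite_induct) (auto simp: linear_form_add, auto simp: linear_form_def)

lemma lookup_var: "Poly_Mapping.lookup (var i) m = (if m = Poly_Mapping.single i 1 then 1 else 0)"
  by (auto simp: var_def lookup_single)

lemma lookup_scalar_mult: "Poly_Mapping.lookup (scalar c * f) m = c * Poly_Mapping.lookup f m"
proof (induction f rule: sym_induct)
  case (single m' c')
  show ?case by (simp add: scalar_def mult_single lookup_single when_def)
next
  case (add f g)
  thus ?case by (simp add: distrib_left lookup_add)
qed

lemma single_one_eq_iff: "Poly_Mapping.single i (Suc 0) = Poly_Mapping.single j (Suc 0) \<longleftrightarrow> i = j"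
  by (metis lookup_single_eq lookup_single_not_eq nat.distinct(1))

lemma lookup_linear_form: "Poly_Mapping.lookup (linear_form a) (Poly_Mapping.single i 1) = a $ i"
  by (simp add: linear_form_def lookup_sum lookup_scalar_mult lookup_var single_one_eq_iff if_distrib cong: if_cong)

lemma linear_form_inj: "linear_form a = linear_form b \<longleftrightarrow> a = b"
  by (metis lookup_linear_form vec_eq_iff)

lemma linear_form_0_iff: "linear_form a = 0 \<longleftrightarrow> a = 0"
  by (metis linear_form_inj linear_form_scale scalar_0 mult_zero_left vector_smult_lzero)

lemma mon_degree_single [simp]: "mon_degree (Poly_Mapping.single i d) = d"
  by (simp add: mon_degree_def lookup_single when_def)

lemma mon_restrict_single: "i \<in> I \<Longrightarrow> mon_restrict I (Poly_Mapping.single i d) = Poly_Mapping.single i d"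
  by (rule poly_mapping_eqI) (auto simp: lookup_mon_restrict lookup_single when_def)

lemma var_forms: "i \<in> I \<Longrightarrow> var i \<in> forms I 1"
  unfolding var_def by (intro forms_single mon_restrict_single) auto

lemma linear_form_forms: "(\<And>i. i \<notin> I \<Longrightarrow> a $ i = 0) \<Longrightarrow> linear_form a \<in> forms I 1"
  unfolding linear_form_def
proof (rule forms_sum)
  fix i assume "\<And>i. i \<notin> I \<Longrightarrow> a $ i = 0"
  thus "scalar (a $ i) * var i \<in> forms I 1"
    using forms_scale[OF var_forms[of i I]] by (cases "i \<in> I") auto
qed

lemma linear_form_homog: "linear_form a \<in> homog 1"
  using linear_form_forms[of UNIV a] by (simp add: homog_forms)

lemma var_eq_linear_form: "var i = linear_form (axis i 1)"
  by (simp add: linear_form_def axis_def if_distrib[of scalar] if_distrib[of "\<lambda>x. x * _"] cong: if_cong)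

lemma var_homog: "var i \<in> homog 1"
  using var_forms[of i UNIV] by (simp add: homog_forms)

lemma eval_hom_linear_form:
  "eval_hom scalar \<sigma> (linear_form a) = (\<Sum>i\<in>UNIV. scalar (a $ i) * \<sigma> i)"
  by (simp add: linear_form_def eval_hom_sum[OF coeff_hom_scalar] eval_hom_mult[OF coeff_hom_scalar]
      eval_hom_scalar[OF coeff_hom_scalar] eval_hom_var[OF coeff_hom_scalar])

text \<open>Divisibility by a linear form is vanishing after elimination of a variable.\<close>

lemma linear_form_dvd_iff:
  fixes a :: "'k::field ^ 'n::finite"
  assumes "a \<noteq> 0"
  shows "\<exists>\<sigma> :: 'n \<Rightarrow> ('k, 'n) sym. \<forall>f. linear_form a dvd f \<longleftrightarrow> eval_hom scalar \<sigma> f = 0"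
proof -
  obtain k where k: "a $ k \<noteq> 0" using assms by (auto simp: vec_eq_iff)
  \<comment> \<open>The equation \<open>linear_form a = 0\<close> is solved for the variable
    \<open>k\<close>, whose coefficient is invertible.\<close>
  define \<sigma> where "\<sigma> i = (if i = k then var i - scalar (inverse (a $ k)) * linear_form a else var i)" for i
  let ?\<psi> = "eval_hom scalar \<sigma>"
  note hom = eval_hom_add[OF coeff_hom_scalar] eval_hom_mult[OF coeff_hom_scalar]
      eval_hom_scalar[OF coeff_hom_scalar] eval_hom_var[OF coeff_hom_scalar] eval_hom_one[OF coeff_hom_scalar]
  have l: "?\<psi> (linear_form a) = 0"
  proof -
    have "(\<Sum>i\<in>UNIV. scalar (a $ i) * \<sigma> i) =
      (\<Sum>i\<in>UNIV. scalar (a $ i) * var i - (if i = k then linear_form a else 0))"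
      using k by (intro sum.cong)
        (auto simp: \<sigma>_def right_diff_distrib scalar_mult[symmetric] mult.assoc[symmetric])
    also have "\<dots> = 0"
      by (simp add: sum_subtractf) (simp add: linear_form_def)
    finally show ?thesis by (simp add: eval_hom_linear_form)
  qed
  \<comment> \<open>The congruence of \<open>f\<close> and \<open>?\<psi> f\<close> modulo the form
    passes to products, hence from the variables to all polynomials.\<close>
  have mult: "linear_form a dvd f * g - ?\<psi> (f * g)"
    if "linear_form a dvd f - ?\<psi> f" "linear_form a dvd g - ?\<psi> g" for f g
  proof -
    have "f * g - ?\<psi> (f * g) = (f - ?\<psi> f) * g + ?\<psi> f * (g - ?\<psi> g)"
      by (simp add: hom algebra_simps)
    with that show ?thesis by simp
  qed
  have var: "linear_form a dvd var i - ?\<psi> (var i)" for i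
    by (simp add: hom \<sigma>_def)
  have pow: "linear_form a dvd var i ^ d - ?\<psi> (var i ^ d)" for i d
  proof (induction d)
    case (Suc d)
    show ?case using mult[OF var Suc] by simp
  qed (simp add: hom)
  have prd: "linear_form a dvd (\<Prod>i\<in>K. var i ^ e i) - ?\<psi> (\<Prod>i\<in>K. var i ^ e i)" if "finite K" for K e
    using that
  proof (induction K rule: finite_induct)
    case (insert k K)
    show ?case using mult[OF pow insert.IH] insert by simp
  qed (simp add: hom)
  have cong: "linear_form a dvd f - ?\<psi> f" for f
  proof (induction f rule: sym_induct)
    case (single m c)
    have "linear_form a dvd scalar c - ?\<psi> (scalar c)" by (simp add: hom)
    from mult[OF this prd[of UNIV "Poly_Mapping.lookup m"]] show ?case
      by (simp add: single_expansion[of m c])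
  next
    case (add f g)
    have eq: "f + g - ?\<psi> (f + g) = (f - ?\<psi> f) + (g - ?\<psi> g)" by (simp add: hom)
    show ?case unfolding eq by (rule dvd_add[OF add])
  qed
  have "linear_form a dvd f \<longleftrightarrow> ?\<psi> f = 0" for f
  proof
    assume "linear_form a dvd f"
    thus "?\<psi> f = 0" using l by (auto simp: dvd_def hom)
  next
    assume "?\<psi> f = 0"
    thus "linear_form a dvd f" using cong[of f] by simp
  qed
  thus ?thesis by blast
qed

text \<open>The multiples of the form are the kernel of a homomorphism into a ring without zero
  divisors.\<close>

lemma linear_form_prime:
  fixes a :: "'k::field ^ 'n::finite"
  assumes "a \<noteq> 0" "linear_form a dvd f * g"
  shows "linear_form a dvd f \<or> linear_form a dvd g"
proof -
  obtain \<sigma> :: "'n \<Rightarrow> ('k, 'n) sym" where "\<forall>f. linear_form a dvd f \<longleftrightarrow> eval_hom scalar \<sigma> f = 0"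
    using linear_form_dvd_iff[OF assms(1)] ..
  note \<sigma> = this[rule_format]
  show ?thesis
    using assms(2) unfolding \<sigma> eval_hom_mult[OF coeff_hom_scalar] by (rule sym_no_zero_divisors)
qed

lemma linear_form_dvd_linear_form:
  assumes "linear_form a dvd linear_form b"
  shows "\<exists>c. b = c *s a"
proof -
  obtain f where f: "linear_form b = linear_form a * f" using assms by (auto simp: dvd_def)
  have b: "linear_form b \<in> forms UNIV 1" and a: "linear_form a \<in> forms UNIV 1"
    using linear_form_homog by (auto simp: homog_forms)
  have "linear_form b = hcomp 1 (linear_form b)"
    using slice_of_form[OF b, of 1] by simp
  \<comment> \<open>In degree 1 only the constant part of the cofactor contributes.\<close>
  also have "\<dots> = linear_form a * hcomp 0 f"
    using slice_mult[OF a, of 0 1 f] by (simp add: f)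
  also have "hcomp 0 f = scalar (Poly_Mapping.lookup (hcomp 0 f) 0)"
    by (rule forms_0[of _ UNIV]) (use slice_forms[of UNIV "(0, 0)" f] in simp)
  finally show ?thesis
    by (metis linear_form_inj linear_form_scale mult.commute)
qed

lemma graded_hom:
  assumes "\<And>i. \<sigma> i \<in> homog 1" "f \<in> homog d"
  shows "eval_hom scalar \<sigma> f \<in> homog d"
  unfolding eval_hom_def homog_forms
proof (rule forms_sum)
  fix m assume "m \<in> Poly_Mapping.keys f"
  hence d: "(\<Sum>i\<in>UNIV. Poly_Mapping.lookup m i) = d"
    using assms(2) by (simp add: homog_def mon_degree_def)
  have "(\<Prod>i\<in>UNIV. \<sigma> i ^ Poly_Mapping.lookup m i) \<in> forms UNIV (\<Sum>i\<in>UNIV. Poly_Mapping.lookup m i)"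
    using forms_power[of _ UNIV 1] assms(1) by (intro forms_prod) (auto simp: homog_forms)
  thus "scalar (Poly_Mapping.lookup f m) * (\<Prod>i\<in>UNIV. \<sigma> i ^ Poly_Mapping.lookup m i) \<in> forms UNIV d"
    using d forms_scale by auto
qed

lemma homog_sum_zero:
  assumes "finite K" "\<And>d. d \<in> K \<Longrightarrow> h d \<in> homog d" "(\<Sum>d\<in>K. h d) = 0" "e \<in> K"
  shows "h e = 0"
proof -
  have "hcomp e (\<Sum>d\<in>K. h d) = (\<Sum>d\<in>K. if d = e then h e else 0)"
    unfolding slice_sum
  proof (intro sum.cong refl)
    fix d assume "d \<in> K"
    thus "hcomp e (h d) = (if d = e then h e else 0)"
      using slice_of_form[of "h d" UNIV d e] assms(2)[of d] by (auto simp: homog_forms)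
  qed
  with assms show ?thesis by simp
qed

section \<open>Homogeneous localization\<close>

lemma Proj_0: "p \<in> Proj \<Longrightarrow> 0 \<in> p"
  by (auto simp: Proj_def prime_ideal_def ideal.subspace_0)

lemma Proj_subspace: "p \<in> Proj \<Longrightarrow> ideal.subspace p"
  by (simp add: Proj_def prime_ideal_def)

lemma Proj_1: "p \<in> Proj \<Longrightarrow> 1 \<notin> p"
  using ideal.subspace_scale[of p 1] by (fastforce simp: Proj_def prime_ideal_def)

lemma Proj_mult:
  assumes "p \<in> Proj"
  shows "f * g \<in> p \<longleftrightarrow> f \<in> p \<or> g \<in> p"
proof -
  have p: "prime_ideal p" using assms by (simp add: Proj_def)
  hence sp: "ideal.subspace p" by (simp add: prime_ideal_def)
  show ?thesis
    using p ideal.subspace_scale[OF sp, of f g] ideal.subspace_scale[OF sp, of g f]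
    by (auto simp: prime_ideal_def mult.commute)
qed

lemma Proj_power: "p \<in> Proj \<Longrightarrow> f \<notin> p \<Longrightarrow> f ^ d \<notin> p"
  by (induction d) (auto simp: Proj_mult Proj_1)

lemma Proj_prod: "finite K \<Longrightarrow> p \<in> Proj \<Longrightarrow> (\<And>i. i \<in> K \<Longrightarrow> h i \<notin> p) \<Longrightarrow> prod h K \<notin> p"
  by (induction K rule: finite_induct) (auto simp: Proj_mult Proj_1)

lemma vars_in_prime:
  fixes p :: "('k::field, 'n::finite) sym set"
  assumes p: "ideal.subspace p" and var: "\<And>i. var i \<in> p"
  shows "irrelevant_ideal \<subseteq> p"
  unfolding irrelevant_ideal_def
proof (rule ideal.span_minimal[OF _ p], rule)
  fix f :: "('k, 'n) sym"
  assume "f \<in> (\<Union>d\<in>{0<..}. homog d)"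
  then obtain d where d: "0 < d" "f \<in> homog d" by auto
  have "Poly_Mapping.single m c \<in> p" if "mon_degree m \<noteq> 0" for m c
  proof -
    from that obtain i where i: "Poly_Mapping.lookup m i \<noteq> 0"
      by (auto simp: mon_degree_def)
    have "var i dvd (\<Prod>i\<in>UNIV. var i ^ Poly_Mapping.lookup m i)"
      using i by (intro dvd_trans[OF dvd_power dvd_prodI[of UNIV i]]) auto
    hence "var i dvd Poly_Mapping.single m c"
      unfolding single_expansion[of m c] by (rule dvd_mult)
    thus ?thesis using ideal.subspace_scale[OF p var] by (auto simp: dvd_def mult.commute)
  qed
  moreover have "f = (\<Sum>m\<in>Poly_Mapping.keys f. Poly_Mapping.single m (Poly_Mapping.lookup f m))"
    by (rule sum_single)
  moreover have "mon_degree m \<noteq> 0" if "m \<in> Poly_Mapping.keys f" for m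
    using d that by (auto simp: homog_def)
  ultimately show "f \<in> p" by (metis ideal.subspace_sum[OF p])
qed

text \<open>Powers of such a variable are homogeneous elements of every degree outside
  \<open>p\<close>. They serve as denominators and to equalize degrees.\<close>

lemma Proj_var: "p \<in> Proj \<Longrightarrow> \<exists>i. var i \<notin> p"
  using vars_in_prime[of p] by (auto simp: Proj_def prime_ideal_def)

lemma open_subset_Proj: "openin proj_topology W \<Longrightarrow> W \<subseteq> Proj"
  by (auto simp: openin_proj_topology)

lemma basic_open: "f \<in> homog d \<Longrightarrow> openin proj_topology {p \<in> Proj. f \<notin> p}"
  unfolding openin_proj_topology
proof (intro exI conjI)
  assume f: "f \<in> homog d"
  show "homog_ideal (ideal.span {f})" using f by (intro homog_ideal_span) auto
  have "ideal.span {f} \<subseteq> p \<longleftrightarrow> f \<in> p" if "p \<in> Proj" for p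
    using span_subset_iff[OF Proj_subspace[OF that], of "{f}"] by simp
  thus "{p \<in> Proj. f \<notin> p} = Proj - zariski_closed (ideal.span {f})"
    by (auto simp: zariski_closed_def)
qed

lemma homog_0 [simp]: "0 \<in> homog d" and homog_1 [simp]: "1 \<in> homog 0"
  by (auto simp: homog_forms)

lemma homog_add: "f \<in> homog d \<Longrightarrow> g \<in> homog d \<Longrightarrow> f + g \<in> homog d"
  by (simp add: homog_forms forms_add)

lemma homog_var_power: "var i ^ d \<in> homog d"
  using forms_power[of "var i" UNIV 1 d] var_homog[of i] by (simp add: homog_forms)

text \<open>Torsion-freeness reduces equality of fractions to cross-multiplication, without the
  auxiliary factor \<open>u\<close> of \<open>hfraction_rel\<close>. The assumption
  \<open>G_direct\<close> splits a relation into its homogeneous parts.\<close>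

locale graded_module = module sc
  for sc :: "('k::field, 'n::finite) sym \<Rightarrow> 'm::ab_group_add \<Rightarrow> 'm" +
  fixes G :: "nat \<Rightarrow> 'm set"
  assumes torsion_free: "sc f m = 0 \<Longrightarrow> f = 0 \<or> m = 0"
    and G_0: "0 \<in> G d"
    and G_add: "m \<in> G d \<Longrightarrow> m' \<in> G d \<Longrightarrow> m + m' \<in> G d"
    and G_scale: "f \<in> homog a \<Longrightarrow> m \<in> G d \<Longrightarrow> sc f m \<in> G (a + d)"
    and G_direct: "finite K \<Longrightarrow> (\<And>d. d \<in> K \<Longrightarrow> x d \<in> G d) \<Longrightarrow> (\<Sum>d\<in>K. x d) = 0 \<Longrightarrow>
      e \<in> K \<Longrightarrow> x e = 0"
begin

lemma sc_cancel: "f \<noteq> 0 \<Longrightarrow> sc f m = sc f m' \<longleftrightarrow> m = m'"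
  using torsion_free[of f "m - m'"] by (auto simp: scale_right_diff_distrib)

lemma G_sum: "(\<And>i. i \<in> K \<Longrightarrow> x i \<in> G d) \<Longrightarrow> sum x K \<in> G d"
  by (induction K rule: infinite_finite_induct) (auto simp: G_0 G_add)

abbreviation frac where "frac \<equiv> hfrac sc G"

definition fraction :: "('k, 'n) sym set \<Rightarrow> 'm \<Rightarrow> ('k, 'n) sym \<Rightarrow> bool" where
  "fraction p m s \<longleftrightarrow> p \<in> Proj \<and> (\<exists>d. m \<in> G d \<and> s \<in> homog d \<and> s \<notin> p)"

lemma fractionI: "p \<in> Proj \<Longrightarrow> m \<in> G d \<Longrightarrow> s \<in> homog d \<Longrightarrow> s \<notin> p \<Longrightarrow> fraction p m s"
  by (auto simp: fraction_def)

lemma fraction_nonzero: "fraction p m s \<Longrightarrow> s \<noteq> 0"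
  using Proj_0 by (auto simp: fraction_def)

lemma rel_iff:
  assumes "p \<in> Proj"
  shows "((m, s), (m', s')) \<in> hfraction_rel sc G p \<longleftrightarrow>
    fraction p m s \<and> fraction p m' s' \<and> sc s' m = sc s m'"
proof -
  have "u \<noteq> 0" if "u \<notin> p" for u using that Proj_0[OF assms] by auto
  moreover have "\<exists>u e. u \<in> homog e \<and> u \<notin> p"
    using Proj_1[OF assms] homog_1 by blast
  ultimately show ?thesis
    unfolding hfraction_rel_def hfractions_def fraction_def
    using assms by (auto simp: sc_cancel simp del: scale_scale)
qed

lemma rel_trans:
  assumes "fraction p m' s'" "sc s' m = sc s m'" "sc s'' m' = sc s' m''"
  shows "sc s'' m = sc s m''"
proof -
  have "sc s' (sc s'' m) = sc s'' (sc s m')"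
    unfolding assms(2)[symmetric] by (simp add: mult.commute)
  also have "\<dots> = sc s (sc s' m'')"
    unfolding assms(3)[symmetric] by (simp add: mult.commute)
  also have "\<dots> = sc s' (sc s m'')" by (simp add: mult.commute)
  finally show ?thesis using fraction_nonzero[OF assms(1)] sc_cancel by blast
qed

lemma frac_mem:
  "p \<in> Proj \<Longrightarrow> (m', s') \<in> frac p m s \<longleftrightarrow> fraction p m s \<and> fraction p m' s' \<and> sc s' m = sc s m'"
  by (simp add: hfrac_def rel_iff)

lemma frac_eq_iff:
  assumes "fraction p m s" "fraction p m' s'"
  shows "frac p m s = frac p m' s' \<longleftrightarrow> sc s' m = sc s m'"
proof -
  have p: "p \<in> Proj" using assms by (simp add: fraction_def)
  show ?thesis
  proof
    assume eq: "frac p m s = frac p m' s'"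
    have "(m', s') \<in> frac p m' s'" using frac_mem[OF p] assms by blast
    thus "sc s' m = sc s m'" unfolding eq[symmetric] frac_mem[OF p] by blast
  next
    assume eq: "sc s' m = sc s m'"
    have "(a, b) \<in> frac p m s \<longleftrightarrow> (a, b) \<in> frac p m' s'" for a b
      unfolding frac_mem[OF p] using rel_trans[OF assms(2) eq, of b a]
        rel_trans[OF assms(1) eq[symmetric], of b a] assms by blast
    thus "frac p m s = frac p m' s'" by auto
  qed
qed

lemma frac_eqI:
  "fraction p m s \<Longrightarrow> fraction p m' s' \<Longrightarrow> sc s' m = sc s m' \<Longrightarrow> frac p m s = frac p m' s'"
  by (simp add: frac_eq_iff)

lemma frac_hlocalization: "fraction p m s \<Longrightarrow> frac p m s \<in> hlocalization sc G p"
  by (auto simp: hlocalization_def quotient_def hfrac_def hfractions_def fraction_def)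

lemma hlocalization_frac:
  assumes "p \<in> Proj" "x \<in> hlocalization sc G p"
  obtains d m s where "m \<in> G d" "s \<in> homog d" "s \<notin> p" "fraction p m s" "x = frac p m s"
  using assms(2) that unfolding hlocalization_def quotient_def hfrac_def hfractions_def fraction_def
  using assms(1) by blast

lemma fraction_add:
  assumes "fraction p m s" "fraction p m' s'"
  shows "fraction p (sc s' m + sc s m') (s * s')"
proof -
  obtain d d' where "m \<in> G d" "s \<in> homog d" "s \<notin> p" "m' \<in> G d'" "s' \<in> homog d'" "s' \<notin> p" "p \<in> Proj"
    using assms by (auto simp: fraction_def)
  thus ?thesis
    using G_scale[of s' d' m d] G_scale[of s d m' d'] homog_mult[of s d s' d']
    by (intro fractionI[of p _ "d + d'"] G_add) (auto simp: add.commute Proj_mult)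
qed

text \<open>\<open>hadd\<close> is a union over all pairs of representatives; it is a single class
  because any two choices yield the same fraction.\<close>

lemma hadd_frac:
  assumes "fraction p m s" "fraction p m' s'"
  shows "hadd sc G p (frac p m s) (frac p m' s') = frac p (sc s' m + sc s m') (s * s')"
proof -
  have p: "p \<in> Proj" using assms by (simp add: fraction_def)
  have eq: "frac p (sc b' a + sc b a') (b * b') = frac p (sc s' m + sc s m') (s * s')"
    if "(a, b) \<in> frac p m s" "(a', b') \<in> frac p m' s'" for a b a' b'
  proof (rule frac_eqI)
    have *: "fraction p a b" "sc b m = sc s a" "fraction p a' b'" "sc b' m' = sc s' a'"
      using that unfolding frac_mem[OF p] by blast+
    show "fraction p (sc b' a + sc b a') (b * b')" using * by (intro fraction_add)
    show "fraction p (sc s' m + sc s m') (s * s')" using assms by (intro fraction_add)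
    have "sc (s * s') (sc b' a + sc b a') = sc (s' * b') (sc s a) + sc (s * b) (sc s' a')"
      by (simp add: scale_right_distrib mult_ac)
    also have "\<dots> = sc (b * b') (sc s' m + sc s m')"
      unfolding *(2,4)[symmetric] by (simp add: scale_right_distrib mult_ac)
    finally show "sc (s * s') (sc b' a + sc b a') = sc (b * b') (sc s' m + sc s m')" .
  qed
  have ne: "(m, s) \<in> frac p m s" "(m', s') \<in> frac p m' s'"
    using assms frac_mem[OF p] by blast+
  have "(\<Union>(a, b)\<in>frac p m s. \<Union>(a', b')\<in>frac p m' s'. frac p (sc b' a + sc b a') (b * b')) =
    (\<Union>x\<in>frac p m s. \<Union>y\<in>frac p m' s'. frac p (sc s' m + sc s m') (s * s'))"
    using eq by (intro SUP_cong refl) (auto simp: split_beta)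
  also have "\<dots> = frac p (sc s' m + sc s m') (s * s')"
    using ne by auto
  finally show ?thesis by (simp add: hadd_def)
qed

lemma hadd_common:
  assumes "fraction p m s" "fraction p m' s" "fraction p (m + m') s"
  shows "hadd sc G p (frac p m s) (frac p m' s) = frac p (m + m') s"
  unfolding hadd_frac[OF assms(1,2)]
  by (rule frac_eqI[OF fraction_add[OF assms(1,2)] assms(3)]) (simp add: scale_right_distrib)

lemma frac_expand:
  assumes "fraction p m s" "u \<in> homog e" "u \<notin> p"
  shows "fraction p (sc u m) (u * s)" "frac p m s = frac p (sc u m) (u * s)"
proof -
  obtain d where d: "p \<in> Proj" "m \<in> G d" "s \<in> homog d" "s \<notin> p"
    using assms(1) by (auto simp: fraction_def)
  show f: "fraction p (sc u m) (u * s)"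
    using d assms G_scale homog_mult by (intro fractionI[of p _ "e + d"]) (auto simp: Proj_mult)
  show "frac p m s = frac p (sc u m) (u * s)"
    by (rule frac_eqI[OF assms(1) f]) (simp add: mult.commute)
qed

section \<open>Sections of the associated sheaf\<close>

lemma sections_PiE: "\<sigma> \<in> tilde_sections sc G U \<Longrightarrow> \<sigma> \<in> PiE U (hlocalization sc G)"
  by (simp add: tilde_sections_def)

lemma sections_local:
  assumes "\<sigma> \<in> tilde_sections sc G U" "p \<in> U"
  shows "\<exists>W d m s. openin proj_topology W \<and> p \<in> W \<and> W \<subseteq> U \<and> m \<in> G d \<and>
      s \<in> homog d \<and> (\<forall>q\<in>W. s \<notin> q \<and> \<sigma> q = frac q m s)"
proof -
  have "\<forall>p\<in>U. \<exists>W d m s. openin proj_topology W \<and> p \<in> W \<and> W \<subseteq> U \<and> m \<in> G d \<and>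
      s \<in> homog d \<and> (\<forall>q\<in>W. s \<notin> q \<and> \<sigma> q = frac q m s)"
    using assms(1) by (simp add: tilde_sections_def)
  thus ?thesis using assms(2) by (rule bspec)
qed

lemma sectionsI:
  assumes "U \<subseteq> Proj" "\<And>q. q \<notin> U \<Longrightarrow> \<sigma> q = undefined"
    and "\<And>p. p \<in> U \<Longrightarrow> \<exists>W d m s. openin proj_topology W \<and> p \<in> W \<and> W \<subseteq> U \<and> m \<in> G d \<and>
      s \<in> homog d \<and> (\<forall>q\<in>W. s \<notin> q \<and> \<sigma> q = frac q m s)"
  shows "\<sigma> \<in> tilde_sections sc G U"
proof -
  have "\<sigma> p \<in> hlocalization sc G p" if "p \<in> U" for p
  proof -
    from assms(3)[OF that] obtain W d m s where *: "p \<in> W" "m \<in> G d" "s \<in> homog d"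
      "\<forall>q\<in>W. s \<notin> q \<and> \<sigma> q = frac q m s"
      by (elim exE conjE)
    moreover from * have "s \<notin> p" "\<sigma> p = frac p m s" by simp_all
    moreover have "p \<in> Proj" using assms(1) that by (rule subsetD)
    ultimately show ?thesis using frac_hlocalization[OF fractionI, of p m d s] by simp
  qed
  thus ?thesis using assms(2,3) by (auto simp: tilde_sections_def PiE_def extensional_def)
qed

lemma frac_section:
  assumes "openin proj_topology W" "m \<in> G d" "s \<in> homog d" "\<And>q. q \<in> W \<Longrightarrow> s \<notin> q"
  shows "(\<lambda>q\<in>W. frac q m s) \<in> tilde_sections sc G W"
proof (rule sectionsI)
  fix p assume "p \<in> W"
  thus "\<exists>W' d m' s'. openin proj_topology W' \<and> p \<in> W' \<and> W' \<subseteq> W \<and> m' \<in> G d \<and>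
      s' \<in> homog d \<and> (\<forall>q\<in>W'. s' \<notin> q \<and> (\<lambda>q\<in>W. frac q m s) q = frac q m' s')"
    using assms by (intro exI[of _ W] exI[of _ d] exI[of _ m] exI[of _ s]) auto
qed (use open_subset_Proj[OF assms(1)] in auto)

text \<open>Expanding fractions by homogeneous factors gives all of them one denominator, hence also
  numerators of one common degree. A tuple of sections can then be handled as a tuple of polynomials
  or module elements.\<close>

lemma common_denominator:
  fixes r :: nat
  assumes "W \<subseteq> Proj" "\<And>i. i < r \<Longrightarrow> m i \<in> G (d i)" "\<And>i. i < r \<Longrightarrow> s i \<in> homog (d i)"
    and "\<And>i q. i < r \<Longrightarrow> q \<in> W \<Longrightarrow> s i \<notin> q"
  shows "\<exists>e t m'. t \<in> homog e \<and> (\<forall>q\<in>W. t \<notin> q) \<and>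
    (\<forall>i<r. m' i \<in> G e \<and> (\<forall>q\<in>W. frac q (m i) (s i) = frac q (m' i) t))"
  using assms(2-)
proof (induction r)
  case 0
  show ?case by (rule exI[of _ 0], rule exI[of _ 1]) (use Proj_1 assms(1) in auto)
next
  case (Suc r)
  have "\<exists>e t m'. t \<in> homog e \<and> (\<forall>q\<in>W. t \<notin> q) \<and>
    (\<forall>i<r. m' i \<in> G e \<and> (\<forall>q\<in>W. frac q (m i) (s i) = frac q (m' i) t))"
    using Suc.prems by (intro Suc.IH) auto
  then obtain e t m' where ex: "t \<in> homog e \<and> (\<forall>q\<in>W. t \<notin> q) \<and>
    (\<forall>i<r. m' i \<in> G e \<and> (\<forall>q\<in>W. frac q (m i) (s i) = frac q (m' i) t))"
    by (elim exE)
  hence *: "t \<in> homog e" "\<And>q. q \<in> W \<Longrightarrow> t \<notin> q" "\<And>i. i < r \<Longrightarrow> m' i \<in> G e"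
    "\<And>i q. i < r \<Longrightarrow> q \<in> W \<Longrightarrow> frac q (m i) (s i) = frac q (m' i) t"
    by simp_all
  have s: "m r \<in> G (d r)" "s r \<in> homog (d r)" "\<And>q. q \<in> W \<Longrightarrow> s r \<notin> q"
    using Suc.prems by auto
  let ?m = "\<lambda>i. if i = r then sc t (m r) else sc (s r) (m' i)"
  show ?case
  proof (intro exI conjI allI ballI impI)
    show "t * s r \<in> homog (e + d r)" using * s by (intro homog_mult)
    show "t * s r \<notin> q" if "q \<in> W" for q
      using that *(2) s(3) assms(1) by (auto simp: Proj_mult)
    fix i assume i: "i < Suc r"
    show "?m i \<in> G (e + d r)"
      using i G_scale[OF *(1) s(1)] G_scale[OF s(2) *(3), of i] by (auto simp: add.commute)
    fix q assume q: "q \<in> W"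
    show "frac q (m i) (s i) = frac q (?m i) (t * s r)"
    proof (cases "i = r")
      case True
      have "fraction q (m r) (s r)" using q s assms(1) by (intro fractionI) auto
      thus ?thesis using frac_expand(2)[OF _ *(1) *(2)[OF q]] True by simp
    next
      case False
      hence "fraction q (m' i) t" using q i * assms(1) by (intro fractionI) auto
      thus ?thesis using frac_expand(2)[OF _ s(2) s(3)[OF q]] False i *(4)[of i, OF _ q]
        by (simp add: mult.commute)
    qed
  qed
qed

lemma sections_common:
  fixes r :: nat
  assumes "openin proj_topology U" "p \<in> U" "\<forall>i<r. \<sigma> i \<in> tilde_sections sc G U"
  shows "\<exists>W e t m. openin proj_topology W \<and> p \<in> W \<and> W \<subseteq> U \<and> t \<in> homog e \<and>
    (\<forall>q\<in>W. t \<notin> q) \<and> (\<forall>i<r. m i \<in> G e) \<and> (\<forall>i<r. \<forall>q\<in>W. \<sigma> i q = frac q (m i) t)"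
proof -
  have "\<forall>i. \<exists>W d m s. i < r \<longrightarrow> openin proj_topology W \<and> p \<in> W \<and> W \<subseteq> U \<and> m \<in> G d \<and>
      s \<in> homog d \<and> (\<forall>q\<in>W. s \<notin> q \<and> \<sigma> i q = frac q m s)"
    using sections_local[OF assms(3)[rule_format] assms(2)] by simp
  then obtain V d m s where V: "\<And>i. i < r \<Longrightarrow> openin proj_topology (V i) \<and> p \<in> V i \<and> V i \<subseteq> U \<and> m i \<in> G (d i) \<and>
      s i \<in> homog (d i) \<and> (\<forall>q\<in>V i. s i \<notin> q \<and> \<sigma> i q = frac q (m i) (s i))"
    by metis
  \<comment> \<open>Intersecting with \<open>U\<close> covers the case \<open>r = 0\<close>, in
    which the family of open sets is empty.\<close>
  define W where "W = U \<inter> (\<Inter>i\<in>{..<r}. V i)"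
  have W: "W = \<Inter>(insert U (V ` {..<r}))" by (auto simp: W_def)
  have "openin proj_topology W"
    unfolding W using assms(1) V by (intro openin_Inter) auto
  moreover have "p \<in> W" "W \<subseteq> U" using V assms by (auto simp: W_def)
  moreover have "\<exists>e t m'. t \<in> homog e \<and> (\<forall>q\<in>W. t \<notin> q) \<and>
    (\<forall>i<r. m' i \<in> G e \<and> (\<forall>q\<in>W. frac q (m i) (s i) = frac q (m' i) t))"
    using open_subset_Proj[OF \<open>openin proj_topology W\<close>] V
    by (intro common_denominator[of W r m d s]) (auto simp: W_def)
  then obtain e t m' where *: "t \<in> homog e \<and> (\<forall>q\<in>W. t \<notin> q) \<and>
      (\<forall>i<r. m' i \<in> G e \<and> (\<forall>q\<in>W. frac q (m i) (s i) = frac q (m' i) t))"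
    by (elim exE)
  moreover have "\<sigma> i q = frac q (m i) (s i)" if "i < r" "q \<in> W" for i q
    using V[OF that(1)] that by (auto simp: W_def)
  ultimately show ?thesis using *
    by (intro exI[of _ W] exI[of _ e] exI[of _ t] exI[of _ m']) simp
qed

end

interpretation O: graded_module "(*) :: ('k::field, 'n::finite) sym \<Rightarrow> _" homog
proof
  show "f * m = 0 \<Longrightarrow> f = 0 \<or> m = 0" for f m :: "('k, 'n) sym" by (rule sym_no_zero_divisors)
qed (auto simp: homog_add homog_mult intro: homog_sum_zero)

section \<open>Local frames give local trivializations\<close>

abbreviation "free_sheaf \<equiv> free_presheaf structure_sheaf"

lemmas sheaf_defs = free_presheaf_def structure_sheaf_def tilde_def

lemma free_sections:
  "psec (free_sheaf r) W = PiE {..<r} (\<lambda>_. tilde_sections (*) homog W)"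
  by (simp add: sheaf_defs)

lemma (in graded_module) hscale_frac:
  assumes "O.fraction p f t" "fraction p m s"
  shows "fraction p (sc f m) (t * s)"
    and "hscale sc G p (O.frac p f t) (frac p m s) = frac p (sc f m) (t * s)"
proof -
  have p: "p \<in> Proj" using assms(2) by (simp add: fraction_def)
  have fr: "fraction p (sc f m) (t * s)" if "O.fraction p f t" "fraction p m s" for f t m s
  proof -
    from that obtain d e where "f \<in> homog d" "t \<in> homog d" "t \<notin> p" "m \<in> G e" "s \<in> homog e" "s \<notin> p"
      by (auto simp: fraction_def O.fraction_def)
    thus ?thesis using p G_scale homog_mult
      by (intro fractionI[of p _ "d + e"]) (auto simp: Proj_mult)
  qed
  show "fraction p (sc f m) (t * s)" by (rule fr[OF assms])
  have eq: "frac p (sc a m') (b * s') = frac p (sc f m) (t * s)"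
    if "(a, b) \<in> O.frac p f t" "(m', s') \<in> frac p m s" for a b m' s'
  proof (rule frac_eqI)
    have *: "O.fraction p a b" "b * f = t * a" "fraction p m' s'" "sc s' m = sc s m'"
      using that unfolding frac_mem[OF p] O.frac_mem[OF p] by blast+
    show "fraction p (sc a m') (b * s')" "fraction p (sc f m) (t * s)"
      using * assms by (auto intro: fr)
    have "sc (t * s) (sc a m') = sc (t * a) (sc s m')" by (simp add: mult_ac)
    also have "\<dots> = sc (b * s') (sc f m)" unfolding *(2,4)[symmetric] by (simp add: mult_ac)
    finally show "sc (t * s) (sc a m') = sc (b * s') (sc f m)" .
  qed
  have ne: "(f, t) \<in> O.frac p f t" "(m, s) \<in> frac p m s"
    using assms frac_mem[OF p] O.frac_mem[OF p] by blast+
  have "(\<Union>(a, b)\<in>O.frac p f t. \<Union>(m', s')\<in>frac p m s. frac p (sc a m') (b * s')) =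
    (\<Union>x\<in>O.frac p f t. \<Union>y\<in>frac p m s. frac p (sc f m) (t * s))"
    using eq by (intro SUP_cong refl) (auto simp: split_beta)
  also have "\<dots> = frac p (sc f m) (t * s)"
    using ne by auto
  finally show "hscale sc G p (O.frac p f t) (frac p m s) = frac p (sc f m) (t * s)"
    by (simp add: hscale_def)
qed

text \<open>Data for a trivialization where \<open>u * s\<close> does not vanish: \<open>s\<close>
  turns the \<open>\<theta> i\<close> into fractions \<open>\<theta> i / s\<close> of degree zero,
  and \<open>u\<close> clears the denominators when elements are expressed through the
  \<open>\<theta> i\<close>. The degree \<open>a + e\<close> of the coefficients makes both sides of
  \<open>gen\<close> homogeneous of degree \<open>a + d + e\<close>.\<close>

locale frame = graded_module sc G
  for sc :: "('k::field, 'n::finite) sym \<Rightarrow> 'm::ab_group_add \<Rightarrow> 'm" and G +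
  fixes r d :: nat and \<theta> :: "nat \<Rightarrow> 'm" and s u :: "('k, 'n) sym" and a :: nat
  assumes theta: "\<And>i. i < r \<Longrightarrow> \<theta> i \<in> G d"
    and indep: "\<And>c i. (\<Sum>i<r. sc (c i) (\<theta> i)) = 0 \<Longrightarrow> i < r \<Longrightarrow> c i = 0"
    and s: "s \<in> homog d" and u: "u \<in> homog (a + d)"
    and gen: "\<And>e \<eta>. \<eta> \<in> G e \<Longrightarrow>
      \<exists>c. (\<forall>i<r. c i \<in> homog (a + e)) \<and> sc u \<eta> = (\<Sum>i<r. sc (c i) (\<theta> i))"
begin

definition dom :: "('k, 'n) sym set set" where
  "dom = {q \<in> Proj. u * s \<notin> q}"

lemma domD: "q \<in> dom \<Longrightarrow> q \<in> Proj \<and> u \<notin> q \<and> s \<notin> q"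
  by (auto simp: dom_def Proj_mult)

definition combine :: "(nat \<Rightarrow> ('k, 'n) sym) \<Rightarrow> 'm" where
  "combine f = (\<Sum>i<r. sc (f i) (\<theta> i))"

lemma combine_fraction:
  assumes "q \<in> dom" "\<And>i. i < r \<Longrightarrow> f i \<in> homog e" "t \<in> homog e" "t \<notin> q"
  shows "fraction q (combine f) (t * s)"
  using domD[OF assms(1)] assms(2-) theta s unfolding combine_def
  by (intro fractionI[of q _ "e + d"] G_sum G_scale homog_mult) (auto simp: Proj_mult)

lemma combine_inj:
  assumes "sc g (combine f) = sc g' (combine f')" "i < r"
  shows "g * f i = g' * f' i"
proof -
  have "(\<Sum>i<r. sc (g * f i - g' * f' i) (\<theta> i)) = 0"
    using assms(1) unfolding combine_def
    by (simp add: scale_sum_right scale_left_diff_distrib sum_subtractf)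
  from indep[OF this assms(2)] show ?thesis by simp
qed

text \<open>On the stalk at \<open>q\<close>, the isomorphism sends \<open>c\<close> to \<open>\<Sum>i. c\<^sub>i \<theta>\<^sub>i / s\<close>.\<close>

definition corr :: "('k, 'n) sym set \<Rightarrow> (nat \<Rightarrow> (('k, 'n) sym \<times> ('k, 'n) sym) set) \<Rightarrow>
    ('m \<times> ('k, 'n) sym) set \<Rightarrow> bool" where
  "corr q c x \<longleftrightarrow> (\<exists>t f e. t \<in> homog e \<and> t \<notin> q \<and>
     (\<forall>i<r. f i \<in> homog e \<and> c i = O.frac q (f i) t) \<and> x = frac q (combine f) (t * s))"

lemma corrI:
  "t \<in> homog e \<Longrightarrow> t \<notin> q \<Longrightarrow> (\<And>i. i < r \<Longrightarrow> f i \<in> homog e) \<Longrightarrow>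
   (\<And>i. i < r \<Longrightarrow> c i = O.frac q (f i) t) \<Longrightarrow> x = frac q (combine f) (t * s) \<Longrightarrow> corr q c x"
  unfolding corr_def by blast

lemma corr_cong: "corr q c x \<Longrightarrow> (\<And>i. i < r \<Longrightarrow> c' i = c i) \<Longrightarrow> corr q c' x"
  unfolding corr_def by simp

lemma corrE:
  assumes "corr q c x"
  obtains t f e where "t \<in> homog e" "t \<notin> q" "\<And>i. i < r \<Longrightarrow> f i \<in> homog e"
    "\<And>i. i < r \<Longrightarrow> c i = O.frac q (f i) t" "x = frac q (combine f) (t * s)"
proof -
  from assms obtain t f e where "t \<in> homog e \<and> t \<notin> q \<and>
     (\<forall>i<r. f i \<in> homog e \<and> c i = O.frac q (f i) t) \<and> x = frac q (combine f) (t * s)"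
    unfolding corr_def by (elim exE)
  thus ?thesis by (intro that[of t e f]) simp_all
qed

text \<open>One direction makes \<open>corr\<close> single-valued, which justifies the
  \<open>THE\<close> in \<open>glue\<close>; the other makes it injective. After clearing
  denominators both amount to independence of the \<open>\<theta> i\<close>.\<close>

lemma corr_iff:
  assumes "q \<in> dom" "corr q c x" "corr q c' x'"
  shows "x = x' \<longleftrightarrow> (\<forall>i<r. c i = c' i)"
proof -
  obtain t f e where 1: "t \<in> homog e" "t \<notin> q" "\<And>i. i < r \<Longrightarrow> f i \<in> homog e"
    "\<And>i. i < r \<Longrightarrow> c i = O.frac q (f i) t" "x = frac q (combine f) (t * s)"
    using corrE[OF assms(2)] by metis
  obtain t' f' e' where 2: "t' \<in> homog e'" "t' \<notin> q" "\<And>i. i < r \<Longrightarrow> f' i \<in> homog e'"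
    "\<And>i. i < r \<Longrightarrow> c' i = O.frac q (f' i) t'" "x' = frac q (combine f') (t' * s)"
    using corrE[OF assms(3)] by metis
  have q: "q \<in> Proj" "s \<noteq> 0" using domD[OF assms(1)] Proj_0 by auto
  have fr: "O.fraction q (f i) t" "O.fraction q (f' i) t'" if "i < r" for i
    using 1 2 q that by (auto intro: O.fractionI[OF q(1) 1(3) 1(1)] O.fractionI[OF q(1) 2(3) 2(1)])
  have "x = x' \<longleftrightarrow> sc (t' * s) (combine f) = sc (t * s) (combine f')"
    unfolding 1 2 by (intro frac_eq_iff combine_fraction[OF assms(1)]) (use 1 2 in auto)
  also have "\<dots> \<longleftrightarrow> sc t' (combine f) = sc t (combine f')"
    using sc_cancel[OF q(2), of "sc t' (combine f)" "sc t (combine f')"] by (simp add: mult.commute)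
  also have "\<dots> \<longleftrightarrow> (\<forall>i<r. t' * f i = t * f' i)"
  proof
    assume *: "\<forall>i<r. t' * f i = t * f' i"
    show "sc t' (combine f) = sc t (combine f')"
      unfolding combine_def scale_sum_right using * by (intro sum.cong) simp_all
  qed (use combine_inj in blast)
  also have "\<dots> \<longleftrightarrow> (\<forall>i<r. c i = c' i)"
    using 1(4) 2(4) O.frac_eq_iff[OF fr] by auto
  finally show ?thesis .
qed

lemma corr_total:
  assumes q: "q \<in> dom" and c: "\<And>i. i < r \<Longrightarrow> c i \<in> hlocalization (*) homog q"
  shows "\<exists>x. corr q c x"
proof -
  have qP: "q \<in> Proj" using domD[OF q] by simp
  have "\<forall>i. \<exists>e f t. i < r \<longrightarrow> f \<in> homog e \<and> t \<in> homog e \<and> t \<notin> q \<and> c i = O.frac q f t"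
    using O.hlocalization_frac[OF qP c] by metis
  then obtain e f t where *: "\<And>i. i < r \<Longrightarrow> f i \<in> homog (e i) \<and> t i \<in> homog (e i) \<and> t i \<notin> q \<and>
      c i = O.frac q (f i) (t i)"
    by metis
  have "\<exists>e' t' f'. t' \<in> homog e' \<and> (\<forall>q\<in>{q}. t' \<notin> q) \<and>
    (\<forall>i<r. f' i \<in> homog e' \<and> (\<forall>q\<in>{q}. O.frac q (f i) (t i) = O.frac q (f' i) t'))"
    using * qP by (intro O.common_denominator[of "{q}" r f e t]) auto
  then obtain e' t' f' where "t' \<in> homog e' \<and> (\<forall>q\<in>{q}. t' \<notin> q) \<and>
    (\<forall>i<r. f' i \<in> homog e' \<and> (\<forall>q\<in>{q}. O.frac q (f i) (t i) = O.frac q (f' i) t'))"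
    by (elim exE)
  thus ?thesis using * by (intro exI corrI[of t' e' q f']) auto
qed

text \<open>From \<open>gen\<close>, the fraction \<open>\<eta> / t\<close> equals the sum of
  \<open>(c i * s) / (u * t)\<close> times \<open>\<theta> i / s\<close>. The numerators do not
  depend on \<open>q\<close>, so preimages of sections are again locally given by single
  fractions.\<close>

lemma corr_generic:
  assumes "\<eta> \<in> G e" "t \<in> homog e"
  shows "\<exists>b. (\<forall>i<r. b i \<in> homog (a + d + e)) \<and>
    (\<forall>q\<in>dom. t \<notin> q \<longrightarrow> corr q (\<lambda>i. O.frac q (b i) (u * t)) (frac q \<eta> t))"
proof -
  obtain c where c: "\<And>i. i < r \<Longrightarrow> c i \<in> homog (a + e)" "sc u \<eta> = combine c"
    using gen[OF assms(1)] unfolding combine_def by auto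
  have deg: "c i * s \<in> homog (a + d + e)" if "i < r" for i
    using homog_mult[OF c(1)[OF that] s] by (simp add: ac_simps)
  have ut: "u * t \<in> homog (a + d + e)" using homog_mult[OF u assms(2)] .
  show ?thesis
  proof (intro exI[of _ "\<lambda>i. c i * s"] conjI ballI impI)
    show "corr q (\<lambda>i. O.frac q (c i * s) (u * t)) (frac q \<eta> t)" if "q \<in> dom" "t \<notin> q" for q
    proof (rule corrI[OF ut])
      show ut': "u * t \<notin> q" using domD[OF that(1)] that(2) by (simp add: Proj_mult)
      show "frac q \<eta> t = frac q (combine (\<lambda>i. c i * s)) (u * t * s)"
      proof (rule frac_eqI)
        show "fraction q \<eta> t" using domD[OF that(1)] that assms by (auto intro: fractionI)
        show "fraction q (combine (\<lambda>i. c i * s)) (u * t * s)"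
          using that(1) deg ut ut' by (rule combine_fraction)
        have "combine (\<lambda>i. c i * s) = sc s (combine c)"
          by (simp add: combine_def scale_sum_right mult.commute)
        thus "sc (u * t * s) \<eta> = sc t (combine (\<lambda>i. c i * s))"
          unfolding c(2)[symmetric] by (simp add: mult_ac)
      qed
    qed (use deg in auto)
  qed (use deg in auto)
qed

lemma corr_add:
  assumes q: "q \<in> dom" and "corr q c x" "corr q c' x'"
  shows "corr q (\<lambda>i. hadd (*) homog q (c i) (c' i)) (hadd sc G q x x')"
proof -
  obtain t f e where 1: "t \<in> homog e" "t \<notin> q" "\<And>i. i < r \<Longrightarrow> f i \<in> homog e"
    "\<And>i. i < r \<Longrightarrow> c i = O.frac q (f i) t" "x = frac q (combine f) (t * s)"
    using corrE[OF assms(2)] by metis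
  obtain t' f' e' where 2: "t' \<in> homog e'" "t' \<notin> q" "\<And>i. i < r \<Longrightarrow> f' i \<in> homog e'"
    "\<And>i. i < r \<Longrightarrow> c' i = O.frac q (f' i) t'" "x' = frac q (combine f') (t' * s)"
    using corrE[OF assms(3)] by metis
  have qP: "q \<in> Proj" using domD[OF q] by simp
  have tt: "t * t' \<in> homog (e + e')" "t * t' \<notin> q"
    using 1 2 qP homog_mult by (auto simp: Proj_mult)
  have deg: "t' * f i + t * f' i \<in> homog (e + e')" if "i < r" for i
    using homog_mult[OF 2(1) 1(3)[OF that]] homog_mult[OF 1(1) 2(3)[OF that]]
    by (intro homog_add) (simp_all add: add.commute)
  have fr: "fraction q (combine f) (t * s)" "fraction q (combine f') (t' * s)"
    by (rule combine_fraction[OF q 1(3) 1(1,2)], assumption) (rule combine_fraction[OF q 2(3) 2(1,2)])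
  show ?thesis
  proof (rule corrI[OF tt deg])
    fix i assume i: "i < r"
    have "O.fraction q (f i) t" "O.fraction q (f' i) t'"
      using 1 2 i by (auto intro: O.fractionI[OF qP 1(3) 1(1)] O.fractionI[OF qP 2(3) 2(1)])
    thus "hadd (*) homog q (c i) (c' i) = O.frac q (t' * f i + t * f' i) (t * t')"
      using i by (simp add: 1 2 O.hadd_frac)
  next
    have c: "combine (\<lambda>i. t' * f i + t * f' i) = sc t' (combine f) + sc t (combine f')"
      by (simp add: combine_def scale_left_distrib sum.distrib scale_sum_right)
    show "hadd sc G q x x' = frac q (combine (\<lambda>i. t' * f i + t * f' i)) (t * t' * s)"
      unfolding 1 2 hadd_frac[OF fr]
    proof (rule frac_eqI[OF fraction_add[OF fr] combine_fraction[OF q deg tt]])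
      show "sc (t * t' * s) (sc (t' * s) (combine f) + sc (t * s) (combine f')) =
          sc (t * s * (t' * s)) (combine (\<lambda>i. t' * f i + t * f' i))"
        unfolding c by (simp add: scale_right_distrib mult_ac)
    qed
  qed
qed

lemma corr_scale:
  assumes q: "q \<in> dom" and b: "b \<in> hlocalization (*) homog q" and "corr q c x"
  shows "corr q (\<lambda>i. hscale (*) homog q b (c i)) (hscale sc G q b x)"
proof -
  obtain t f e where 1: "t \<in> homog e" "t \<notin> q" "\<And>i. i < r \<Longrightarrow> f i \<in> homog e"
    "\<And>i. i < r \<Longrightarrow> c i = O.frac q (f i) t" "x = frac q (combine f) (t * s)"
    using corrE[OF assms(3)] by metis
  have qP: "q \<in> Proj" using domD[OF q] by simp
  obtain e' g t' where 2: "g \<in> homog e'" "t' \<in> homog e'" "t' \<notin> q" "O.fraction q g t'" "b = O.frac q g t'"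
    using O.hlocalization_frac[OF qP b] by metis
  have fr: "fraction q (combine f) (t * s)"
    by (rule combine_fraction[OF q 1(3) 1(1,2)])
  show ?thesis
  proof (rule corrI[of "t' * t" "e' + e" q "\<lambda>i. g * f i"])
    fix i assume i: "i < r"
    have "O.fraction q (f i) t" using 1 i qP by (auto intro: O.fractionI)
    thus "hscale (*) homog q b (c i) = O.frac q (g * f i) (t' * t)"
      using i 2 by (simp add: 1 O.hscale_frac)
  next
    have "combine (\<lambda>i. g * f i) = sc g (combine f)"
      by (simp add: combine_def scale_sum_right)
    thus "hscale sc G q b x = frac q (combine (\<lambda>i. g * f i)) (t' * t * s)"
      unfolding 1 2 using hscale_frac[OF 2(4) fr] by (simp add: mult.assoc)
  qed (use 1 2 qP in \<open>auto simp: Proj_mult intro: homog_mult\<close>)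
qed

definition glue :: "('k, 'n) sym set set \<Rightarrow>
    (nat \<Rightarrow> ('k, 'n) sym set \<Rightarrow> (('k, 'n) sym \<times> ('k, 'n) sym) set) \<Rightarrow>
    ('k, 'n) sym set \<Rightarrow> ('m \<times> ('k, 'n) sym) set" where
  "glue W c = (\<lambda>q\<in>W. THE x. corr q (\<lambda>i. c i q) x)"

lemma glue_eqI:
  assumes "W \<subseteq> dom" "q \<in> W" "corr q (\<lambda>i. c i q) x"
  shows "glue W c q = x"
  unfolding glue_def using assms corr_iff[of q "\<lambda>i. c i q"] by (auto intro!: the_equality)

lemma corr_glue:
  assumes "W \<subseteq> dom" "q \<in> W" "c \<in> PiE {..<r} (\<lambda>_. tilde_sections (*) homog W)"
  shows "corr q (\<lambda>i. c i q) (glue W c q)"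
proof -
  have "\<exists>x. corr q (\<lambda>i. c i q) x"
    using assms O.sections_PiE by (intro corr_total) (fastforce simp: PiE_def)+
  thus ?thesis using glue_eqI[OF assms(1,2), of c] by blast
qed

lemma glue_section:
  assumes W: "openin proj_topology W" "W \<subseteq> dom" and c: "c \<in> PiE {..<r} (\<lambda>_. tilde_sections (*) homog W)"
  shows "glue W c \<in> tilde_sections sc G W"
proof (rule sectionsI)
  fix p assume p: "p \<in> W"
  have "\<forall>i<r. c i \<in> tilde_sections (*) homog W"
    using PiE_mem[OF c] by simp
  from O.sections_common[OF W(1) p this] obtain W' e t f
    where *: "openin proj_topology W'" "p \<in> W'" "W' \<subseteq> W" "t \<in> homog e"
      "\<forall>q\<in>W'. t \<notin> q" "\<forall>i<r. f i \<in> homog e"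
      "\<forall>i<r. \<forall>q\<in>W'. c i q = O.frac q (f i) t"
    by (elim exE conjE)
  have "combine f \<in> G (e + d)"
    unfolding combine_def using * theta by (intro G_sum G_scale) auto
  moreover have "t * s \<in> homog (e + d)" using * s by (intro homog_mult)
  moreover have "t * s \<notin> q" if "q \<in> W'" for q
    using that * W(2) domD[of q] by (auto simp: Proj_mult)
  moreover have "glue W c q = frac q (combine f) (t * s)" if "q \<in> W'" for q
    using that * by (intro glue_eqI[OF W(2)] corrI[of t e q f]) auto
  ultimately show "\<exists>W' d m s. openin proj_topology W' \<and> p \<in> W' \<and> W' \<subseteq> W \<and> m \<in> G d \<and>
      s \<in> homog d \<and> (\<forall>q\<in>W'. s \<notin> q \<and> glue W c q = frac q m s)"
    using * by (intro exI[of _ W'] exI[of _ "e + d"] exI[of _ "combine f"] exI[of _ "t * s"]) auto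
qed (use open_subset_Proj[OF W(1)] in \<open>auto simp: glue_def\<close>)

lemma glue_inj:
  assumes W: "W \<subseteq> dom" and c: "c \<in> PiE {..<r} (\<lambda>_. tilde_sections (*) homog W)"
    and c': "c' \<in> PiE {..<r} (\<lambda>_. tilde_sections (*) homog W)" and eq: "glue W c = glue W c'"
  shows "c = c'"
proof (rule PiE_ext[OF c c'])
  fix i assume i: "i \<in> {..<r}"
  have "c i q = c' i q" if "q \<in> W" for q
    using corr_iff[OF _ corr_glue[OF W that c] corr_glue[OF W that c']] eq W that i by auto
  thus "c i = c' i"
    by (rule PiE_ext[OF O.sections_PiE[OF PiE_mem[OF c i]] O.sections_PiE[OF PiE_mem[OF c' i]]])
qed

lemma glue_surj:
  assumes W: "openin proj_topology W" "W \<subseteq> dom" and \<sigma>: "\<sigma> \<in> tilde_sections sc G W"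
  shows "\<exists>c\<in>PiE {..<r} (\<lambda>_. tilde_sections (*) homog W). glue W c = \<sigma>"
proof -
  \<comment> \<open>A preimage is chosen separately on each stalk. By \<open>corr_iff\<close> its
    entries with index below \<open>r\<close> are unique, so they agree with the uniform fractions
    \<open>b i / t\<close> obtained locally in \<open>loc\<close>.\<close>
  define c where "c = (\<lambda>i\<in>{..<r}. \<lambda>q\<in>W. (SOME c. corr q c (\<sigma> q)) i)"
  have loc: "\<exists>V e t b. openin proj_topology V \<and> p \<in> V \<and> V \<subseteq> W \<and> t \<in> homog e \<and>
      (\<forall>i<r. b i \<in> homog e) \<and> (\<forall>q\<in>V. t \<notin> q \<and> corr q (\<lambda>i. O.frac q (b i) t) (\<sigma> q))"
    if "p \<in> W" for p
  proof -
    from sections_local[OF \<sigma> that] obtain V e \<eta> t where V: "openin proj_topology V" "p \<in> V" "V \<subseteq> W"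
      "\<eta> \<in> G e" "t \<in> homog e" "\<forall>q\<in>V. t \<notin> q \<and> \<sigma> q = frac q \<eta> t"
      by (elim exE conjE)
    from corr_generic[OF V(4,5)] obtain b where b: "\<forall>i<r. b i \<in> homog (a + d + e)"
      "\<forall>q\<in>dom. t \<notin> q \<longrightarrow> corr q (\<lambda>i. O.frac q (b i) (u * t)) (frac q \<eta> t)"
      by (elim exE conjE)
    have "u * t \<in> homog (a + d + e)" using u V(5) by (rule homog_mult)
    moreover have "u * t \<notin> q" if "q \<in> V" for q
      using that V W(2) domD[of q] by (auto simp: Proj_mult)
    moreover have "corr q (\<lambda>i. O.frac q (b i) (u * t)) (\<sigma> q)" if "q \<in> V" for q
      using b(2) that V W(2) by auto
    ultimately show ?thesis using V b(1)
      by (intro exI[of _ V] exI[of _ "a + d + e"] exI[of _ "u * t"] exI[of _ b]) auto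
  qed
  have corr: "corr q (\<lambda>i. c i q) (\<sigma> q)" if "q \<in> W" for q
  proof -
    from loc[OF that] obtain V e t b where "q \<in> V"
      "\<forall>q\<in>V. t \<notin> q \<and> corr q (\<lambda>i. O.frac q (b i) t) (\<sigma> q)"
      by (elim exE conjE)
    hence "corr q (\<lambda>i. O.frac q (b i) t) (\<sigma> q)" by simp
    hence "corr q (SOME c. corr q c (\<sigma> q)) (\<sigma> q)"
      by (rule someI[of "\<lambda>c. corr q c (\<sigma> q)"])
    thus ?thesis by (rule corr_cong) (use that in \<open>simp add: c_def\<close>)
  qed
  have "c i \<in> tilde_sections (*) homog W" if i: "i < r" for i
  proof (rule O.sectionsI)
    fix p assume "p \<in> W"
    from loc[OF this] obtain V e t b where V: "openin proj_topology V" "p \<in> V" "V \<subseteq> W" "t \<in> homog e"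
      "\<forall>i<r. b i \<in> homog e" "\<forall>q\<in>V. t \<notin> q \<and> corr q (\<lambda>i. O.frac q (b i) t) (\<sigma> q)"
      by (elim exE conjE)
    have "c i q = O.frac q (b i) t" if "q \<in> V" for q
    proof -
      have q: "q \<in> W" "q \<in> dom" using that V(3) W(2) by auto
      have "corr q (\<lambda>i. O.frac q (b i) t) (\<sigma> q)" using V(6) that by simp
      from corr_iff[OF q(2) corr[OF q(1)] this] i show ?thesis by simp
    qed
    thus "\<exists>V d m s. openin proj_topology V \<and> p \<in> V \<and> V \<subseteq> W \<and> m \<in> homog d \<and>
        s \<in> homog d \<and> (\<forall>q\<in>V. s \<notin> q \<and> c i q = O.frac q m s)"
      using V(1-5) i V(6) by (intro exI[of _ V] exI[of _ e] exI[of _ "b i"] exI[of _ t]) simp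
  qed (use open_subset_Proj[OF W(1)] i in \<open>auto simp: c_def\<close>)
  hence "c \<in> PiE {..<r} (\<lambda>_. tilde_sections (*) homog W)"
    by (auto simp: c_def)
  moreover have "glue W c = \<sigma>"
  proof
    fix q show "glue W c q = \<sigma> q"
    proof (cases "q \<in> W")
      case True
      thus ?thesis using corr by (intro glue_eqI[OF W(2)])
    next
      case False
      thus ?thesis using sections_PiE[OF \<sigma>] by (auto simp: glue_def)
    qed
  qed
  ultimately show ?thesis by blast
qed

text \<open>Each compatibility is checked stalk by stalk, since \<open>glue_eqI\<close> recognizes
  the value of \<open>glue\<close> from \<open>corr\<close>; outside the open set both sides are
  \<open>undefined\<close>.\<close>

lemma frame_iso:
  "module_iso_on proj_topology structure_sheaf dom (free_sheaf r) (tilde sc G)"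
  unfolding module_iso_on_def
proof (intro exI[of _ glue] allI impI, elim conjE, intro conjI ballI allI impI)
  fix W assume W: "openin proj_topology W" "W \<subseteq> dom"
  show "bij_betw (glue W) (psec (free_sheaf r) W) (psec (tilde sc G) W)"
    unfolding bij_betw_def inj_on_def free_sections
  proof (intro conjI ballI impI)
    show "glue W ` PiE {..<r} (\<lambda>_. tilde_sections (*) homog W) = psec (tilde sc G) W"
      using glue_section[OF W] glue_surj[OF W] by (auto simp: tilde_def)
  qed (use glue_inj[OF W(2)] in blast)
next
  fix W c c' assume W: "openin proj_topology W" "W \<subseteq> dom"
    and "c \<in> psec (free_sheaf r) W" "c' \<in> psec (free_sheaf r) W"
  hence c: "c \<in> PiE {..<r} (\<lambda>_. tilde_sections (*) homog W)" "c' \<in> PiE {..<r} (\<lambda>_. tilde_sections (*) homog W)"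
    by (simp_all only: free_sections)
  show "glue W (padd (free_sheaf r) W c c') = padd (tilde sc G) W (glue W c) (glue W c')"
  proof
    fix q
    show "glue W (padd (free_sheaf r) W c c') q = padd (tilde sc G) W (glue W c) (glue W c') q"
    proof (cases "q \<in> W")
      case True
      have "corr q (\<lambda>i. padd (free_sheaf r) W c c' i q) (hadd sc G q (glue W c q) (glue W c' q))"
        using corr_add[OF _ corr_glue[OF W(2) True c(1)] corr_glue[OF W(2) True c(2)]] True W(2)
        by (auto simp: corr_def sheaf_defs)
      hence "glue W (padd (free_sheaf r) W c c') q = hadd sc G q (glue W c q) (glue W c' q)"
        by (rule glue_eqI[OF W(2) True])
      thus ?thesis using True by (simp add: tilde_def)
    qed (simp add: glue_def tilde_def)
  qed
next
  fix W b c assume W: "openin proj_topology W" "W \<subseteq> dom" and b: "b \<in> psec structure_sheaf W"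
    and "c \<in> psec (free_sheaf r) W"
  hence c: "c \<in> PiE {..<r} (\<lambda>_. tilde_sections (*) homog W)"
    by (simp only: free_sections)
  show "glue W (pscale (free_sheaf r) W b c) = pscale (tilde sc G) W b (glue W c)"
  proof
    fix q
    show "glue W (pscale (free_sheaf r) W b c) q = pscale (tilde sc G) W b (glue W c) q"
    proof (cases "q \<in> W")
      case True
      have "b q \<in> hlocalization (*) homog q"
        using O.sections_PiE[of b W] b True by (auto simp: structure_sheaf_def tilde_def PiE_def)
      hence "corr q (\<lambda>i. pscale (free_sheaf r) W b c i q) (hscale sc G q (b q) (glue W c q))"
        using corr_scale[OF _ _ corr_glue[OF W(2) True c], of "b q"] True W(2)
        by (auto simp: corr_def sheaf_defs)
      hence "glue W (pscale (free_sheaf r) W b c) q = hscale sc G q (b q) (glue W c q)"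
        by (rule glue_eqI[OF W(2) True])
      thus ?thesis using True by (simp add: tilde_def)
    qed (simp add: glue_def tilde_def)
  qed
next
  fix W W' c assume W: "openin proj_topology W" "W \<subseteq> dom" and W': "openin proj_topology W' \<and> W' \<subseteq> W"
    and "c \<in> psec (free_sheaf r) W"
  hence c: "c \<in> PiE {..<r} (\<lambda>_. tilde_sections (*) homog W)"
    by (simp only: free_sections)
  show "glue W' (pres (free_sheaf r) W W' c) = pres (tilde sc G) W W' (glue W c)"
  proof
    fix q
    show "glue W' (pres (free_sheaf r) W W' c) q = pres (tilde sc G) W W' (glue W c) q"
    proof (cases "q \<in> W'")
      case True
      hence "q \<in> W" using W' by auto
      have "corr q (\<lambda>i. pres (free_sheaf r) W W' c i q) (glue W c q)"
        using corr_glue[OF W(2) \<open>q \<in> W\<close> c] True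
        by (auto simp: corr_def sheaf_defs)
      moreover have "W' \<subseteq> dom" using W W' by auto
      ultimately have "glue W' (pres (free_sheaf r) W W' c) q = glue W c q"
        using True by (intro glue_eqI)
      thus ?thesis using True by (simp add: tilde_def)
    qed (simp add: glue_def tilde_def)
  qed
qed

end

section \<open>Local trivializations give local frames\<close>

definition fraction_tuple ::
  "nat \<Rightarrow> ('k::field, 'n::finite) sym set set \<Rightarrow> (nat \<Rightarrow> ('k, 'n) sym) \<Rightarrow> ('k, 'n) sym \<Rightarrow>
   nat \<Rightarrow> ('k, 'n) sym set \<Rightarrow> (('k, 'n) sym \<times> ('k, 'n) sym) set" where
  "fraction_tuple r W f t = (\<lambda>i\<in>{..<r}. \<lambda>q\<in>W. O.frac q (f i) t)"

lemma fraction_tuple_mem: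
  assumes "openin proj_topology W" "\<And>i. i < r \<Longrightarrow> f i \<in> homog e" "t \<in> homog e" "\<And>q. q \<in> W \<Longrightarrow> t \<notin> q"
  shows "fraction_tuple r W f t \<in> psec (free_sheaf r) W"
  unfolding free_sections fraction_tuple_def using assms by (auto intro!: O.frac_section)

locale local_trivialization = graded_module sc G
  for sc :: "('k::field, 'n::finite) sym \<Rightarrow> 'm::ab_group_add \<Rightarrow> 'm" and G +
  fixes U :: "('k, 'n) sym set set" and r :: nat and \<phi>
  assumes U: "openin proj_topology U"
    and bij: "\<And>W. openin proj_topology W \<Longrightarrow> W \<subseteq> U \<Longrightarrow>
      bij_betw (\<phi> W) (psec (free_sheaf r) W) (psec (tilde sc G) W)"
    and add: "\<And>W c c'. openin proj_topology W \<Longrightarrow> W \<subseteq> U \<Longrightarrow>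
      c \<in> psec (free_sheaf r) W \<Longrightarrow> c' \<in> psec (free_sheaf r) W \<Longrightarrow>
      \<phi> W (padd (free_sheaf r) W c c') = padd (tilde sc G) W (\<phi> W c) (\<phi> W c')"
    and scale: "\<And>W b c. openin proj_topology W \<Longrightarrow> W \<subseteq> U \<Longrightarrow> b \<in> psec structure_sheaf W \<Longrightarrow>
      c \<in> psec (free_sheaf r) W \<Longrightarrow>
      \<phi> W (pscale (free_sheaf r) W b c) = pscale (tilde sc G) W b (\<phi> W c)"
    and res: "\<And>W W' c. openin proj_topology W \<Longrightarrow> W \<subseteq> U \<Longrightarrow> openin proj_topology W' \<Longrightarrow> W' \<subseteq> W \<Longrightarrow>
      c \<in> psec (free_sheaf r) W \<Longrightarrow>
      \<phi> W' (pres (free_sheaf r) W W' c) = pres (tilde sc G) W W' (\<phi> W c)"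
begin

abbreviation "F \<equiv> free_sheaf r"

definition unit_tuple where
  "unit_tuple W k = fraction_tuple r W (\<lambda>j. if j = k then 1 else 0) 1"

lemma mem: "openin proj_topology W \<Longrightarrow> W \<subseteq> U \<Longrightarrow> c \<in> psec F W \<Longrightarrow> \<phi> W c \<in> tilde_sections sc G W"
  using bij[of W] by (auto simp: bij_betw_def tilde_def)

lemma unit_tuple_mem:
  assumes "openin proj_topology W"
  shows "unit_tuple W k \<in> psec F W"
  unfolding unit_tuple_def
  by (rule fraction_tuple_mem[OF assms, of _ _ 0]) (use Proj_1 open_subset_Proj[OF assms] in auto)

lemma sections_eqI:
  assumes "\<sigma> \<in> tilde_sections sc G W" "\<And>q. q \<in> W \<Longrightarrow> \<sigma> q = x q"
  shows "\<sigma> = (\<lambda>q\<in>W. x q)"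
proof
  fix q show "\<sigma> q = (\<lambda>q\<in>W. x q) q"
    using assms sections_PiE[OF assms(1)] by (cases "q \<in> W") (auto simp: PiE_def extensional_def)
qed

text \<open>An additive map sends the zero tuple to an element equal to its own double, and
  cancellation shows that this element is zero.\<close>

lemma hadd_idem:
  assumes q: "q \<in> Proj" and x: "x \<in> hlocalization sc G q" and "hadd sc G q x x = x" and t: "fraction q 0 t"
  shows "x = frac q 0 t"
proof -
  obtain m v where mv: "fraction q m v" "x = frac q m v"
    using hlocalization_frac[OF q x] by metis
  have "frac q (sc v m + sc v m) (v * v) = frac q m v"
    using assms(3) mv by (simp add: hadd_frac)
  hence "sc v (sc v m + sc v m) = sc (v * v) m"
    using frac_eq_iff[OF fraction_add[OF mv(1) mv(1)] mv(1)] by simp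
  hence "sc (v * v) m = 0" by (simp add: scale_right_distrib)
  moreover have "v * v \<noteq> 0" using fraction_nonzero[OF mv(1)] sym_no_zero_divisors by blast
  ultimately have "m = 0" using torsion_free by blast
  thus ?thesis unfolding mv(2) using mv(1) t by (intro frac_eqI) simp_all
qed

text \<open>Linearity of \<open>\<phi>\<close> on fractions: the images of the standard basis
  sections are \<open>\<theta> i / s\<close>, so the tuple of the \<open>f i / t\<close> goes to the
  sum of the products.\<close>

lemma combination:
  assumes W: "openin proj_topology W" "W \<subseteq> U"
    and \<theta>: "\<And>i. i < r \<Longrightarrow> \<theta> i \<in> G d" and s: "s \<in> homog d" "\<And>q. q \<in> W \<Longrightarrow> s \<notin> q"
    and unit: "\<And>i q. i < r \<Longrightarrow> q \<in> W \<Longrightarrow> \<phi> U (unit_tuple U i) q = frac q (\<theta> i) s"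
    and f: "\<And>i. i < r \<Longrightarrow> f i \<in> homog e" and t: "t \<in> homog e" "\<And>q. q \<in> W \<Longrightarrow> t \<notin> q"
  shows "\<phi> W (fraction_tuple r W f t) = (\<lambda>q\<in>W. frac q (\<Sum>i<r. sc (f i) (\<theta> i)) (t * s))"
proof -
  \<comment> \<open>The tuple cut off after \<open>k\<close> entries; entry \<open>k\<close> is
    added as a multiple of the \<open>k\<close>-th standard basis section.\<close>
  define C where "C k = fraction_tuple r W (\<lambda>j. if j < k then f j else 0) t" for k
  have qP: "q \<in> Proj" if "q \<in> W" for q using that open_subset_Proj[OF W(1)] by auto
  have C: "C k \<in> psec F W" for k
    unfolding C_def by (rule fraction_tuple_mem[OF W(1), of _ _ e]) (use f t in auto)
  have fr: "fraction q (\<Sum>i<k. sc (f i) (\<theta> i)) (t * s)" if "q \<in> W" "k \<le> r" for q k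
    using that \<theta> s t f qP homog_mult[OF t(1) s(1)]
    by (intro fractionI[of q _ "e + d"] G_sum G_scale) (auto simp: Proj_mult)
  have Ofr: "O.fraction q g t" if "q \<in> W" "g \<in> homog e" for q g
    using O.fractionI[OF qP[OF that(1)] that(2) t(1) t(2)[OF that(1)]] .
  have "\<phi> W (C k) = (\<lambda>q\<in>W. frac q (\<Sum>i<k. sc (f i) (\<theta> i)) (t * s))" if "k \<le> r" for k
    using that
  proof (induction k)
    case 0
    have "padd F W (C 0) (C 0) = C 0"
    proof (intro ext)
      fix i q
      have "hadd (*) homog q (O.frac q 0 t) (O.frac q 0 t) = O.frac q 0 t" if "q \<in> W"
        using O.hadd_common[of q 0 t 0] Ofr[OF that, of 0] by simp
      thus "padd F W (C 0) (C 0) i q = C 0 i q"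
        by (simp add: C_def fraction_tuple_def sheaf_defs restrict_def)
    qed
    hence eq: "padd (tilde sc G) W (\<phi> W (C 0)) (\<phi> W (C 0)) = \<phi> W (C 0)"
      using add[OF W C C, of 0 0] by simp
    show ?case
    proof (rule sections_eqI[OF mem[OF W C]])
      fix q assume q: "q \<in> W"
      have "hadd sc G q (\<phi> W (C 0) q) (\<phi> W (C 0) q) = \<phi> W (C 0) q"
        using fun_cong[OF eq, of q] q by (simp add: tilde_def)
      moreover have "\<phi> W (C 0) q \<in> hlocalization sc G q"
        using sections_PiE[OF mem[OF W C]] q by (rule PiE_mem)
      ultimately show "\<phi> W (C 0) q = frac q (\<Sum>i<0. sc (f i) (\<theta> i)) (t * s)"
        using hadd_idem[OF qP[OF q]] fr[OF q, of 0] by simp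
    qed
  next
    case (Suc k)
    define b where "b = (\<lambda>q\<in>W. O.frac q (f k) t)"
    have k: "k < r" using Suc.prems by simp
    have b: "b \<in> psec structure_sheaf W"
      unfolding b_def structure_sheaf_def tilde_def using O.frac_section[OF W(1) f[OF k] t] by simp
    have E: "unit_tuple W k \<in> psec F W" using unit_tuple_mem[OF W(1)] .
    have bE: "pscale F W b (unit_tuple W k) = fraction_tuple r W (\<lambda>j. if j = k then f k else 0) t"
    proof (intro ext)
      fix i q
      have "hscale (*) homog q (O.frac q (f k) t) (O.frac q (if i = k then 1 else 0) 1) =
        O.frac q (if i = k then f k else 0) t" if "q \<in> W"
      proof -
        have "O.fraction q (if i = k then 1 else 0) 1"
          using O.fractionI[OF qP[OF that], of _ 0 1] Proj_1[OF qP[OF that]] by simp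
        from O.hscale_frac(2)[OF Ofr[OF that f[OF k]] this] show ?thesis
          by (cases "i = k") simp_all
      qed
      thus "pscale F W b (unit_tuple W k) i q = fraction_tuple r W (\<lambda>j. if j = k then f k else 0) t i q"
        by (simp add: b_def unit_tuple_def fraction_tuple_def sheaf_defs restrict_def)
    qed
    have bEm: "pscale F W b (unit_tuple W k) \<in> psec F W"
      unfolding bE by (rule fraction_tuple_mem[OF W(1), of _ _ e]) (use f[OF k] t in auto)
    have "padd F W (C k) (pscale F W b (unit_tuple W k)) = C (Suc k)"
      unfolding bE
    proof (intro ext)
      fix i q
      have "hadd (*) homog q (O.frac q (if i < k then f i else 0) t)
          (O.frac q (if i = k then f k else 0) t) =
        O.frac q (if i < Suc k then f i else 0) t" if "q \<in> W" "i < r"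
      proof -
        have "(if i < k then f i else 0) \<in> homog e" "(if i = k then f k else 0) \<in> homog e"
          "(if i < k then f i else 0) + (if i = k then f k else 0) \<in> homog e"
          using f that k by auto
        note Ofr[OF that(1) this(1)] Ofr[OF that(1) this(2)] Ofr[OF that(1) this(3)]
        from O.hadd_common[OF this] show ?thesis
          by (auto simp: less_Suc_eq)
      qed
      thus "padd F W (C k) (fraction_tuple r W (\<lambda>j. if j = k then f k else 0) t) i q = C (Suc k) i q"
        by (simp add: C_def fraction_tuple_def sheaf_defs restrict_def)
    qed
    hence eq: "\<phi> W (C (Suc k)) = padd (tilde sc G) W (\<phi> W (C k)) (pscale (tilde sc G) W b (\<phi> W (unit_tuple W k)))"
      using add[OF W C bEm, of k] scale[OF W b E] by simp
    have "pres F U W (unit_tuple U k) = unit_tuple W k"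
      using W(2) by (intro ext) (auto simp: unit_tuple_def fraction_tuple_def sheaf_defs restrict_def)
    hence "\<phi> W (unit_tuple W k) = pres (tilde sc G) U W (\<phi> U (unit_tuple U k))"
      using res[OF U order_refl W unit_tuple_mem[OF U], of k] by simp
    hence u: "\<phi> W (unit_tuple W k) q = frac q (\<theta> k) s" if "q \<in> W" for q
      using unit[OF k that] that by (simp add: tilde_def)
    show ?case
    proof (rule sections_eqI[OF mem[OF W C]])
      fix q assume q: "q \<in> W"
      have th: "fraction q (\<theta> k) s" using qP[OF q] \<theta>[OF k] s(1) s(2)[OF q] by (rule fractionI)
      note sc = hscale_frac[OF Ofr[OF q f[OF k]] th]
      have "\<phi> W (C (Suc k)) q = hadd sc G q (frac q (\<Sum>i<k. sc (f i) (\<theta> i)) (t * s))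
          (frac q (sc (f k) (\<theta> k)) (t * s))"
        unfolding eq using q Suc u[OF q] sc by (simp add: tilde_def b_def)
      also have "\<dots> = frac q (\<Sum>i<Suc k. sc (f i) (\<theta> i)) (t * s)"
        using hadd_common[OF fr[OF q, of k] sc(1)] fr[OF q Suc.prems] k by simp
      finally show "\<phi> W (C (Suc k)) q = frac q (\<Sum>i<Suc k. sc (f i) (\<theta> i)) (t * s)" .
    qed
  qed
  from this[of r] have "\<phi> W (C r) = (\<lambda>q\<in>W. frac q (\<Sum>i<r. sc (f i) (\<theta> i)) (t * s))" by simp
  moreover have "C r = fraction_tuple r W f t"
    by (auto simp: C_def fraction_tuple_def fun_eq_iff restrict_def)
  ultimately show ?thesis by simp
qed

text \<open>The \<open>\<theta> i\<close> are the numerators of the images of the standard basis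
  sections, over a common denominator near \<open>p\<close>. Injectivity of the trivialization makes
  them independent, and surjectivity makes them generate after localization at
  \<open>p\<close>.\<close>

lemma local_frame:
  assumes p: "p \<in> U"
  shows "\<exists>d \<theta>. (\<forall>i<r. \<theta> i \<in> G d) \<and>
    (\<forall>c. (\<Sum>i<r. sc (c i) (\<theta> i)) = 0 \<longrightarrow> (\<forall>i<r. c i = 0)) \<and>
    (\<forall>e. \<forall>\<eta>\<in>G e. \<exists>u c. u \<notin> p \<and> sc u \<eta> = (\<Sum>i<r. sc (c i) (\<theta> i)))"
proof -
  have pP: "p \<in> Proj" using p open_subset_Proj[OF U] by auto
  obtain k where k: "var k \<notin> p" using Proj_var[OF pP] by blast
  have "\<forall>i<r. \<phi> U (unit_tuple U i) \<in> tilde_sections sc G U"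
    using mem[OF U order_refl unit_tuple_mem[OF U]] by simp
  from sections_common[OF U p this] obtain W d s \<theta>
    where W: "openin proj_topology W" "p \<in> W" "W \<subseteq> U" and s: "s \<in> homog d" "\<forall>q\<in>W. s \<notin> q"
      and \<theta>: "\<forall>i<r. \<theta> i \<in> G d" "\<forall>i<r. \<forall>q\<in>W. \<phi> U (unit_tuple U i) q = frac q (\<theta> i) s"
    by (elim exE conjE)
  have comb: "\<phi> V (fraction_tuple r V f t) = (\<lambda>q\<in>V. frac q (\<Sum>i<r. sc (f i) (\<theta> i)) (t * s))"
    if "openin proj_topology V" "V \<subseteq> W" "\<And>i. i < r \<Longrightarrow> f i \<in> homog e" "t \<in> homog e"
      "\<And>q. q \<in> V \<Longrightarrow> t \<notin> q" for V f t e
    using that W s \<theta> by (intro combination[of V \<theta> d s f e t]) auto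
  \<comment> \<open>Where a variable is invertible, every homogeneous element of degree
    \<open>e\<close> becomes a section after division by the \<open>e\<close>-th power of that
    variable.\<close>
  define V where "V = W \<inter> {q \<in> Proj. var k \<notin> q}"
  have V: "openin proj_topology V" "p \<in> V" "V \<subseteq> W" "V \<subseteq> U"
    using W pP k basic_open[OF var_homog[of k]] by (auto simp: V_def intro: openin_Int)
  have vk: "var k ^ e \<notin> q" if "q \<in> V" for e q
    using that Proj_power[of q "var k" e] by (auto simp: V_def)
  \<comment> \<open>By a homogeneous relation, the tuple of the fractions
    \<open>f i / var k ^ e\<close> and the zero tuple have the same image over
    \<open>V\<close>.\<close>
  have homog_indep: "f i = 0" if f: "\<And>i. i < r \<Longrightarrow> f i \<in> homog e" and 0: "(\<Sum>i<r. sc (f i) (\<theta> i)) = 0"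
    and i: "i < r" for f e i
  proof -
    have "\<phi> V (fraction_tuple r V f (var k ^ e)) = \<phi> V (fraction_tuple r V (\<lambda>_. 0) (var k ^ e))"
      using comb[OF V(1,3), of f e "var k ^ e"] comb[OF V(1,3), of "\<lambda>_. 0" e "var k ^ e"] f 0 vk
      by (simp add: homog_var_power)
    moreover have "fraction_tuple r V f (var k ^ e) \<in> psec F V" "fraction_tuple r V (\<lambda>_. 0) (var k ^ e) \<in> psec F V"
      using f vk by (auto intro!: fraction_tuple_mem[OF V(1)] homog_var_power)
    ultimately have "fraction_tuple r V f (var k ^ e) = fraction_tuple r V (\<lambda>_. 0) (var k ^ e)"
      using bij[OF V(1,4)] by (auto simp: bij_betw_def dest: inj_onD)
    hence "fraction_tuple r V f (var k ^ e) i p = fraction_tuple r V (\<lambda>_. 0) (var k ^ e) i p" by simp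
    hence "O.frac p (f i) (var k ^ e) = O.frac p 0 (var k ^ e)"
      using i V(2) by (simp add: fraction_tuple_def)
    moreover have fr: "O.fraction p g (var k ^ e)" if "g \<in> homog e" for g
      using O.fractionI[OF pP that homog_var_power vk[OF V(2)]] .
    ultimately have "var k ^ e * f i = 0"
      using O.frac_eq_iff[OF fr[OF f[OF i]] fr[of 0]] by simp
    moreover have "(var k ^ e :: ('k, 'n) sym) \<noteq> 0" using vk[OF V(2), of e] Proj_0[OF pP] by metis
    ultimately show "f i = 0" using sym_no_zero_divisors by blast
  qed
  have indep: "c i = 0" if 0: "(\<Sum>i<r. sc (c i) (\<theta> i)) = 0" and i: "i < r" for c i
  proof -
    define K where "K = (\<Union>i\<in>{..<r}. mon_degree ` Poly_Mapping.keys (c i))"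
    have K: "c i = (\<Sum>e\<in>K. hcomp e (c i))" if "i < r" for i
      using that by (intro hcomp_expansion) (auto simp: K_def)
    define x where "x e = (\<Sum>i<r. sc (hcomp e (c i)) (\<theta> i))" for e
    have "(\<Sum>i<r. sc (c i) (\<theta> i)) = (\<Sum>i<r. \<Sum>e\<in>K. sc (hcomp e (c i)) (\<theta> i))"
      using K by (intro sum.cong refl) (simp flip: scale_sum_left)
    also have "\<dots> = (\<Sum>e\<in>K. x e)" unfolding x_def by (rule sum.swap)
    finally have "(\<Sum>e\<in>K. x e) = 0" using 0 by simp
    moreover have x: "x e \<in> G (e + d)" for e
      unfolding x_def using \<theta> by (intro G_sum G_scale hcomp_homog) auto
    ultimately have x0: "x e = 0" if "e \<in> K" for e
    proof -
      have "finite K" by (simp add: K_def)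
      \<comment> \<open>The sum \<open>x e\<close> has degree \<open>e + d\<close>, so the family is
        reindexed by its true degree before \<open>G_direct\<close> separates its members.\<close>
      moreover have "x (n - d) \<in> G n" if "n \<in> (\<lambda>e. e + d) ` K" for n
        using that x by auto
      moreover have "(\<Sum>n\<in>(\<lambda>e. e + d) ` K. x (n - d)) = 0"
        using \<open>(\<Sum>e\<in>K. x e) = 0\<close> by (simp add: sum.reindex)
      ultimately show ?thesis
        using G_direct[of "(\<lambda>e. e + d) ` K" "\<lambda>n. x (n - d)" "e + d"] that by simp
    qed
    have "hcomp e (c i) = 0" if "e \<in> K" for e
      using x0[OF that] by (intro homog_indep[of "\<lambda>i. hcomp e (c i)" e i, OF hcomp_homog _ i]) (simp add: x_def)
    thus "c i = 0" by (subst K[OF i]) simp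
  qed
  have gen: "\<exists>u c. u \<notin> p \<and> sc u \<eta> = (\<Sum>i<r. sc (c i) (\<theta> i))" if \<eta>: "\<eta> \<in> G e" for \<eta> e
  proof -
    \<comment> \<open>The preimage of this section becomes a tuple of fractions with a common
      denominator on a smaller open set; equality of fractions at \<open>p\<close> is the desired
      relation.\<close>
    define \<tau> where "\<tau> = (\<lambda>q\<in>V. frac q \<eta> (var k ^ e))"
    have "\<tau> \<in> psec (tilde sc G) V"
      using frac_section[OF V(1) \<eta> homog_var_power vk] by (simp add: tilde_def \<tau>_def)
    hence "\<tau> \<in> \<phi> V ` psec F V"
      using bij[OF V(1,4)] by (simp add: bij_betw_def)
    then obtain c where c: "\<tau> = \<phi> V c" "c \<in> psec F V"
      by (rule imageE)
    have "\<forall>i<r. c i \<in> tilde_sections (*) homog V"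
      using c(2) by (auto simp: free_sections)
    from O.sections_common[OF V(1,2) this] obtain V' e' t f
      where V': "openin proj_topology V'" "p \<in> V'" "V' \<subseteq> V" and t: "t \<in> homog e'" "\<forall>q\<in>V'. t \<notin> q"
        and f: "\<forall>i<r. f i \<in> homog e'" "\<forall>i<r. \<forall>q\<in>V'. c i q = O.frac q (f i) t"
      by (elim exE conjE)
    have "pres F V V' c = fraction_tuple r V' f t"
      using f(2) by (intro ext) (auto simp: fraction_tuple_def sheaf_defs restrict_def)
    hence "\<phi> V' (fraction_tuple r V' f t) = pres (tilde sc G) V V' \<tau>"
      using res[OF V(1,4) V'(1,3) c(2)] c(1) by simp
    hence "frac p (\<Sum>i<r. sc (f i) (\<theta> i)) (t * s) = frac p \<eta> (var k ^ e)"
      using comb[of V' f e' t] V' V t f(1) by (auto simp: tilde_def \<tau>_def dest: fun_cong[of _ _ p])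
    moreover have "fraction p (\<Sum>i<r. sc (f i) (\<theta> i)) (t * s)"
      using \<theta> f(1) t s V' W(2) pP
      by (intro fractionI[of p _ "e' + d"] G_sum G_scale homog_mult) (auto simp: Proj_mult)
    moreover have "fraction p \<eta> (var k ^ e)"
      using pP \<eta> homog_var_power vk[OF V(2)] by (rule fractionI)
    ultimately have "sc (var k ^ e) (\<Sum>i<r. sc (f i) (\<theta> i)) = sc (t * s) \<eta>"
      using frac_eq_iff by blast
    hence "sc (t * s) \<eta> = (\<Sum>i<r. sc (var k ^ e * f i) (\<theta> i))"
      by (simp add: scale_sum_right)
    moreover have "t * s \<notin> p" using pP t s V' W(2) by (auto simp: Proj_mult)
    ultimately show ?thesis
      by (intro exI[of _ "t * s"] exI[of _ "\<lambda>i. var k ^ e * f i"] conjI)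
  qed
  show ?thesis
    using \<theta>(1) indep gen by (intro exI[of _ d] exI[of _ \<theta>] conjI allI ballI impI) simp_all
qed

end

lemma (in graded_module) locally_free_local_frame:
  assumes "locally_free_sheaf proj_topology structure_sheaf (tilde sc G)" "p \<in> Proj"
  shows "\<exists>r d \<theta>. (\<forall>i<r::nat. \<theta> i \<in> G d) \<and>
    (\<forall>c. (\<Sum>i<r. sc (c i) (\<theta> i)) = 0 \<longrightarrow> (\<forall>i<r. c i = 0)) \<and>
    (\<forall>e. \<forall>\<eta>\<in>G e. \<exists>u c. u \<notin> p \<and> sc u \<eta> = (\<Sum>i<r. sc (c i) (\<theta> i)))"
proof -
  obtain i :: 'n where i: "var i \<notin> p" using Proj_var[OF assms(2)] by blast
  have "p \<in> topspace proj_topology"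
    using openin_subset[OF basic_open[OF var_homog[of i]]] i assms(2) by blast
  then obtain U r where UU: "openin proj_topology U" "p \<in> U"
    "module_iso_on proj_topology structure_sheaf U (free_sheaf r) (tilde sc G)"
    using assms(1) unfolding locally_free_sheaf_def by blast
  from UU(3)[unfolded module_iso_on_def] obtain \<phi> where \<phi>: "\<forall>W. openin proj_topology W \<and> W \<subseteq> U \<longrightarrow>
       bij_betw (\<phi> W) (psec (free_sheaf r) W) (psec (tilde sc G) W) \<and>
       (\<forall>s\<in>psec (free_sheaf r) W. \<forall>t\<in>psec (free_sheaf r) W.
          \<phi> W (padd (free_sheaf r) W s t) = padd (tilde sc G) W (\<phi> W s) (\<phi> W t)) \<and>
       (\<forall>c\<in>psec structure_sheaf W. \<forall>s\<in>psec (free_sheaf r) W.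
          \<phi> W (pscale (free_sheaf r) W c s) = pscale (tilde sc G) W c (\<phi> W s)) \<and>
       (\<forall>W'. openin proj_topology W' \<and> W' \<subseteq> W \<longrightarrow>
          (\<forall>s\<in>psec (free_sheaf r) W.
             \<phi> W' (pres (free_sheaf r) W W' s) = pres (tilde sc G) W W' (\<phi> W s)))"
    by (elim exE)
  interpret local_trivialization sc G U r \<phi>
    by unfold_locales (use UU(1) \<phi> in simp_all)
  show ?thesis using local_frame[OF UU(2)] by (rule exI)
qed

lemma (in graded_module) locally_freeI:
  assumes "\<And>p. p \<in> Proj \<Longrightarrow> \<exists>r d \<theta> s u a. frame sc G r d \<theta> s u a \<and> u \<notin> p \<and> s \<notin> p"
  shows "locally_free_sheaf proj_topology structure_sheaf (tilde sc G)"
  unfolding locally_free_sheaf_def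
proof
  fix p :: "('k, 'n) sym set" assume "p \<in> topspace proj_topology"
  hence p: "p \<in> Proj" unfolding topspace_def using open_subset_Proj by blast
  from assms[OF this] obtain r d \<theta> s u a where fr: "frame sc G r d \<theta> s u a" "u \<notin> p" "s \<notin> p"
    by (elim exE conjE)
  interpret frame sc G r d \<theta> s u a by (rule fr(1))
  have "p \<in> dom" using p fr by (simp add: dom_def Proj_mult)
  moreover have "openin proj_topology dom"
    unfolding dom_def by (rule basic_open[OF homog_mult[OF u s]])
  ultimately show "\<exists>U r. openin proj_topology U \<and> p \<in> U \<and>
      module_iso_on proj_topology structure_sheaf U (free_sheaf r) (tilde sc G)"
    using frame_iso by blast
qed

section \<open>Logarithmic derivations of an arrangement\<close>

text \<open>A basis of \<open>W\<close> gives fewer equations than unknowns. Over an arbitrary field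
  \<open>c\<close> may itself lie in \<open>W\<close>, so this is not a decomposition into
  orthogonal summands.\<close>

lemma orthogonal_vector:
  fixes W :: "('k::field ^ 'n::finite) set"
  assumes W: "vec.subspace W" "W \<noteq> UNIV"
  shows "\<exists>c. c \<noteq> 0 \<and> (\<forall>a\<in>W. (\<Sum>i\<in>UNIV. a $ i * c $ i) = 0)"
proof -
  obtain B where B: "B \<subseteq> W" "vec.independent B" "W \<subseteq> vec.span B" "card B = vec.dim W"
    using vec.basis_exists by blast
  have "vec.dim W \<noteq> CARD('n)"
    using vec.subspace_dim_equal[OF W(1) vec.subspace_UNIV] W(2) by (auto simp: card_cart_basis)
  moreover have "vec.dim W \<le> CARD('n)" using vec.dim_subset[of W UNIV] by (simp add: card_cart_basis)
  ultimately have "card B < card (UNIV :: 'n set)" using B(4) by simp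
  moreover have "finite B" using B(2) by (rule vec.finiteI_independent)
  ultimately obtain c where c: "\<exists>i. c i \<noteq> 0" "\<And>b. b \<in> B \<Longrightarrow> (\<Sum>i\<in>UNIV. b $ i * c i) = 0"
    using homogeneous_system[of B "UNIV :: 'n set" "\<lambda>b i. b $ i"] by auto
  have "vec.subspace {a. (\<Sum>i\<in>UNIV. a $ i * c i) = 0}"
    by (auto simp: vec.subspace_def distrib_right sum.distrib mult.assoc simp flip: sum_distrib_left)
  hence "vec.span B \<subseteq> {a. (\<Sum>i\<in>UNIV. a $ i * c i) = 0}"
    using c(2) by (intro vec.span_minimal) auto
  thus ?thesis using B(3) c(1) by (intro exI[of _ "\<chi> i. c i"]) (auto simp: vec_eq_iff)
qed

definition normal :: "('k::field ^ 'n::finite) set \<Rightarrow> 'k ^ 'n" where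
  "normal H = (SOME a. H = {v. (\<Sum>i\<in>UNIV. a $ i * v $ i) = 0})"

lemma hyperplane_form_normal: "hyperplane_form H = linear_form (normal H)"
  by (simp add: hyperplane_form_def normal_def)

lemma kernel_subspace: "vec.subspace {v. (\<Sum>i\<in>UNIV. a $ i * v $ i) = 0}"
  by (auto simp: vec.subspace_def distrib_left sum.distrib mult.left_commute simp flip: sum_distrib_left)

text \<open>The choice in \<open>normal\<close> succeeds: the kernel of a nonzero functional
  vanishing on \<open>H\<close> contains \<open>H\<close> and is proper, so it has the same
  dimension as \<open>H\<close>.\<close>

lemma normal:
  fixes H :: "('k::field ^ 'n::finite) set"
  assumes "arrangement A" "H \<in> A"
  shows "H = {v. (\<Sum>i\<in>UNIV. normal H $ i * v $ i) = 0}" and "normal H \<noteq> 0"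
proof -
  have H: "vec.subspace H" "vec.dim H + 1 = CARD('n)"
    using assms by (auto simp: arrangement_def)
  hence ne: "H \<noteq> UNIV" by (auto simp: card_cart_basis)
  obtain c where c: "c \<noteq> 0" "\<forall>v\<in>H. (\<Sum>i\<in>UNIV. v $ i * c $ i) = 0"
    using orthogonal_vector[OF H(1) ne] by blast
  let ?K = "{v. (\<Sum>i\<in>UNIV. c $ i * v $ i) = 0}"
  obtain j where j: "c $ j \<noteq> 0" using c(1) by (auto simp: vec_eq_iff)
  have "axis j 1 \<notin> ?K"
    using j by (simp add: axis_def if_distrib[of "\<lambda>x. _ * x"] cong: if_cong)
  hence "?K \<noteq> UNIV" by blast
  hence "vec.dim ?K \<noteq> CARD('n)"
    using vec.subspace_dim_equal[OF kernel_subspace vec.subspace_UNIV, of c] by (auto simp: card_cart_basis)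
  moreover have "vec.dim ?K \<le> CARD('n)"
    using vec.dim_subset[of ?K UNIV] by (simp add: card_cart_basis)
  ultimately have "vec.dim ?K \<le> vec.dim H" using H(2) by simp
  moreover have "H \<subseteq> ?K" using c(2) by (auto simp: mult.commute)
  ultimately have "H = ?K" using vec.subspace_dim_equal[OF H(1) kernel_subspace] by blast
  hence "\<exists>a. H = {v. (\<Sum>i\<in>UNIV. a $ i * v $ i) = 0}" by blast
  from someI_ex[OF this] show eq: "H = {v. (\<Sum>i\<in>UNIV. normal H $ i * v $ i) = 0}"
    unfolding normal_def .
  show "normal H \<noteq> 0"
  proof
    assume "normal H = 0"
    hence "H = UNIV" using eq by simp
    thus False using ne by simp
  qed
qed

lemma hyperplane_form_nonzero: "arrangement A \<Longrightarrow> H \<in> A \<Longrightarrow> hyperplane_form H \<noteq> 0"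
  using normal(2) by (simp add: hyperplane_form_normal linear_form_0_iff)

lemma hyperplane_form_homog: "hyperplane_form H \<in> homog 1"
  unfolding hyperplane_form_normal by (rule linear_form_homog)

lemma hyperplane_form_prime:
  "arrangement A \<Longrightarrow> H \<in> A \<Longrightarrow> hyperplane_form H dvd f * g \<Longrightarrow>
    hyperplane_form H dvd f \<or> hyperplane_form H dvd g"
  unfolding hyperplane_form_normal by (rule linear_form_prime[OF normal(2)])

lemma hyperplane_form_dvd:
  assumes "arrangement A" "H \<in> A" "H' \<in> A" "hyperplane_form H dvd hyperplane_form H'"
  shows "H = H'"
proof -
  obtain c where c: "normal H' = c *s normal H"
    using linear_form_dvd_linear_form assms(4) unfolding hyperplane_form_normal by blast
  have "c \<noteq> 0" using normal(2)[OF assms(1,3)] c by auto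
  have "(\<Sum>i\<in>UNIV. normal H' $ i * v $ i) = c * (\<Sum>i\<in>UNIV. normal H $ i * v $ i)" for v
    by (simp add: c sum_distrib_left mult.assoc)
  hence "{v. (\<Sum>i\<in>UNIV. normal H' $ i * v $ i) = 0} = {v. (\<Sum>i\<in>UNIV. normal H $ i * v $ i) = 0}"
    using \<open>c \<noteq> 0\<close> by simp
  thus ?thesis using normal(1)[OF assms(1,2)] normal(1)[OF assms(1,3)] by simp
qed

lemma prod_nonzero:
  fixes h :: "'a \<Rightarrow> ('k::field, 'n::finite) sym"
  assumes "finite K" "\<And>x. x \<in> K \<Longrightarrow> h x \<noteq> 0"
  shows "prod h K \<noteq> 0"
  using assms
proof (induction K rule: finite_induct)
  case (insert x K)
  have "prod h (insert x K) = h x * prod h K" using insert by simp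
  moreover have "h x \<noteq> 0" "prod h K \<noteq> 0" using insert by simp_all
  ultimately show ?case using sym_no_zero_divisors by metis
qed simp

text \<open>Write the defining polynomial as \<open>l * R\<close> with \<open>l\<close> the form of
  \<open>H\<close>. By Leibniz, \<open>l\<close> divides \<open>\<theta> l * R\<close> as soon as it
  divides the value of \<open>\<theta>\<close> on the product, and \<open>l\<close> is prime and
  does not divide \<open>R\<close>. The converse is Leibniz again, one factor at a time.\<close>

lemma D1_iff:
  fixes A :: "('k::field ^ 'n::finite) set set"
  assumes A: "arrangement A"
  shows "\<theta> \<in> D1 A \<longleftrightarrow> \<theta> \<in> Der \<and> (\<forall>H\<in>A. hyperplane_form H dvd \<theta> (hyperplane_form H))"
proof -
  let ?l = "hyperplane_form :: _ \<Rightarrow> ('k, 'n) sym"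
  have fin: "finite A" using A by (simp add: arrangement_def)
  have span: "f \<in> ideal.span {g} \<longleftrightarrow> g dvd f" for f g :: "('k, 'n) sym"
    by (auto simp: ideal.span_singleton dvd_def mult.commute)
  have 1: "prod ?l K dvd \<theta> (prod ?l K)"
    if "\<theta> \<in> Der" "\<And>H. H \<in> K \<Longrightarrow> ?l H dvd \<theta> (?l H)" "finite K" for K
    using that(3,2)
  proof (induction K rule: finite_induct)
    case empty
    show ?case by simp
  next
    case (insert H K)
    have "\<theta> (prod ?l (insert H K)) = ?l H * \<theta> (prod ?l K) + \<theta> (?l H) * prod ?l K"
      using insert that(1) by (simp add: Der_mult)
    moreover have "?l H * prod ?l K dvd ?l H * \<theta> (prod ?l K)" "?l H * prod ?l K dvd \<theta> (?l H) * prod ?l K"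
      using mult_dvd_mono[OF dvd_refl insert.IH] mult_dvd_mono[OF insert.prems[of H] dvd_refl] insert.prems
      by simp_all
    ultimately show ?case using insert.hyps by simp
  qed
  have 2: "?l H dvd \<theta> (?l H)" if "\<theta> \<in> Der" "prod ?l A dvd \<theta> (prod ?l A)" "H \<in> A" for H
  proof -
    let ?R = "prod ?l (A - {H})"
    have Q: "prod ?l A = ?l H * ?R" using fin that(3) by (rule prod.remove)
    have "?l H dvd \<theta> (prod ?l A)" using that(2) Q by (metis dvd_mult_left)
    hence "?l H dvd \<theta> (?l H) * ?R"
      unfolding Q Der_mult[OF that(1)] by (simp add: dvd_add_right_iff)
    \<comment> \<open>Distinct hyperplanes have forms that do not divide each other; primality
      extends this to products, and degrees exclude that \<open>?l H\<close> divides 1.\<close>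
    moreover have "\<not> ?l H dvd prod ?l K" if "finite K" "K \<subseteq> A - {H}" for K
      using that
    proof (induction K rule: finite_induct)
      case empty
      have "\<not> ?l H dvd 1"
      proof
        assume "?l H dvd 1"
        then obtain w where "1 = ?l H * w" by (auto simp: dvd_def)
        moreover have "hcomp 0 (?l H * w) = 0"
          using slice_mult[of "?l H" UNIV 1 0 0 w] hyperplane_form_homog[of H] by (simp add: homog_forms)
        moreover have "hcomp 0 (1 :: ('k, 'n) sym) = 1"
          using slice_of_form[OF forms_one, of UNIV 0] by simp
        ultimately show False by (metis zero_neq_one)
      qed
      thus ?case by simp
    next
      case (insert H' K)
      have "\<not> ?l H dvd ?l H'" using hyperplane_form_dvd[OF A \<open>H \<in> A\<close>, of H'] insert.prems by auto
      moreover have "\<not> ?l H dvd prod ?l K" using insert by simp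
      ultimately have "\<not> ?l H dvd ?l H' * prod ?l K"
        using hyperplane_form_prime[OF A \<open>H \<in> A\<close>] by blast
      thus ?case using insert by simp
    qed
    from this[of "A - {H}"] have "\<not> ?l H dvd ?R" using fin by simp
    ultimately show ?thesis using hyperplane_form_prime[OF A that(3)] by blast
  qed
  show ?thesis
    unfolding D1_def defining_poly_def using 1[of A] 2 fin span by auto
qed

lemma subspace_D1: "der.subspace (D1 A :: (('k::field, 'n::finite) sym \<Rightarrow> ('k, 'n) sym) set)"
proof (rule der.subspaceI)
  show "0 \<in> D1 A"
    using der.subspace_0[OF subspace_Der] by (auto simp: D1_def intro: ideal.span_zero)
  show "\<theta> + \<theta>' \<in> D1 A" if "\<theta> \<in> D1 A" "\<theta>' \<in> D1 A" for \<theta> \<theta>' :: "('k, 'n) sym \<Rightarrow> ('k, 'n) sym"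
  proof -
    have "\<theta> + \<theta>' \<in> Der" using that by (intro der.subspace_add[OF subspace_Der]) (auto simp: D1_def)
    thus ?thesis using that by (auto simp: D1_def intro: ideal.span_add)
  qed
  show "der_scale c \<theta> \<in> D1 A" if "\<theta> \<in> D1 A" for c and \<theta> :: "('k, 'n) sym \<Rightarrow> ('k, 'n) sym"
  proof -
    have "der_scale c \<theta> \<in> Der" using that by (intro der.subspace_scale[OF subspace_Der]) (auto simp: D1_def)
    moreover have "der_scale c \<theta> (defining_poly A) \<in> ideal.span {defining_poly A}"
      unfolding der_scale_def using that by (intro ideal.span_scale) (auto simp: D1_def)
    ultimately show ?thesis by (simp add: D1_def)
  qed
qed

lemma D1_Der: "D1 A \<subseteq> Der"
  by (auto simp: D1_def)

lemma D1_componentD: "\<theta> \<in> D1_component A d \<Longrightarrow> \<theta> \<in> D1 A \<and> \<theta> \<in> Der"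
  by (simp add: D1_component_def D1_def)

lemma D1_component_scale:
  assumes "f \<in> homog a" "\<theta> \<in> D1_component A d"
  shows "der_scale f \<theta> \<in> D1_component A (a + d)"
  using assms homog_mult[OF assms(1)] der.subspace_scale[OF subspace_D1, of \<theta> A f]
  by (auto simp: D1_component_def) (auto simp: der_scale_def)

lemma graded_module_D1: "graded_module der_scale (D1_component (A :: ('k::field ^ 'n::finite) set set))"
proof (intro graded_module.intro graded_module_axioms.intro)
  show "module (der_scale :: ('k, 'n) sym \<Rightarrow> (('k, 'n) sym \<Rightarrow> ('k, 'n) sym) \<Rightarrow> _)"
    by (rule der.module_axioms)
next
  fix f :: "('k, 'n) sym" and m :: "('k, 'n) sym \<Rightarrow> ('k, 'n) sym"
  assume 0: "der_scale f m = 0"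
  have "f * m g = 0" for g using fun_cong[OF 0, of g] by (simp add: der_scale_def)
  hence "f = 0 \<or> m g = 0" for g by (rule sym_no_zero_divisors)
  thus "f = 0 \<or> m = 0" by auto
next
  show "0 \<in> D1_component A d" for d
    using der.subspace_0[OF subspace_D1, of A] by (simp add: D1_component_def)
  show "m + m' \<in> D1_component A d" if "m \<in> D1_component A d" "m' \<in> D1_component A d" for m m' d
    using that der.subspace_add[OF subspace_D1, of m A m'] by (simp add: D1_component_def homog_add)
  show "der_scale f m \<in> D1_component A (a + d)" if "f \<in> homog a" "m \<in> D1_component A d" for f m a d
    using that by (rule D1_component_scale)
next
  fix K and x :: "nat \<Rightarrow> ('k, 'n) sym \<Rightarrow> ('k, 'n) sym" and e
  assume K: "finite K" "\<And>d. d \<in> K \<Longrightarrow> x d \<in> D1_component A d" "sum x K = 0" "e \<in> K"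
  show "x e = 0"
  proof (rule Der_eqI)
    show "x e \<in> Der" using K by (auto dest: D1_componentD)
    show "0 \<in> Der" by (rule der.subspace_0[OF subspace_Der])
    show "x e (var i) = 0 (var i)" for i
    proof -
      have "(\<Sum>d\<in>K. x d (var i)) = 0" using fun_cong[OF K(3), of "var i"] by (simp add: sum_fun_apply)
      moreover have "x d (var i) \<in> homog d" if "d \<in> K" for d
        using K(2)[OF that] by (simp add: D1_component_def)
      ultimately show ?thesis using homog_sum_zero[OF K(1) _ _ K(4), of "\<lambda>d. x d (var i)"] by simp
    qed
  qed
qed

text \<open>The values \<open>\<eta> (var i)\<close> are sliced simultaneously in the coordinates
  given by \<open>\<beta>\<close>. A derivation takes on a linear form a scalar combination of these
  values, so slicing commutes with evaluation on hyperplane forms and preserves divisibility by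
  them. The monomials in \<open>z\<close> that slicing removes become coefficients in the
  span.\<close>

lemma D1_span_slices:
  fixes A :: "('k::field ^ 'n::finite) set set" and \<alpha> \<beta> :: "'n \<Rightarrow> ('k, 'n) sym"
  assumes A: "arrangement A"
    and \<alpha>\<beta>: "\<And>f. eval_hom scalar \<alpha> (eval_hom scalar \<beta> f) = f"
    and \<beta>\<alpha>: "\<And>f. eval_hom scalar \<beta> (eval_hom scalar \<alpha> f) = f"
    and l: "\<And>H. H \<in> A \<Longrightarrow> eval_hom scalar \<beta> (hyperplane_form H) \<in> forms I 1"
  shows "D1 A \<subseteq> der.span {\<theta> \<in> D1 A. \<exists>e. \<forall>i. eval_hom scalar \<beta> (\<theta> (var i)) \<in> forms I e}"
    (is "_ \<subseteq> der.span ?T")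
proof
  let ?a = "eval_hom scalar \<alpha>" and ?b = "eval_hom scalar \<beta>"
  note hom = eval_hom_add[OF coeff_hom_scalar] eval_hom_mult[OF coeff_hom_scalar]
      eval_hom_scalar[OF coeff_hom_scalar] eval_hom_sum[OF coeff_hom_scalar]
  fix \<eta> assume \<eta>: "\<eta> \<in> D1 A"
  hence \<eta>D: "\<eta> \<in> Der" using D1_Der by auto
  define part where "part x = der_of (\<lambda>i. ?a (slice I x (?b (\<eta> (var i)))))" for x
  have T: "part x \<in> ?T" for x
  proof -
    have "hyperplane_form H dvd part x (hyperplane_form H)" if H: "H \<in> A" for H
    proof -
      have "part x (hyperplane_form H) = ?a (slice I x (?b (\<eta> (hyperplane_form H))))"
        by (simp add: part_def hyperplane_form_normal Der_linear_form[OF der_of_Der]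
            Der_linear_form[OF \<eta>D] hom slice_sum slice_scale)
      moreover have "hyperplane_form H dvd \<eta> (hyperplane_form H)"
        using \<eta> H D1_iff[OF A] by blast
      hence "?b (hyperplane_form H) dvd ?b (\<eta> (hyperplane_form H))"
        by (auto simp: dvd_def hom)
      from dvd_slice[OF l[OF H] this, of x]
      have "?a (?b (hyperplane_form H)) dvd ?a (slice I x (?b (\<eta> (hyperplane_form H))))"
        by (auto simp: dvd_def hom)
      ultimately show ?thesis by (simp add: \<alpha>\<beta>)
    qed
    hence "part x \<in> D1 A" unfolding D1_iff[OF A] by (simp add: part_def)
    moreover have "?b (part x (var i)) \<in> forms I (snd x)" for i
      by (simp add: part_def \<beta>\<alpha> slice_forms)
    ultimately show ?thesis by blast
  qed
  define K where "K = (\<Union>i\<in>UNIV. Poly_Mapping.keys (?b (\<eta> (var i))))"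
  have K: "finite K" by (simp add: K_def)
  have "\<eta> = (\<Sum>x\<in>bidegree I ` K. der_scale (?a (Poly_Mapping.single (fst x) 1)) (part x))"
  proof (rule Der_eqI[OF \<eta>D])
    show "(\<Sum>x\<in>bidegree I ` K. der_scale (?a (Poly_Mapping.single (fst x) 1)) (part x)) \<in> Der"
      by (intro der.subspace_sum[OF subspace_Der] der.subspace_scale[OF subspace_Der]) (simp add: part_def)
    show "\<eta> (var i) = (\<Sum>x\<in>bidegree I ` K. der_scale (?a (Poly_Mapping.single (fst x) 1)) (part x)) (var i)" for i
    proof -
      have "?b (\<eta> (var i)) = (\<Sum>x\<in>bidegree I ` K. Poly_Mapping.single (fst x) 1 * slice I x (?b (\<eta> (var i))))"
        by (rule slice_expansion[OF K]) (auto simp: K_def)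
      hence "?a (?b (\<eta> (var i))) =
          ?a (\<Sum>x\<in>bidegree I ` K. Poly_Mapping.single (fst x) 1 * slice I x (?b (\<eta> (var i))))"
        by (rule arg_cong)
      thus ?thesis by (simp add: \<alpha>\<beta> hom sum_fun_apply der_scale_def part_def)
    qed
  qed
  also have "\<dots> \<in> der.span ?T"
    using T by (intro der.span_sum der.span_scale der.span_base)
  finally show "\<eta> \<in> der.span ?T" .
qed

text \<open>The special case in which every variable belongs to \<open>I\<close> and the coordinates
  are unchanged.\<close>

lemma D1_span_homog:
  assumes "arrangement A"
  shows "D1 A \<subseteq> der.span (\<Union>d. D1_component A d)"
proof -
  have "D1 A \<subseteq> der.span {\<theta> \<in> D1 A. \<exists>e. \<forall>i. eval_hom scalar var (\<theta> (var i)) \<in> forms UNIV e}"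
    using hyperplane_form_homog
    by (intro D1_span_slices[OF assms, of var var]) (simp_all add: eval_hom_id homog_forms)
  also have "{\<theta> \<in> D1 A. \<exists>e. \<forall>i. eval_hom scalar var (\<theta> (var i)) \<in> forms UNIV e} = (\<Union>d. D1_component A d)"
    by (auto simp: eval_hom_id D1_component_def homog_forms)
  finally show ?thesis .
qed

lemma arrangement_sub: "arrangement A \<Longrightarrow> arrangement (subarrangement A X)"
  by (auto simp: arrangement_def subarrangement_def)

text \<open>The factor that carries logarithmic derivations of the subarrangement to those of
  \<open>A\<close>. At a prime that contains none of its factors it is a unit, and there the two
  modules agree.\<close>

definition complement_poly :: "('k::field ^ 'n::finite) set set \<Rightarrow> ('k ^ 'n) set \<Rightarrow> ('k, 'n) sym" where
  "complement_poly A X = (\<Prod>H\<in>A - subarrangement A X. hyperplane_form H)"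

lemma prod_forms_homog: "finite K \<Longrightarrow> (\<Prod>H\<in>K. hyperplane_form H) \<in> homog (card K)"
  using forms_prod[of K hyperplane_form UNIV "\<lambda>_. 1", OF _ hyperplane_form_homog[unfolded homog_forms]]
  by (simp add: homog_forms)

lemma D1_component_subarrangement:
  assumes "arrangement A" "\<theta> \<in> D1_component A d"
  shows "\<theta> \<in> D1_component (subarrangement A X) d"
  using assms D1_iff[OF assms(1), of \<theta>] D1_iff[OF arrangement_sub[OF assms(1)], of \<theta> X]
  by (auto simp: D1_component_def subarrangement_def)

lemma complement_poly_scale:
  assumes A: "arrangement A" and \<theta>: "\<theta> \<in> D1_component (subarrangement A X) d"
  shows "der_scale (complement_poly A X) \<theta> \<in> D1_component A (card (A - subarrangement A X) + d)"
proof -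
  have fin: "finite (A - subarrangement A X)" using A by (simp add: arrangement_def)
  have D: "\<theta> \<in> Der" using \<theta> D1_componentD by blast
  have "hyperplane_form H dvd complement_poly A X * \<theta> (hyperplane_form H)" if "H \<in> A" for H
  proof (cases "H \<in> subarrangement A X")
    case True
    thus ?thesis using \<theta> D1_iff[OF arrangement_sub[OF A], of \<theta> X] by (simp add: D1_component_def)
  next
    case False
    hence "hyperplane_form H dvd complement_poly A X"
      unfolding complement_poly_def using that fin by (intro dvd_prodI) auto
    thus ?thesis by simp
  qed
  hence "der_scale (complement_poly A X) \<theta> \<in> D1 A"
    unfolding D1_iff[OF A] using der.subspace_scale[OF subspace_Der D] by (simp add: der_scale_def)
  moreover have "der_scale (complement_poly A X) \<theta> (var i) \<in> homog (card (A - subarrangement A X) + d)" for i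
    using \<theta> homog_mult[OF prod_forms_homog[OF fin], of "\<theta> (var i)" d]
    by (simp add: D1_component_def der_scale_def complement_poly_def)
  ultimately show ?thesis by (simp add: D1_component_def)
qed

text \<open>These elements give the module full rank: they are the input for the lower bounds
  \<open>basis_indexed\<close>, \<open>rank_ge\<close> and \<open>jac_nonzero\<close>.\<close>

lemma defining_poly_scale:
  fixes A :: "('k::field ^ 'n::finite) set set"
  assumes A: "arrangement A"
  shows "der_scale (defining_poly A) (der_of (\<lambda>j. if j = i then 1 else 0)) \<in> D1_component A (card A)"
proof -
  have fin: "finite A" using A by (simp add: arrangement_def)
  have "der_scale (defining_poly A) (der_of (\<lambda>j. if j = i then 1 else 0)) \<in> D1 A"
  proof -
    let ?\<delta> = "der_of (\<lambda>j. if j = i then 1 else 0) :: ('k, 'n) sym \<Rightarrow> ('k, 'n) sym"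
    have "der_scale (defining_poly A) ?\<delta> (defining_poly A) = ?\<delta> (defining_poly A) * defining_poly A"
      by (simp add: der_scale_def mult.commute)
    also have "\<dots> \<in> ideal.span {defining_poly A}"
      by (intro ideal.span_scale ideal.span_base) simp
    finally show ?thesis
      using der.subspace_scale[OF subspace_Der der_of_Der] by (simp add: D1_def)
  qed
  thus ?thesis
    using prod_forms_homog[OF fin] by (auto simp: D1_component_def der_scale_def defining_poly_def)
qed

lemma defining_poly_nonzero: "arrangement A \<Longrightarrow> defining_poly A \<noteq> 0"
  unfolding defining_poly_def
  by (rule prod_nonzero) (auto simp: arrangement_def hyperplane_form_nonzero)

section \<open>From free localizations to local frames\<close>

text \<open>For \<open>g\<close> nonzero these are the \<open>f\<close> whose quotient by
  \<open>g\<close> lies in the extension of \<open>c\<close> to the local ring at \<open>p\<close>,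
  expressed without forming that ring. For \<open>c = p\<close> that extension is the maximal
  ideal.\<close>

lemma subspace_local_multiples:
  assumes p: "p \<in> Proj" and c: "ideal.subspace c"
  shows "ideal.subspace {f. \<exists>w v. w \<notin> p \<and> v \<in> c \<and> w * f = v * g}"
proof (rule ideal.subspaceI)
  show "0 \<in> {f. \<exists>w v. w \<notin> p \<and> v \<in> c \<and> w * f = v * g}"
    by (rule CollectI, rule exI[of _ 1], rule exI[of _ 0]) (use Proj_1[OF p] ideal.subspace_0[OF c] in simp)
next
  fix f f' assume "f \<in> {f. \<exists>w v. w \<notin> p \<and> v \<in> c \<and> w * f = v * g}"
    "f' \<in> {f. \<exists>w v. w \<notin> p \<and> v \<in> c \<and> w * f = v * g}"
  then obtain w v w' v' where *: "w \<notin> p" "v \<in> c" "w * f = v * g" "w' \<notin> p" "v' \<in> c" "w' * f' = v' * g"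
    by blast
  have "w * w' * (f + f') = w' * (w * f) + w * (w' * f')" by (simp add: algebra_simps)
  also have "\<dots> = (w' * v + w * v') * g" unfolding * by (simp add: algebra_simps)
  finally have "w * w' * (f + f') = (w' * v + w * v') * g" .
  moreover have "w * w' \<notin> p" using * p by (simp add: Proj_mult)
  moreover have "w' * v + w * v' \<in> c"
    using * by (intro ideal.subspace_add[OF c] ideal.subspace_scale[OF c])
  ultimately show "f + f' \<in> {f. \<exists>w v. w \<notin> p \<and> v \<in> c \<and> w * f = v * g}" by blast
next
  fix a f assume "f \<in> {f. \<exists>w v. w \<notin> p \<and> v \<in> c \<and> w * f = v * g}"
  then obtain w v where *: "w \<notin> p" "v \<in> c" "w * f = v * g" by blast
  have "w * (a * f) = a * (w * f)" by (simp add: algebra_simps)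
  also have "\<dots> = (a * v) * g" unfolding * by (simp add: algebra_simps)
  finally show "a * f \<in> {f. \<exists>w v. w \<notin> p \<and> v \<in> c \<and> w * f = v * g}"
    using * ideal.subspace_scale[OF c *(2), of a] by blast
qed

lemma jac_scale_all: "jac (\<lambda>i. der_scale (u i) (\<eta> i)) = (\<Prod>i\<in>UNIV. u i) * jac \<eta>"
proof -
  have "(\<chi> i j. der_scale (u i) (\<eta> i) (var j)) = (\<chi> i. u i *s (\<chi> j. \<eta> i (var j)))"
    by (simp add: vec_eq_iff der_scale_def)
  thus ?thesis by (simp add: jac_def det_rows_mul)
qed

lemma subspace_linear_forms_in:
  fixes p :: "('k::field, 'n::finite) sym set"
  assumes "ideal.subspace p"
  shows "vec.subspace {a. linear_form a \<in> p}"
proof (rule vec.subspaceI)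
  show "0 \<in> {a. linear_form a \<in> p}"
    using ideal.subspace_0[OF assms] linear_form_0_iff[of "0 :: 'k ^ 'n"] by simp
  show "a + b \<in> {a. linear_form a \<in> p}" if "a \<in> {a. linear_form a \<in> p}" "b \<in> {a. linear_form a \<in> p}" for a b
    using that ideal.subspace_add[OF assms] by (simp add: linear_form_add)
  show "c *s a \<in> {a. linear_form a \<in> p}" if "a \<in> {a. linear_form a \<in> p}" for c a
    using that ideal.subspace_scale[OF assms] by (simp add: linear_form_scale)
qed

text \<open>Some variable lies outside \<open>p\<close>, so the linear forms in \<open>p\<close>
  make up a proper subspace and have a common zero other than the origin. It lies in
  \<open>X\<close>, which bounds the codimension.\<close>

lemma flat_of_prime:
  fixes A :: "('k::field ^ 'n::finite) set set"
  assumes A: "arrangement A" and p: "p \<in> Proj"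
  defines "X \<equiv> \<Inter>{H \<in> A. hyperplane_form H \<in> p}"
  shows "X \<in> intersection_lattice A" "codim X < CARD('n)"
    and "\<And>H. H \<in> A \<Longrightarrow> hyperplane_form H \<in> p \<Longrightarrow> H \<in> subarrangement A X"
proof -
  show "X \<in> intersection_lattice A" unfolding X_def intersection_lattice_def by blast
  show "H \<in> subarrangement A X" if "H \<in> A" "hyperplane_form H \<in> p" for H
    using that by (auto simp: subarrangement_def X_def)
  let ?W = "{a. linear_form a \<in> p}"
  obtain k where k: "var k \<notin> p" using Proj_var[OF p] by blast
  hence "axis k 1 \<notin> ?W" by (simp flip: var_eq_linear_form)
  hence "?W \<noteq> UNIV" by blast
  then obtain c where c: "c \<noteq> 0" "\<forall>a\<in>?W. (\<Sum>i\<in>UNIV. a $ i * c $ i) = 0"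
    using orthogonal_vector[OF subspace_linear_forms_in[OF Proj_subspace[OF p]]] by blast
  have "c \<in> H" if "H \<in> A" "hyperplane_form H \<in> p" for H
    using c(2) that(2) normal(1)[OF A that(1)] by (auto simp: hyperplane_form_normal)
  hence "c \<in> X" by (auto simp: X_def)
  hence "vec.dim X \<noteq> 0" using c(1) by auto
  thus "codim X < CARD('n)" unfolding codim_def by (intro diff_less zero_less_card_finite neq0_conv[THEN iffD1])
qed

lemma frame_of_free:
  fixes A :: "('k::field ^ 'n::finite) set set"
  assumes A: "arrangement A" and lf: "locally_free_arrangement A" and p: "p \<in> Proj"
  shows "\<exists>r d \<theta> s u a. frame der_scale (D1_component A) r d \<theta> s u a \<and> u \<notin> p \<and> s \<notin> p"
proof -
  define X where "X = \<Inter>{H \<in> A. hyperplane_form H \<in> p}"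
  note X = flat_of_prime[OF A p, folded X_def]
  let ?A = "subarrangement A X"
  have A': "arrangement ?A" using A by (rule arrangement_sub)
  obtain B where B: "\<not> der.dependent B" "der.span B = D1 ?A"
    using lf X(1,2) unfolding locally_free_arrangement_def free_arrangement_def by blast
  have "\<exists>b :: 'n \<Rightarrow> _. bij_betw b UNIV B \<and> jac b \<noteq> 0"
  proof (rule basis_indexed[OF B(1)])
    show "der.span B \<subseteq> Der" using B(2) D1_Der by simp
    show "defining_poly ?A \<noteq> 0" by (rule defining_poly_nonzero[OF A'])
    show "der_scale (defining_poly ?A) (der_of (\<lambda>j. if j = i then 1 else 0)) \<in> der.span B" for i
      using D1_componentD[OF defining_poly_scale[OF A', of i]] unfolding B(2) ..
  qed
  then obtain b :: "'n \<Rightarrow> _" where b: "bij_betw b UNIV B" "jac b \<noteq> 0" by (elim exE conjE)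
  have b_in: "b i \<in> D1 ?A" for i
    using b(1) B(2) der.span_superset[of B] by (auto simp: bij_betw_def)
  \<comment> \<open>Every tuple in the module is a matrix times the basis, and determinants
    multiply.\<close>
  have dvd_b: "\<exists>w. jac \<eta> = w * jac b" if "range \<eta> \<subseteq> D1 ?A" for \<eta> :: "'n \<Rightarrow> _"
  proof -
    have "finite B" using bij_betw_finite[OF b(1)] by simp
    have "\<exists>c. \<eta> i = (\<Sum>j\<in>UNIV. der_scale (c j) (b j))" for i
    proof -
      have "\<eta> i \<in> der.span B" using that B(2) by blast
      then obtain c where "\<eta> i = (\<Sum>v\<in>B. der_scale (c v) v)"
        unfolding der.span_finite[OF \<open>finite B\<close>] by blast
      also have "\<dots> = (\<Sum>j\<in>UNIV. der_scale (c (b j)) (b j))"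
        using sum.reindex_bij_betw[OF b(1), of "\<lambda>v. der_scale (c v) v"] by simp
      finally show ?thesis by (rule exI[of _ "\<lambda>j. c (b j)"])
    qed
    then obtain c where "\<And>i. \<eta> i = (\<Sum>j\<in>UNIV. der_scale (c i j) (b j))" by metis
    from jac_product[of \<eta> c b, OF this] show ?thesis by blast
  qed
  \<comment> \<open>The polynomials whose quotient by \<open>jac b\<close> lies in the maximal ideal
    at \<open>p\<close>. A tuple with determinant outside \<open>J\<close> agrees with the basis up
    to a unit at \<open>p\<close>.\<close>
  define J where "J = {f. \<exists>w v. w \<notin> p \<and> v \<in> p \<and> w * f = v * jac b}"
  have "\<exists>\<tau> :: 'n \<Rightarrow> _. range \<tau> \<subseteq> (\<Union>d. D1_component ?A d) \<and> jac \<tau> \<notin> J"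
  proof (rule ccontr)
    assume no: "\<not> ?thesis"
    have "jac b \<in> J"
    proof (rule jac_span)
      show "ideal.subspace J"
        unfolding J_def by (rule subspace_local_multiples[OF p Proj_subspace[OF p]])
      show "jac \<tau> \<in> J" if "range \<tau> \<subseteq> (\<Union>d. D1_component ?A d)" for \<tau> :: "'n \<Rightarrow> _"
        using no that by blast
      show "range b \<subseteq> der.span (\<Union>d. D1_component ?A d)"
        using D1_span_homog[OF A'] b_in by (intro image_subsetI) (rule subsetD)
    qed
    then obtain w v where "w \<notin> p" "v \<in> p" "w * jac b = v * jac b"
      unfolding J_def by (elim CollectE exE conjE)
    thus False using sym_mult_cancel[OF b(2), of w v] by (simp add: mult.commute)
  qed
  then obtain \<tau> :: "'n \<Rightarrow> _" where \<tau>: "range \<tau> \<subseteq> (\<Union>d. D1_component ?A d)" "jac \<tau> \<notin> J"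
    by (elim exE conjE)
  from \<tau>(1) have "\<forall>i. \<exists>d. \<tau> i \<in> D1_component ?A d" by blast
  then obtain dd where dd: "\<And>i. \<tau> i \<in> D1_component ?A (dd i)" by metis
  have \<tau>D: "\<tau> i \<in> D1 ?A" "\<tau> i \<in> Der" for i using D1_componentD[OF dd] by blast+
  obtain v where v: "jac \<tau> = v * jac b" using dvd_b[of \<tau>] \<tau>D by blast
  have vp: "v \<notin> p"
  proof
    assume "v \<in> p"
    hence "jac \<tau> \<in> J" unfolding J_def
      by - (rule CollectI, rule exI[of _ 1], rule exI[of _ v], simp add: v Proj_1[OF p])
    with \<tau>(2) show False by blast
  qed
  have jac0: "jac \<tau> \<noteq> 0"
    using v b(2) sym_no_zero_divisors[of v "jac b"] vp Proj_0[OF p] by auto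
  \<comment> \<open>The basis \<open>b\<close>, hence also \<open>v\<close>, need not be
    homogeneous, but the denominator of a frame must be.\<close>
  have "\<exists>e. hcomp e v \<notin> p"
  proof (rule ccontr)
    assume *: "\<not> ?thesis"
    have "v = (\<Sum>e\<in>mon_degree ` Poly_Mapping.keys v. hcomp e v)"
      by (rule hcomp_expansion) auto
    moreover have "\<dots> \<in> p" using * by (intro ideal.subspace_sum[OF Proj_subspace[OF p]]) auto
    ultimately show False using vp by simp
  qed
  then obtain a where a: "hcomp a v \<notin> p" by blast
  \<comment> \<open>Cramer's rule expresses \<open>v\<close> times \<open>\<eta>\<close> through the
    \<open>\<tau> i\<close>. As \<open>\<eta>\<close> and the \<open>\<tau> i\<close> are
    homogeneous, the part in degree \<open>a + e\<close> is the same relation for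
    \<open>hcomp a v\<close>. Multiplying by \<open>var k ^ dd i\<close> makes the degrees of the
    coefficients independent of \<open>i\<close>.\<close>
  have gen: "\<exists>w. (\<forall>i. w i * var k ^ dd i \<in> homog (a + e)) \<and>
      der_scale (hcomp a v) \<eta> = (\<Sum>i\<in>UNIV. der_scale (w i) (\<tau> i))"
    if \<eta>: "\<eta> \<in> D1_component ?A e" for \<eta> e k
  proof -
    have \<eta>D: "\<eta> \<in> D1 ?A" "\<eta> \<in> Der" using D1_componentD[OF \<eta>] by auto
    have "\<exists>w. jac (\<tau>(i := \<eta>)) = w * jac b" for i
      using \<tau>D \<eta>D by (intro dvd_b) auto
    then obtain w where w: "\<And>i. jac (\<tau>(i := \<eta>)) = w i * jac b" by metis
    have "der_scale (jac b) (der_scale v \<eta>) = der_scale (jac b) (\<Sum>i\<in>UNIV. der_scale (w i) (\<tau> i))"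
      using jac_cramer[OF \<tau>D(2) \<eta>D(2) jac0] unfolding v w
      by (simp add: der.scale_sum_right mult.commute)
    hence veq: "v * \<eta> (var j) = (\<Sum>i\<in>UNIV. w i * \<tau> i (var j))" for j
      using sym_mult_cancel[OF b(2)] by (auto simp: der_scale_def fun_eq_iff sum_fun_apply)
    \<comment> \<open>The test guards the truncated subtraction: when \<open>dd i\<close> exceeds
      \<open>a + e\<close>, the term with \<open>\<tau> i\<close> has no part in that
      degree.\<close>
    define w' where "w' i = (if dd i \<le> a + e then hcomp (a + e - dd i) (w i) else 0)" for i
    have "der_scale (hcomp a v) \<eta> = (\<Sum>i\<in>UNIV. der_scale (w' i) (\<tau> i))"
    proof (rule Der_eqI)
      show "der_scale (hcomp a v) \<eta> \<in> Der" using der.subspace_scale[OF subspace_Der \<eta>D(2)] .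
      show "(\<Sum>i\<in>UNIV. der_scale (w' i) (\<tau> i)) \<in> Der"
        using \<tau>D(2) by (intro der.subspace_sum[OF subspace_Der] der.subspace_scale[OF subspace_Der])
      fix j
      have \<eta>j: "\<eta> (var j) \<in> forms UNIV e" using \<eta> by (simp add: D1_component_def homog_forms)
      have \<tau>j: "\<tau> i (var j) \<in> forms UNIV (dd i)" for i using dd[of i] by (simp add: D1_component_def homog_forms)
      have "hcomp (a + e) (\<eta> (var j) * v) = (\<Sum>i\<in>UNIV. hcomp (a + e) (\<tau> i (var j) * w i))"
        using veq[of j] by (simp add: mult.commute slice_sum)
      hence "\<eta> (var j) * hcomp a v = (\<Sum>i\<in>UNIV. \<tau> i (var j) * w' i)"
        by (simp add: slice_mult[OF \<eta>j] slice_mult[OF \<tau>j] w'_def if_distrib[of "\<lambda>x. _ * x"] cong: if_cong)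
      thus "der_scale (hcomp a v) \<eta> (var j) = (\<Sum>i\<in>UNIV. der_scale (w' i) (\<tau> i)) (var j)"
        by (simp add: der_scale_def sum_fun_apply mult.commute)
    qed
    moreover have "w' i * var k ^ dd i \<in> homog (a + e)" for i
      using homog_mult[OF hcomp_homog homog_var_power, of "a + e - dd i" "w i" k "dd i"]
      by (auto simp: w'_def)
    ultimately show ?thesis by blast
  qed
  obtain k where k: "var k \<notin> p" using Proj_var[OF p] by blast
  \<comment> \<open>A common upper bound for the degrees \<open>dd i\<close>.\<close>
  define E where "E = (\<Sum>i\<in>UNIV. dd i)"
  have ddE: "dd i \<le> E" for i unfolding E_def by (rule member_le_sum) auto
  let ?Q = "complement_poly A X" and ?q = "card (A - ?A)"
  have finA: "finite (A - ?A)" using A by (simp add: arrangement_def)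
  have Q: "?Q \<in> homog ?q" unfolding complement_poly_def by (rule prod_forms_homog[OF finA])
  have Qp: "?Q \<notin> p"
    unfolding complement_poly_def using X(3) by (intro Proj_prod[OF finA p]) auto
  have "\<exists>ix :: nat \<Rightarrow> 'n. bij_betw ix {..<CARD('n)} UNIV"
    using ex_bij_betw_nat_finite[of "UNIV :: 'n set"] by (auto simp: atLeast0LessThan)
  then obtain ix :: "nat \<Rightarrow> 'n" where ix: "bij_betw ix {..<CARD('n)} UNIV" by blast
  \<comment> \<open>The power of \<open>var k\<close> raises every \<open>\<tau>\<close> to degree
    \<open>E\<close>, and \<open>?Q\<close> moves it from the subarrangement to \<open>A\<close>;
    both factors lie outside \<open>p\<close>.\<close>
  define \<theta> where "\<theta> j = der_scale ?Q (der_scale (var k ^ (E - dd (ix j))) (\<tau> (ix j)))" for j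
  \<comment> \<open>The denominator \<open>var k ^ (?q + E)\<close> matches the degree of the
    \<open>\<theta> j\<close>. In the other one, \<open>hcomp a v\<close> comes from Cramer's rule,
    while \<open>?Q * var k ^ E\<close> provides the factors by which the \<open>\<theta> j\<close>
    differ from the \<open>\<tau> i\<close>.\<close>
  have "frame der_scale (D1_component A) CARD('n) (?q + E) \<theta> (var k ^ (?q + E)) (hcomp a v * ?Q * var k ^ E) a"
  proof (intro frame.intro frame_axioms.intro graded_module_D1)
    show "\<theta> j \<in> D1_component A (?q + E)" for j
      unfolding \<theta>_def using D1_component_scale[OF homog_var_power[of k "E - dd (ix j)"] dd[of "ix j"]] ddE
      by (intro complement_poly_scale[OF A]) simp
    show "var k ^ (?q + E) \<in> homog (?q + E)" by (rule homog_var_power)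
    show "hcomp a v * ?Q * var k ^ E \<in> homog (a + (?q + E))"
      using homog_mult[OF homog_mult[OF hcomp_homog Q] homog_var_power] by (simp add: add.assoc)
  next
    fix c i assume 0: "(\<Sum>j<CARD('n). der_scale (c j) (\<theta> j)) = 0" and i: "i < CARD('n)"
    define iy where "iy = the_inv_into {..<CARD('n)} ix"
    have iy: "iy (ix j) = j" if "j < CARD('n)" for j
      using that ix by (auto simp: iy_def bij_betw_def intro: the_inv_into_f_f)
    have "(\<Sum>j<CARD('n). der_scale (c j) (\<theta> j)) =
        (\<Sum>j<CARD('n). der_scale (c (iy (ix j)) * ?Q * var k ^ (E - dd (ix j))) (\<tau> (ix j)))"
      by (intro sum.cong refl) (simp add: \<theta>_def iy mult.assoc)
    also have "\<dots> = (\<Sum>l\<in>UNIV. der_scale (c (iy l) * ?Q * var k ^ (E - dd l)) (\<tau> l))"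
      by (rule sum.reindex_bij_betw[OF ix])
    finally have "c (iy (ix i)) * ?Q * var k ^ (E - dd (ix i)) = 0"
      using 0 by (intro jac_independent[OF jac0, of "\<lambda>l. c (iy l) * ?Q * var k ^ (E - dd l)"]) simp
    hence "c i * (?Q * var k ^ (E - dd (ix i))) = 0" using iy[OF i] by (simp add: mult.assoc)
    moreover have "?Q * var k ^ (E - dd (ix i)) \<notin> p"
      using Qp Proj_power[OF p k] by (simp add: Proj_mult[OF p])
    ultimately show "c i = 0" using sym_no_zero_divisors Proj_0[OF p] by metis
  next
    fix e \<eta> assume "\<eta> \<in> D1_component A e"
    hence "\<eta> \<in> D1_component ?A e" by (rule D1_component_subarrangement[OF A])
    from gen[OF this, of k] obtain w where w: "\<forall>i. w i * var k ^ dd i \<in> homog (a + e)"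
      "der_scale (hcomp a v) \<eta> = (\<Sum>i\<in>UNIV. der_scale (w i) (\<tau> i))" by blast
    have "der_scale (hcomp a v * ?Q * var k ^ E) \<eta> = der_scale (?Q * var k ^ E) (der_scale (hcomp a v) \<eta>)"
      by (simp add: mult_ac)
    also have "\<dots> = (\<Sum>i\<in>UNIV. der_scale (w i * ?Q * (var k ^ dd i * var k ^ (E - dd i))) (\<tau> i))"
      using ddE unfolding w by (simp add: der.scale_sum_right mult_ac flip: power_add)
    also have "\<dots> = (\<Sum>j<CARD('n). der_scale (w (ix j) * ?Q * (var k ^ dd (ix j) * var k ^ (E - dd (ix j)))) (\<tau> (ix j)))"
      by (rule sum.reindex_bij_betw[OF ix, symmetric])
    also have "\<dots> = (\<Sum>j<CARD('n). der_scale (w (ix j) * var k ^ dd (ix j)) (\<theta> j))"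
      by (simp add: \<theta>_def mult_ac)
    finally show "\<exists>c. (\<forall>i<CARD('n). c i \<in> homog (a + e)) \<and>
        der_scale (hcomp a v * ?Q * var k ^ E) \<eta> = (\<Sum>i<CARD('n). der_scale (c i) (\<theta> i))"
      using w(1) by (intro exI[of _ "\<lambda>j. w (ix j) * var k ^ dd (ix j)"]) simp
  qed
  moreover have "hcomp a v * ?Q * var k ^ E \<notin> p" "var k ^ (?q + E) \<notin> p"
    using a Qp Proj_power[OF p k] by (simp_all add: Proj_mult[OF p])
  ultimately show ?thesis by blast
qed

section \<open>From local frames to free localizations\<close>

lemma eval_hom_inverse:
  assumes "\<And>i. eval_hom scalar \<alpha> (\<beta> i) = var i"
  shows "eval_hom scalar \<alpha> (eval_hom scalar \<beta> f) = f"
proof -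
  note hom = eval_hom_add[OF coeff_hom_scalar] eval_hom_mult[OF coeff_hom_scalar]
      eval_hom_scalar[OF coeff_hom_scalar] eval_hom_var[OF coeff_hom_scalar] eval_hom_one[OF coeff_hom_scalar]
  have "eval_hom scalar \<alpha> (eval_hom scalar \<beta> f) = eval_hom scalar var f"
    using hom_eq_eval_hom[of "\<lambda>f. eval_hom scalar \<alpha> (eval_hom scalar \<beta> f)" f] assms
    by (simp add: hom)
  thus ?thesis by (simp add: eval_hom_id)
qed

lemma eval_hom_linear_forms:
  "eval_hom scalar (\<lambda>i. linear_form (P i)) (linear_form a) = linear_form (\<Sum>i\<in>UNIV. a $ i *s P i)"
  by (simp add: eval_hom_linear_form linear_form_sum linear_form_scale)

text \<open>A basis of \<open>W\<close> is extended to a basis \<open>P\<close> of the space of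
  linear forms. The substitution \<open>\<alpha>\<close> sends the variables to \<open>P\<close>,
  \<open>\<beta>\<close> is given by the inverse matrix, and \<open>I\<close> marks the basis
  vectors taken from \<open>W\<close>; it is not everything because \<open>W\<close> is
  proper.\<close>

lemma adapted_coordinates:
  fixes W :: "('k::field ^ 'n::finite) set"
  assumes W: "vec.subspace W" "W \<noteq> UNIV"
  shows "\<exists>I (\<alpha> :: 'n \<Rightarrow> ('k, 'n) sym) (\<beta> :: 'n \<Rightarrow> ('k, 'n) sym). I \<noteq> UNIV \<and> (\<forall>i. \<alpha> i \<in> range linear_form) \<and> (\<forall>i. \<beta> i \<in> range linear_form) \<and>
    (\<forall>f. eval_hom scalar \<alpha> (eval_hom scalar \<beta> f) = f) \<and>
    (\<forall>f. eval_hom scalar \<beta> (eval_hom scalar \<alpha> f) = f) \<and>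
    (\<forall>a. eval_hom scalar \<beta> (linear_form a) \<in> forms I 1 \<longleftrightarrow> a \<in> W)"
proof -
  obtain B0 where B0: "B0 \<subseteq> W" "vec.independent B0" "W \<subseteq> vec.span B0"
    using vec.maximal_independent_subset by blast
  let ?B = "vec.extend_basis B0"
  have B: "B0 \<subseteq> ?B" "vec.independent ?B" "vec.span ?B = UNIV"
    using vec.extend_basis_superset vec.independent_extend_basis vec.span_extend_basis B0(2) by auto
  have "card ?B = CARD('n)"
    using vec.dim_eq_card[of ?B UNIV] B by (simp add: card_cart_basis)
  moreover have "finite ?B" using B(2) by (rule vec.finiteI_independent)
  ultimately obtain P :: "'n \<Rightarrow> 'k ^ 'n" where P: "bij_betw P UNIV ?B"
    by (metis finite bij_betw_iff_card)
  define M where "M = (\<chi> i. P i)"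
  have "rows M = ?B" using P by (auto simp: rows_def row_def M_def bij_betw_def)
  then obtain C where C: "C ** M = mat 1"
    using matrix_left_invertible_span_rows_gen[of M] B(3) by auto
  hence C': "M ** C = mat 1" by (simp add: matrix_left_right_inverse)
  define I where "I = {i. P i \<in> B0}"
  define \<alpha> where "\<alpha> i = linear_form (P i)" for i
  define \<beta> where "\<beta> i = linear_form (C $ i)" for i
  have "(\<Sum>j\<in>UNIV. C $ i $ j *s P j) = axis i 1" for i
  proof -
    have "(\<Sum>j\<in>UNIV. C $ i $ j *s P j) $ k = (C ** M) $ i $ k" for k
      by (simp add: matrix_matrix_mult_def M_def sum_component)
    thus ?thesis by (simp add: vec_eq_iff C mat_def axis_def)
  qed
  hence "eval_hom scalar \<alpha> (\<beta> i) = var i" for i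
    unfolding \<alpha>_def \<beta>_def eval_hom_linear_forms by (simp add: var_eq_linear_form)
  hence \<alpha>\<beta>: "eval_hom scalar \<alpha> (eval_hom scalar \<beta> f) = f" for f
    by (rule eval_hom_inverse)
  have "(\<Sum>j\<in>UNIV. P i $ j *s C $ j) = axis i 1" for i
  proof -
    have "(\<Sum>j\<in>UNIV. P i $ j *s C $ j) $ k = (M ** C) $ i $ k" for k
      by (simp add: matrix_matrix_mult_def M_def sum_component)
    thus ?thesis by (simp add: vec_eq_iff C' mat_def axis_def)
  qed
  hence \<beta>P: "eval_hom scalar \<beta> (\<alpha> i) = var i" for i
    unfolding \<alpha>_def \<beta>_def eval_hom_linear_forms by (simp add: var_eq_linear_form)
  hence \<beta>\<alpha>: "eval_hom scalar \<beta> (eval_hom scalar \<alpha> f) = f" for f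
    by (rule eval_hom_inverse)
  have "eval_hom scalar \<beta> (linear_form a) \<in> forms I 1" if "a \<in> W" for a
  proof -
    have "vec.subspace {a. eval_hom scalar \<beta> (linear_form a) \<in> forms I 1}"
      using linear_form_0_iff[of "0 :: 'k ^ 'n"]
      by (auto simp: vec.subspace_def linear_form_add linear_form_scale eval_hom_zero
          eval_hom_add[OF coeff_hom_scalar] eval_hom_mult[OF coeff_hom_scalar]
          eval_hom_scalar[OF coeff_hom_scalar] intro: forms_add forms_scale)
    moreover have "eval_hom scalar \<beta> (linear_form x) \<in> forms I 1" if "x \<in> B0" for x
    proof -
      from that B(1) P obtain i where "x = P i" by (auto simp: bij_betw_def)
      thus ?thesis using \<beta>P[of i] that var_forms[of i I] by (simp add: \<alpha>_def I_def)
    qed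
    ultimately have "vec.span B0 \<subseteq> {a. eval_hom scalar \<beta> (linear_form a) \<in> forms I 1}"
      by (intro vec.span_minimal) auto
    thus ?thesis using that B0(3) by auto
  qed
  moreover have "a \<in> W" if "eval_hom scalar \<beta> (linear_form a) \<in> forms I 1" for a
  proof -
    obtain b where b: "eval_hom scalar \<beta> (linear_form a) = linear_form b"
      unfolding \<beta>_def eval_hom_linear_forms by blast
    have "b $ i = 0" if "i \<notin> I" for i
    proof (rule ccontr)
      assume "b $ i \<noteq> 0"
      hence "Poly_Mapping.single i 1 \<in> Poly_Mapping.keys (linear_form b)"
        using lookup_linear_form[of b i] by (simp add: in_keys_iff)
      hence "mon_restrict I (Poly_Mapping.single i 1) = Poly_Mapping.single i 1"
        using \<open>eval_hom scalar \<beta> (linear_form a) \<in> forms I 1\<close> by (simp add: b forms_def)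
      hence "Poly_Mapping.lookup (mon_restrict I (Poly_Mapping.single i (1::nat))) i = 1" by simp
      thus False using that by (simp add: lookup_mon_restrict)
    qed
    hence "b $ i *s P i \<in> W" for i
      using B0(1) vec.subspace_scale[OF W(1)] vec.subspace_0[OF W(1)] by (cases "i \<in> I") (auto simp: I_def)
    hence "(\<Sum>i\<in>UNIV. b $ i *s P i) \<in> W" by (intro vec.subspace_sum[OF W(1)])
    moreover have "linear_form a = linear_form (\<Sum>i\<in>UNIV. b $ i *s P i)"
      using \<alpha>\<beta>[of "linear_form a"] unfolding b unfolding \<alpha>_def eval_hom_linear_forms by simp
    ultimately show "a \<in> W" by (simp add: linear_form_inj)
  qed
  moreover have "I \<noteq> UNIV"
  proof
    assume "I = UNIV"
    hence "P i \<in> B0" for i by (auto simp: I_def)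
    hence "range P \<subseteq> B0" by blast
    moreover have "range P = ?B" using P by (simp add: bij_betw_def)
    ultimately have "?B = B0" using B(1) by (intro equalityI) simp_all
    hence "UNIV \<subseteq> W" using B(3) vec.span_minimal[OF B0(1) W(1)] by simp
    thus False using W(2) by blast
  qed
  ultimately show ?thesis
    using \<alpha>\<beta> \<beta>\<alpha> by (intro exI[of _ I] exI[of _ \<alpha>] exI[of _ \<beta>]) (auto simp: \<alpha>_def \<beta>_def)
qed

text \<open>The substitution \<open>y = 0\<close>, that is, restriction to a coordinate subspace.
  Its kernel is the ideal generated by the variables in \<open>I\<close>.\<close>

definition kill :: "'n set \<Rightarrow> 'n::finite \<Rightarrow> ('k::field, 'n) sym" where
  "kill I i = (if i \<in> I then 0 else var i)"

lemma kill_homog: "kill I i \<in> homog 1"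
  using var_homog by (auto simp: kill_def)

lemma kill_forms:
  fixes g :: "('k::field, 'n::finite) sym"
  assumes "g \<in> forms I d" "0 < d"
  shows "eval_hom scalar (kill I) g = 0"
  unfolding eval_hom_def
proof (rule sum.neutral, rule)
  fix m assume "m \<in> Poly_Mapping.keys g"
  hence m: "mon_restrict I m = m" "mon_degree m \<noteq> 0" using assms by (auto simp: forms_def)
  then obtain i where i: "Poly_Mapping.lookup m i \<noteq> 0" by (auto simp: mon_degree_def)
  hence "i \<in> I" using m(1) lookup_mon_restrict[of I m i] by (auto split: if_splits)
  hence "(\<Prod>i\<in>UNIV. kill I i ^ Poly_Mapping.lookup m i :: ('k, 'n) sym) = 0"
    using i by (intro prod_zero bexI[of _ i]) (auto simp: kill_def zero_power)
  thus "scalar (Poly_Mapping.lookup g m) * (\<Prod>i\<in>UNIV. kill I i ^ Poly_Mapping.lookup m i) = 0" by simp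
qed

text \<open>A polynomial that does not vanish at \<open>y = 0\<close> has a monomial without
  variables from \<open>I\<close>; that monomial is seen by a slice of degree 0 in
  \<open>y\<close>.\<close>

lemma kill_slice:
  assumes "eval_hom scalar (kill I) f \<noteq> 0"
  shows "\<exists>b. slice I (b, 0) f \<noteq> 0"
proof (rule ccontr)
  assume "\<not> ?thesis"
  hence "eval_hom scalar (kill I) (slice I x f) = 0" for x
    using kill_forms[OF slice_forms[of I x f]] by (cases x, cases "snd x") (auto simp: eval_hom_zero)
  hence "eval_hom scalar (kill I) (\<Sum>x\<in>bidegree I ` Poly_Mapping.keys f. Poly_Mapping.single (fst x) 1 * slice I x f) = 0"
    by (simp add: eval_hom_sum[OF coeff_hom_scalar] eval_hom_mult[OF coeff_hom_scalar])
  thus False using slice_expansion[of "Poly_Mapping.keys f" f I] assms by simp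
qed

lemma kill_linear_form:
  assumes "eval_hom scalar (kill I) (linear_form b) = 0"
  shows "linear_form b \<in> forms I 1"
proof (rule linear_form_forms)
  fix i assume i: "i \<notin> I"
  have "eval_hom scalar (kill I) (linear_form b) = linear_form (\<chi> i. if i \<in> I then 0 else b $ i)"
    unfolding eval_hom_linear_form unfolding linear_form_def
    by (intro sum.cong) (auto simp: kill_def)
  hence "(\<chi> i. if i \<in> I then 0 else b $ i) = 0" using assms by (simp add: linear_form_0_iff)
  from arg_cong[OF this, of "\<lambda>x. x $ i"] show "b $ i = 0" using i by simp
qed

text \<open>The kernel of a graded homomorphism into a ring without zero divisors is prime and
  homogeneous. A variable outside \<open>I\<close> survives the substitution, so the kernel does not
  contain the irrelevant ideal.\<close>

lemma kernel_Proj: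
  fixes \<alpha> \<beta> :: "'n::finite \<Rightarrow> ('k::field, 'n) sym"
  assumes I: "I \<noteq> UNIV" and \<alpha>: "\<And>i. \<alpha> i \<in> range linear_form" and \<beta>: "\<And>i. \<beta> i \<in> range linear_form"
    and \<beta>\<alpha>: "\<And>f. eval_hom scalar \<beta> (eval_hom scalar \<alpha> f) = f"
  defines "p \<equiv> {f. eval_hom scalar (kill I) (eval_hom scalar \<beta> f) = 0}"
  shows "p \<in> Proj"
proof -
  let ?R = "eval_hom scalar (kill I :: 'n \<Rightarrow> ('k, 'n) sym)" and ?b = "eval_hom scalar \<beta>"
  note hom = eval_hom_add[OF coeff_hom_scalar] eval_hom_mult[OF coeff_hom_scalar]
      eval_hom_sum[OF coeff_hom_scalar] eval_hom_one[OF coeff_hom_scalar] eval_hom_var[OF coeff_hom_scalar]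
  have sub: "ideal.subspace p"
    by (rule ideal.subspaceI) (auto simp: p_def hom eval_hom_zero)
  have prime: "prime_ideal p"
    unfolding prime_ideal_def
  proof (intro conjI allI impI)
    have "1 \<notin> p" by (simp add: p_def hom)
    thus "p \<noteq> UNIV" by blast
    show "f \<in> p \<or> g \<in> p" if "f * g \<in> p" for f g
      using that sym_no_zero_divisors[of "?R (?b f)" "?R (?b g)"] by (simp add: p_def hom)
  qed (rule sub)
  have \<beta>h: "\<beta> i \<in> homog 1" for i using \<beta>[of i] linear_form_homog by auto
  have comp: "hcomp d f \<in> p" if "f \<in> p" "d \<in> mon_degree ` Poly_Mapping.keys f" for f d
  proof -
    let ?K = "mon_degree ` Poly_Mapping.keys f"
    have "f = (\<Sum>d\<in>?K. hcomp d f)" by (rule hcomp_expansion) auto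
    hence "?R (?b f) = ?R (?b (\<Sum>d\<in>?K. hcomp d f))" by (rule arg_cong)
    hence "(\<Sum>d\<in>?K. ?R (?b (hcomp d f))) = 0"
      using that(1) by (simp add: p_def hom)
    moreover have "?R (?b (hcomp d f)) \<in> homog d" for d
      by (intro graded_hom kill_homog \<beta>h hcomp_homog)
    ultimately have "?R (?b (hcomp d f)) = 0"
      using homog_sum_zero[of ?K "\<lambda>d. ?R (?b (hcomp d f))" d] that(2) by simp
    thus ?thesis by (simp add: p_def)
  qed
  have "homog_ideal p"
    unfolding homog_ideal_def
  proof (rule equalityI)
    show "ideal.span {f \<in> p. \<exists>d. f \<in> homog d} \<subseteq> p"
      by (rule ideal.span_minimal[OF _ sub]) auto
    show "p \<subseteq> ideal.span {f \<in> p. \<exists>d. f \<in> homog d}"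
    proof
      fix f assume f: "f \<in> p"
      have "f = (\<Sum>d\<in>mon_degree ` Poly_Mapping.keys f. hcomp d f)" by (rule hcomp_expansion) auto
      also have "\<dots> \<in> ideal.span {f \<in> p. \<exists>d. f \<in> homog d}"
        using comp[OF f] hcomp_homog by (intro ideal.span_sum ideal.span_base) blast
      finally show "f \<in> ideal.span {f \<in> p. \<exists>d. f \<in> homog d}" .
    qed
  qed
  moreover obtain k where k: "k \<notin> I" using I by blast
  have "\<alpha> k \<in> irrelevant_ideal"
    unfolding irrelevant_ideal_def using \<alpha>[of k] linear_form_homog
    by (intro ideal.span_base) (auto intro!: bexI[of _ "1::nat"])
  moreover have "\<alpha> k \<notin> p"
  proof
    assume "\<alpha> k \<in> p"
    hence "?R (?b (eval_hom scalar \<alpha> (var k))) = 0" by (simp add: p_def hom)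
    hence "?R (var k) = 0" by (simp only: \<beta>\<alpha>)
    hence "var k = (0 :: ('k, 'n) sym)" using k by (simp add: hom kill_def)
    hence "Poly_Mapping.lookup (var k :: ('k, 'n) sym) (Poly_Mapping.single k 1) = 0" by simp
    thus False by (simp add: lookup_var)
  qed
  ultimately show ?thesis using prime by (auto simp: Proj_def)
qed

lemma eval_hom_det:
  fixes M :: "('k::field, 'n::finite) sym ^ 'm ^ 'm"
  shows "eval_hom scalar \<sigma> (det M) = det (\<chi> i j. eval_hom scalar \<sigma> (M $ i $ j))"
proof -
  note hom = eval_hom_mult[OF coeff_hom_scalar] eval_hom_sum[OF coeff_hom_scalar]
      eval_hom_one[OF coeff_hom_scalar] eval_hom_scalar[OF coeff_hom_scalar]
  have prd: "eval_hom scalar \<sigma> (prod h K) = (\<Prod>x\<in>K. eval_hom scalar \<sigma> (h x))" if "finite K"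
    for h :: "'m \<Rightarrow> ('k, 'n) sym" and K
    using that by (induction K rule: finite_induct) (auto simp: hom)
  have "eval_hom scalar \<sigma> (of_int z) = of_int z" for z
  proof -
    have "(of_int z :: ('k, 'a) sym) = scalar (of_int z)" for z
      by (simp add: scalar_def flip: single_of_int)
    moreover have "(of_int z :: ('k, 'n) sym) = scalar (of_int z)" for z
      by (simp add: scalar_def flip: single_of_int)
    ultimately show ?thesis by (simp add: hom)
  qed
  thus ?thesis by (simp add: det_def hom prd)
qed

lemma free_of_frames:
  fixes A :: "('k::field ^ 'n::finite) set set"
  assumes A: "arrangement A"
    and frames: "\<And>p :: ('k, 'n) sym set. p \<in> Proj \<Longrightarrow> \<exists>r d \<theta>. (\<forall>i<r::nat. \<theta> i \<in> D1_component A d) \<and>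
      (\<forall>c. (\<Sum>i<r. der_scale (c i) (\<theta> i)) = 0 \<longrightarrow> (\<forall>i<r. c i = 0)) \<and>
      (\<forall>e. \<forall>\<eta>\<in>D1_component A e. \<exists>u c. u \<notin> p \<and> der_scale u \<eta> = (\<Sum>i<r. der_scale (c i) (\<theta> i)))"
    and X: "codim X < CARD('n)"
  shows "free_arrangement (subarrangement A X)"
proof -
  let ?A = "subarrangement A X"
  have A': "arrangement ?A" using A by (rule arrangement_sub)
  have "vec.dim X \<noteq> 0" using X unfolding codim_def by linarith
  hence "\<not> X \<subseteq> {0}" by simp
  then obtain v where v: "v \<in> X" "v \<noteq> 0" by blast
  \<comment> \<open>The linear forms spanned by those of the subarrangement. They all vanish at the
    nonzero vector \<open>v\<close> of \<open>X\<close>, so \<open>W\<close> is proper and some new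
    variable remains outside \<open>I\<close>.\<close>
  define W where "W = vec.span (normal ` ?A)"
  have W: "(\<Sum>i\<in>UNIV. a $ i * x $ i) = 0" if "a \<in> W" "x \<in> X" for a x
  proof -
    have "vec.subspace {a. (\<Sum>i\<in>UNIV. x $ i * a $ i) = 0}" by (rule kernel_subspace)
    moreover have "(\<Sum>i\<in>UNIV. x $ i * normal H $ i) = 0" if "H \<in> ?A" for H
    proof -
      have "x \<in> H" using that \<open>x \<in> X\<close> by (auto simp: subarrangement_def)
      moreover have "H = {v. (\<Sum>i\<in>UNIV. normal H $ i * v $ i) = 0}" using normal(1)[OF A' that] .
      ultimately show ?thesis by (auto simp: mult.commute)
    qed
    ultimately have "W \<subseteq> {a. (\<Sum>i\<in>UNIV. x $ i * a $ i) = 0}"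
      unfolding W_def by (intro vec.span_minimal) auto
    thus ?thesis using that(1) by (auto simp: mult.commute)
  qed
  have "W \<noteq> UNIV"
  proof
    assume "W = UNIV"
    hence "(\<Sum>i\<in>UNIV. axis j 1 $ i * v $ i) = 0" for j using W v(1) by blast
    hence "v $ j = 0" for j
      by (simp add: axis_def if_distrib[of "\<lambda>x. x * _"] cong: if_cong)
    thus False using v(2) by (simp add: vec_eq_iff)
  qed
  have "vec.subspace W" unfolding W_def by simp
  from adapted_coordinates[OF this \<open>W \<noteq> UNIV\<close>] obtain I and \<alpha> \<beta> :: "'n \<Rightarrow> ('k, 'n) sym"
    where I: "I \<noteq> UNIV" and \<alpha>: "\<forall>i. \<alpha> i \<in> range linear_form" and \<beta>: "\<forall>i. \<beta> i \<in> range linear_form"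
      and \<alpha>\<beta>: "\<forall>f. eval_hom scalar \<alpha> (eval_hom scalar \<beta> f) = f"
      and \<beta>\<alpha>: "\<forall>f. eval_hom scalar \<beta> (eval_hom scalar \<alpha> f) = f"
      and forms: "\<forall>a. eval_hom scalar \<beta> (linear_form a) \<in> forms I 1 \<longleftrightarrow> a \<in> W"
    by (elim exE conjE)
  let ?a = "eval_hom scalar \<alpha>" and ?b = "eval_hom scalar \<beta>"
  have dvd_b: "?b f dvd ?b g" if "f dvd g" for f g
    using that by (auto simp: dvd_def eval_hom_mult[OF coeff_hom_scalar])
  have dvd_a: "f dvd g" if "?b f dvd ?b g" for f g
  proof -
    have "?a (?b f) dvd ?a (?b g)"
      using that by (auto simp: dvd_def eval_hom_mult[OF coeff_hom_scalar])
    thus ?thesis using \<alpha>\<beta> by simp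
  qed
  \<comment> \<open>In the new coordinates the variables in \<open>I\<close> span \<open>W\<close>,
    so \<open>p\<close> is the ideal generated by the linear forms in \<open>W\<close>.\<close>
  define p where "p = {f. eval_hom scalar (kill I) (?b f) = 0}"
  have p: "p \<in> Proj"
    unfolding p_def using I \<alpha> \<beta> \<beta>\<alpha> by (intro kernel_Proj[of I \<alpha> \<beta>]) simp_all
  have slice: "\<exists>b. slice I (b, 0) (?b u) \<noteq> 0" if "u \<notin> p" for u
    using that by (intro kill_slice) (simp add: p_def)
  have linear: "?b (linear_form a) \<in> range linear_form" for a
  proof -
    have "\<forall>i. \<exists>a. \<beta> i = linear_form a" using \<beta> by (simp add: image_iff)
    from choice[OF this] obtain C where "\<forall>i. \<beta> i = linear_form (C i)" by (elim exE)
    hence "\<beta> = (\<lambda>i. linear_form (C i))" by auto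
    thus ?thesis by (simp add: eval_hom_linear_forms)
  qed
  let ?Q = "complement_poly A X"
  have finA: "finite (A - ?A)" using A by (simp add: arrangement_def)
  \<comment> \<open>A hyperplane whose form lies in \<open>p\<close> has its normal in
    \<open>W\<close>, so it contains \<open>X\<close> and is not a factor of
    \<open>?Q\<close>.\<close>
  have "?Q \<notin> p"
    unfolding complement_poly_def
  proof (rule Proj_prod[OF finA p])
    fix H assume H: "H \<in> A - ?A"
    show "hyperplane_form H \<notin> p"
    proof
      assume "hyperplane_form H \<in> p"
      moreover obtain b where b: "?b (linear_form (normal H)) = linear_form b"
        using linear by blast
      ultimately have "?b (linear_form (normal H)) \<in> forms I 1"
        using kill_linear_form[of I b] by (simp add: p_def hyperplane_form_normal)
      hence "normal H \<in> W" using forms by blast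
      hence "X \<subseteq> {v. (\<Sum>i\<in>UNIV. normal H $ i * v $ i) = 0}" using W by auto
      also have "\<dots> = H" using normal(1)[OF A, of H] H by simp
      finally have "X \<subseteq> H" .
      thus False using H by (simp add: subarrangement_def)
    qed
  qed
  from frames[OF p] obtain r d \<theta> where \<theta>: "\<forall>i<r::nat. \<theta> i \<in> D1_component A d"
    and indep: "\<forall>c. (\<Sum>i<r. der_scale (c i) (\<theta> i)) = 0 \<longrightarrow> (\<forall>i<r. c i = 0)"
    and gen: "\<forall>e. \<forall>\<eta>\<in>D1_component A e. \<exists>u c. u \<notin> p \<and> der_scale u \<eta> = (\<Sum>i<r. der_scale (c i) (\<theta> i))"
    by (elim exE conjE)
  \<comment> \<open>Expressing the defining polynomial times each partial derivative through the
    frame determines the rank \<open>r\<close> and shows that the determinant of the frame is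
    nonzero.\<close>
  have "\<forall>i. \<exists>u c. u \<notin> p \<and>
      der_scale u (der_scale (defining_poly A) (der_of (\<lambda>j. if j = i then 1 else 0))) =
      (\<Sum>i<r. der_scale (c i) (\<theta> i))"
    using gen[rule_format, OF defining_poly_scale[OF A]] by (rule allI)
  from choice[OF this] obtain u where "\<forall>i. \<exists>c. u i \<notin> p \<and>
      der_scale (u i) (der_scale (defining_poly A) (der_of (\<lambda>j. if j = i then 1 else 0))) =
      (\<Sum>j<r. der_scale (c j) (\<theta> j))"
    by (elim exE)
  from choice[OF this] obtain c where "\<forall>i. u i \<notin> p \<and>
      der_scale (u i) (der_scale (defining_poly A) (der_of (\<lambda>j. if j = i then 1 else 0))) =
      (\<Sum>j<r. der_scale (c i j) (\<theta> j))"
    by (elim exE)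
  hence uc: "u i \<notin> p"
    "der_scale (u i) (der_scale (defining_poly A) (der_of (\<lambda>j. if j = i then 1 else 0))) =
      (\<Sum>j<r. der_scale (c i j) (\<theta> j))" for i
    by (simp_all only: simp_thms)
  define q where "q i = u i * defining_poly A" for i
  have q: "q i \<noteq> 0" for i
    using sym_no_zero_divisors[of "u i" "defining_poly A"] uc(1)[of i] Proj_0[OF p]
      defining_poly_nonzero[OF A] by (auto simp: q_def)
  have eq: "(\<Sum>j<r. c i j * \<theta> j (var l)) = (if l = i then q i else 0)" for i l
    using fun_cong[OF uc(2)[of i], of "var l"]
    by (simp add: der_scale_def sum_fun_apply q_def split: if_splits)
  have "card {..<r} \<le> CARD('n)"
  proof (rule rank_le)
    show "\<theta> j \<in> Der" if "j \<in> {..<r}" for j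
      using D1_componentD[OF \<theta>[rule_format, of j]] that by simp
  qed (use indep in auto)
  moreover have "CARD('n) \<le> card {..<r}"
    by (rule rank_ge[of "{..<r}" q c \<theta>]) (use q eq in auto)
  ultimately have r: "r = CARD('n)" by simp
  obtain ix :: "'n \<Rightarrow> nat" where ix: "bij_betw ix UNIV {..<r}"
    using ex_bij_betw_finite_nat[of "UNIV :: 'n set"] by (auto simp: atLeast0LessThan r)
  define \<tau>0 where "\<tau>0 i = \<theta> (ix i)" for i
  have ix_less: "ix i < r" for i using ix by (auto simp: bij_betw_def)
  have jac0: "jac \<tau>0 \<noteq> 0"
  proof (rule jac_nonzero[of q "\<lambda>i j. c i (ix j)"])
    show "(\<Sum>j\<in>UNIV. c i (ix j) * \<tau>0 j (var l)) = (if l = i then q i else 0)" for i l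
      unfolding \<tau>0_def eq[symmetric] by (rule sum.reindex_bij_betw[OF ix])
  qed (rule q)
  let ?T = "{\<theta> \<in> D1 ?A. \<exists>e. \<forall>i. ?b (\<theta> (var i)) \<in> forms I e}"
  have T_span: "D1 ?A \<subseteq> der.span ?T"
  proof (rule D1_span_slices[OF A'])
    fix H assume "H \<in> ?A"
    hence "normal H \<in> W" unfolding W_def by (intro vec.span_base) auto
    thus "?b (hyperplane_form H) \<in> forms I 1" using forms by (simp add: hyperplane_form_normal)
  qed (use \<alpha>\<beta> \<beta>\<alpha> in auto)
  \<comment> \<open>The change of coordinates preserves degrees, so \<open>\<eta>\<close> is
    homogeneous in the original grading too. Multiplied by \<open>?Q\<close> it lies in
    \<open>D1 A\<close>, where the frame applies.\<close>
  have T_gen: "\<exists>u c. u \<notin> p \<and> der_scale u \<eta> = (\<Sum>i\<in>UNIV. der_scale (c i) (\<tau>0 i))" if \<eta>: "\<eta> \<in> ?T" for \<eta>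
  proof -
    obtain e where e: "\<And>i. ?b (\<eta> (var i)) \<in> forms I e" using \<eta> by blast
    have "\<alpha> i \<in> homog 1" for i using \<alpha>[rule_format, of i] linear_form_homog by auto
    hence "?a (?b (\<eta> (var i))) \<in> homog e" for i
      by (rule graded_hom) (rule subsetD[OF forms_subset_homog e])
    hence "\<eta> \<in> D1_component ?A e" using \<eta> \<alpha>\<beta> by (simp add: D1_component_def)
    from complement_poly_scale[OF A this] gen obtain u c where
      "u \<notin> p" "der_scale u (der_scale ?Q \<eta>) = (\<Sum>i<r. der_scale (c i) (\<theta> i))" by blast
    moreover have "(\<Sum>i<r. der_scale (c i) (\<theta> i)) = (\<Sum>i\<in>UNIV. der_scale (c (ix i)) (\<tau>0 i))"
      unfolding \<tau>0_def by (rule sum.reindex_bij_betw[OF ix, symmetric])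
    ultimately have "u * ?Q \<notin> p \<and> der_scale (u * ?Q) \<eta> = (\<Sum>i\<in>UNIV. der_scale (c (ix i)) (\<tau>0 i))"
      using \<open>?Q \<notin> p\<close> by (simp add: Proj_mult[OF p])
    thus ?thesis by (intro exI[of _ "u * ?Q"] exI[of _ "\<lambda>i. c (ix i)"])
  qed
  have T_jac: "\<exists>w z. w \<notin> p \<and> w * jac \<eta> = z * jac \<tau>0" if "range \<eta> \<subseteq> ?T" for \<eta> :: "'n \<Rightarrow> _"
  proof -
    have "\<forall>i. \<exists>u c. u \<notin> p \<and> der_scale u (\<eta> i) = (\<Sum>j\<in>UNIV. der_scale (c j) (\<tau>0 j))"
      by (intro allI T_gen subsetD[OF that]) simp
    from choice[OF this] obtain u where
      "\<forall>i. \<exists>c. u i \<notin> p \<and> der_scale (u i) (\<eta> i) = (\<Sum>j\<in>UNIV. der_scale (c j) (\<tau>0 j))"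
      by (elim exE)
    from choice[OF this] obtain c where
      "\<forall>i. u i \<notin> p \<and> der_scale (u i) (\<eta> i) = (\<Sum>j\<in>UNIV. der_scale (c i j) (\<tau>0 j))"
      by (elim exE)
    hence u: "u i \<notin> p" "der_scale (u i) (\<eta> i) = (\<Sum>j\<in>UNIV. der_scale (c i j) (\<tau>0 j))" for i
      by simp_all
    have "(\<Prod>i\<in>UNIV. u i) * jac \<eta> = det (\<chi> i j. c i j) * jac \<tau>0"
      using jac_product[of "\<lambda>i. der_scale (u i) (\<eta> i)" c \<tau>0, OF u(2)] unfolding jac_scale_all .
    moreover have "(\<Prod>i\<in>UNIV. u i) \<notin> p" using u(1) by (intro Proj_prod[OF _ p]) auto
    ultimately show ?thesis by blast
  qed
  \<comment> \<open>The comparison is now with the frame \<open>\<tau>0\<close>: for a tuple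
    \<open>\<tau>\<close> from \<open>?T\<close> with determinant outside \<open>J\<close>, both
    factors in \<open>w * jac \<tau> = z * jac \<tau>0\<close> lie outside \<open>p\<close>.\<close>
  define J where "J = {f. \<exists>w v. w \<notin> p \<and> v \<in> p \<and> w * f = v * jac \<tau>0}"
  have "\<exists>\<tau> :: 'n \<Rightarrow> _. range \<tau> \<subseteq> ?T \<and> jac \<tau> \<notin> J"
  proof (rule ccontr)
    assume no: "\<not> ?thesis"
    have "jac \<tau>0 \<in> J"
    proof (rule jac_span)
      show "ideal.subspace J"
        unfolding J_def by (rule subspace_local_multiples[OF p Proj_subspace[OF p]])
      show "jac \<tau> \<in> J" if "range \<tau> \<subseteq> ?T" for \<tau> :: "'n \<Rightarrow> _"
        using no that by blast
      have "\<tau>0 i \<in> D1 ?A" for i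
        using \<theta> ix_less[of i] D1_component_subarrangement[OF A, of "\<tau>0 i" d X] D1_componentD
        by (auto simp: \<tau>0_def)
      thus "range \<tau>0 \<subseteq> der.span ?T" using T_span by (intro image_subsetI) (rule subsetD)
    qed
    then obtain w v where "w \<notin> p" "v \<in> p" "w * jac \<tau>0 = v * jac \<tau>0"
      unfolding J_def by (elim CollectE exE conjE)
    thus False using sym_mult_cancel[OF jac0, of w v] by (simp add: mult.commute)
  qed
  then obtain \<tau> :: "'n \<Rightarrow> _" where \<tau>: "range \<tau> \<subseteq> ?T" "jac \<tau> \<notin> J"
    by (elim exE conjE)
  from T_jac[OF \<tau>(1)] obtain w z where wz: "w \<notin> p" "w * jac \<tau> = z * jac \<tau>0" by (elim exE conjE)
  have z: "z \<notin> p"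
  proof
    assume "z \<in> p"
    hence "jac \<tau> \<in> J" unfolding J_def by - (rule CollectI, rule exI[of _ w], rule exI[of _ z], simp add: wz)
    with \<tau>(2) show False by blast
  qed
  have jac\<tau>: "jac \<tau> \<noteq> 0"
  proof
    assume "jac \<tau> = 0"
    hence "z * jac \<tau>0 = 0" using wz(2) by simp
    thus False using sym_no_zero_divisors[of z "jac \<tau>0"] jac0 z Proj_0[OF p] by auto
  qed
  \<comment> \<open>In the new coordinates the determinants of tuples from \<open>?T\<close> are
    forms in \<open>k[y]\<close>, as \<open>forms_dvd_cancel\<close> requires.\<close>
  have T_form: "\<exists>e. ?b (jac \<eta>) \<in> forms I e" if "range \<eta> \<subseteq> ?T" for \<eta> :: "'n \<Rightarrow> _"
  proof -
    have "\<forall>i. \<exists>e. \<forall>j. ?b (\<eta> i (var j)) \<in> forms I e" using that by blast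
    then obtain e where e: "\<And>i j. ?b (\<eta> i (var j)) \<in> forms I (e i)" by metis
    have "det (\<chi> i j. ?b (\<eta> i (var j))) \<in> forms I (\<Sum>i\<in>UNIV. e i)"
      by (rule forms_det) (simp add: e)
    thus ?thesis by (auto simp: jac_def eval_hom_det)
  qed
  obtain e where e: "?b (jac \<tau>) \<in> forms I e" using T_form[OF \<tau>(1)] by blast
  \<comment> \<open>Eliminating \<open>jac \<tau>0\<close> between the relations for
    \<open>\<tau>\<close> and \<open>\<eta>\<close> gives divisibility up to the factor
    \<open>z * w'\<close>. This factor lies outside \<open>p\<close>, so it has a monomial free of
    \<open>y\<close> and can be removed.\<close>
  have T_dvd: "jac \<tau> dvd jac \<eta>" if \<eta>: "range \<eta> \<subseteq> ?T" for \<eta> :: "'n \<Rightarrow> _"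
  proof -
    from T_jac[OF \<eta>] obtain w' z' where wz': "w' \<notin> p" "w' * jac \<eta> = z' * jac \<tau>0" by (elim exE conjE)
    have "z * w' * jac \<eta> = z * (w' * jac \<eta>)" by (simp add: mult_ac)
    also have "\<dots> = z' * (z * jac \<tau>0)" unfolding wz'(2) by (simp add: mult_ac)
    also have "\<dots> = jac \<tau> * (z' * w)" unfolding wz(2)[symmetric] by (simp add: mult_ac)
    finally have "?b (jac \<tau>) dvd ?b (z * w' * jac \<eta>)" by (intro dvd_b) simp
    hence "?b (jac \<tau>) dvd ?b (z * w') * ?b (jac \<eta>)" by (simp add: eval_hom_mult[OF coeff_hom_scalar])
    moreover obtain e' where "?b (jac \<eta>) \<in> forms I e'" using T_form[OF \<eta>] by blast
    moreover have "\<exists>b. slice I (b, 0) (?b (z * w')) \<noteq> 0"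
      using z wz'(1) by (intro slice) (simp add: Proj_mult[OF p])
    ultimately have "?b (jac \<tau>) dvd ?b (jac \<eta>)" by (elim exE) (rule forms_dvd_cancel[OF e])
    thus ?thesis by (rule dvd_a)
  qed
  \<comment> \<open>The multiples of \<open>jac \<tau>\<close> form an ideal, so
    \<open>jac_span\<close> extends the divisibility from tuples in \<open>?T\<close> to tuples in
    its span.\<close>
  have sub: "ideal.subspace {f. jac \<tau> dvd f}"
    by (rule ideal.subspaceI) auto
  have "jac \<tau> dvd jac \<eta>" if "range \<eta> \<subseteq> D1 ?A" for \<eta> :: "'n \<Rightarrow> _"
  proof -
    have "jac \<eta> \<in> {f. jac \<tau> dvd f}"
      by (rule jac_span[OF sub _ subset_trans[OF that T_span]]) (intro CollectI T_dvd)
    thus ?thesis by simp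
  qed
  moreover have "\<tau> i \<in> D1 ?A" for i using \<tau>(1) by auto
  ultimately show ?thesis
    unfolding free_arrangement_def
    using jac\<tau> by (intro basis_of_jac_dvd[OF subspace_D1 D1_Der, of \<tau>]) auto
qed

theorem corollary3p4:
  fixes A :: "('k::field ^ 'n::finite) set set"
  assumes "arrangement A"
    and "essential A"
  shows "locally_free_arrangement A \<longleftrightarrow>
    locally_free_sheaf proj_topology structure_sheaf (tilde der_scale (D1_component A))"
proof
  interpret graded_module der_scale "D1_component A" by (rule graded_module_D1)
  show "locally_free_sheaf proj_topology structure_sheaf (tilde der_scale (D1_component A))"
    if "locally_free_arrangement A"
    using frame_of_free[OF assms(1) that] by (rule locally_freeI)
  show "locally_free_arrangement A"
    if "locally_free_sheaf proj_topology structure_sheaf (tilde der_scale (D1_component A))"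
    unfolding locally_free_arrangement_def
    using free_of_frames[OF assms(1) locally_free_local_frame[OF that]] by blast
qed

end
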